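(* Let $A\in\mathbb{F}_2[x]$ be bi-unitary perfect with $\omega(A)=4$. Then $A$ or $\overline{A}$ belongs to $\{C_8,\dots,C_{13},D_1,D_2\}$, where $C_8=x^8(x+1)^8M_4M_5$, $C_9=x^8(x+1)^9M_4M_5^2$, $C_{10}=x^7(x+1)^{10}M_1^2M_5$, $C_{11}=x^7(x+1)^{13}M_2^2M_3^2$, $C_{12}=x^9(x+1)^9M_4^2M_5^2$, $C_{13}=x^{14}(x+1)^{14}M_2^2M_3^2$, $D_1=x^4(x+1)^5M_1^4S_1$, $D_2=x^4(x+1)^5M_1^5S_1^2$.
   Context: All polynomials are in $\mathbb{F}_2[x]$. For nonzero $S$, a divisor $D$ of $S$ is unitary if $\gcd(D,S/D)=1$; $\gcd_u(S,T)$ denotes the greatest common unitary divisor of $S$ and $T$. A divisor $D$ of $S$ is bi-unitary if $\gcd_u(D,S/D)=1$. $\sigma^{**}(S)$ denotes the sum of all bi-unitary divisors of $S$, and $S$ is bi-unitary perfect if $\sigma^{**}(S)=S$. $\omega(S)$ is the number of distinct irreducible factors of $S$. $\overline{S}(x)=S(x+1)$. $M_1=1+x+x^2$, $M_2=1+x+x^3$, $M_3=1+x^2+x^3$, $M_4=1+x+x^2+x^3+x^4$, $M_5=1+x^3+x^4$, $S_1=1+x+x^4$. *)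

theory Defs
  imports "HOL-Library.Z2" "HOL-Computational_Algebra.Computational_Algebra"
    "HOL-Computational_Algebra.Field_as_Ring"
begin

text \<open>
  The field \<open>\<F>\<^sub>2\<close> is the library type \<^typ>\<open>bit\<close>. The following instances, analogous to those
  of the theory \<open>Field_as_Ring\<close>, make the library's \<^const>\<open>gcd\<close> and unique factorisation
  available on \<^typ>\<open>bit poly\<close>.
\<close>

instantiation bit ::
  "{unique_euclidean_ring, normalization_euclidean_semiring, normalization_semidom_multiplicative}"
begin

definition [simp]: "normalize_bit = (normalize_field :: bit \<Rightarrow> _)"
definition [simp]: "unit_factor_bit = (unit_factor_field :: bit \<Rightarrow> _)"
definition [simp]: "euclidean_size_bit = (euclidean_size_field :: bit \<Rightarrow> _)"
definition [simp]: "division_segment (x :: bit) = 1"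

instance
proof
  fix a b q r :: bit
  show "euclidean_size r < euclidean_size b \<Longrightarrow> (q * b + r) div b = q" if "b \<noteq> 0"
    using that by (cases r; cases b; simp)
qed (auto simp: dvd_field_iff split: if_splits)

end

instantiation bit :: euclidean_ring_gcd
begin

definition gcd_bit :: "bit \<Rightarrow> bit \<Rightarrow> bit" where
  "gcd_bit = Euclidean_Algorithm.gcd"
definition lcm_bit :: "bit \<Rightarrow> bit \<Rightarrow> bit" where
  "lcm_bit = Euclidean_Algorithm.lcm"
definition Gcd_bit :: "bit set \<Rightarrow> bit" where
  "Gcd_bit = Euclidean_Algorithm.Gcd"
definition Lcm_bit :: "bit set \<Rightarrow> bit" where
  "Lcm_bit = Euclidean_Algorithm.Lcm"

instance by standard (simp_all add: gcd_bit_def lcm_bit_def Gcd_bit_def Lcm_bit_def)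

end

instance bit :: field_gcd ..


definition unitary_divisor :: "bit poly \<Rightarrow> bit poly \<Rightarrow> bool" where
  "unitary_divisor D S \<longleftrightarrow> D dvd S \<and> gcd D (S div D) = 1"

text \<open>
  ``Greatest'' means of greatest degree. For nonzero \<open>S\<close> and \<open>T\<close> there is exactly one such
  common unitary divisor, and it is also the greatest one with respect to divisibility; see
  \<open>gcd_unitary_unique\<close> below.
\<close>

definition gcd_unitary :: "bit poly \<Rightarrow> bit poly \<Rightarrow> bit poly" where
  "gcd_unitary S T = (ARG_MAX degree D. unitary_divisor D S \<and> unitary_divisor D T)"

definition biunitary_divisor :: "bit poly \<Rightarrow> bit poly \<Rightarrow> bool" where
  "biunitary_divisor D S \<longleftrightarrow> D dvd S \<and> gcd_unitary D (S div D) = 1"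

definition sigma_biunitary :: "bit poly \<Rightarrow> bit poly" where
  "sigma_biunitary S = (\<Sum>D | biunitary_divisor D S. D)"

definition biunitary_perfect :: "bit poly \<Rightarrow> bool" where
  "biunitary_perfect S \<longleftrightarrow> S \<noteq> 0 \<and> sigma_biunitary S = S"

text \<open>The only unit of \<^typ>\<open>bit poly\<close> is 1, so distinct irreducible factors are never associated.\<close>

definition omega :: "bit poly \<Rightarrow> nat" where
  "omega S = card {P. irreducible P \<and> P dvd S}"

definition bar :: "bit poly \<Rightarrow> bit poly" where
  "bar S = pcompose S [:1, 1:]"

abbreviation X :: "bit poly" where "X \<equiv> [:0, 1:]"

definition M_1 :: "bit poly" where "M_1 = 1 + X + X^2"
definition M_2 :: "bit poly" where "M_2 = 1 + X + X^3"
definition M_3 :: "bit poly" where "M_3 = 1 + X^2 + X^3"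
definition M_4 :: "bit poly" where "M_4 = 1 + X + X^2 + X^3 + X^4"
definition M_5 :: "bit poly" where "M_5 = 1 + X^3 + X^4"
definition S_1 :: "bit poly" where "S_1 = 1 + X + X^4"

definition C_8 :: "bit poly" where "C_8 = X^8 * (X + 1)^8 * M_4 * M_5"
definition C_9 :: "bit poly" where "C_9 = X^8 * (X + 1)^9 * M_4 * M_5^2"
definition C_10 :: "bit poly" where "C_10 = X^7 * (X + 1)^10 * M_1^2 * M_5"
definition C_11 :: "bit poly" where "C_11 = X^7 * (X + 1)^13 * M_2^2 * M_3^2"
definition C_12 :: "bit poly" where "C_12 = X^9 * (X + 1)^9 * M_4^2 * M_5^2"
definition C_13 :: "bit poly" where "C_13 = X^14 * (X + 1)^14 * M_2^2 * M_3^2"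
definition D_1 :: "bit poly" where "D_1 = X^4 * (X + 1)^5 * M_1^4 * S_1"
definition D_2 :: "bit poly" where "D_2 = X^4 * (X + 1)^5 * M_1^5 * S_1^2"


text \<open>
  Well-definedness: uniqueness of the greatest common unitary divisor, and finiteness of the set
  summed over in \<^const>\<open>sigma_biunitary\<close> (a sum over an infinite set would be 0 by convention).
\<close>

lemma normalize_bit_poly [simp]: "normalize (p :: bit poly) = p"
proof (cases "p = 0")
  case False
  then have "lead_coeff p = 1"
    using bit_not_zero_iff leading_coeff_0_iff by blast
  then have "normalize p = p div 1"
    by (simp only: normalize_poly_def unit_factor_bit_def unit_factor_field_def one_pCons)
  then show ?thesis by simp
qed simp

lemma finite_biunitary_divisors:
  assumes "S \<noteq> 0"
  shows "finite {D. biunitary_divisor D S}"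
proof (rule finite_subset)
  let ?L = "{xs :: bit list. set xs \<subseteq> UNIV \<and> length xs \<le> Suc (degree S)}"
  have "UNIV \<subseteq> {0, 1 :: bit}"
  proof
    fix b :: bit
    show "b \<in> {0, 1}" by (cases b) auto
  qed
  then have "finite (UNIV :: bit set)" by (rule finite_subset) simp
  then show "finite (Poly ` ?L)" by (intro finite_imageI finite_lists_length_le)
  show "{D. biunitary_divisor D S} \<subseteq> Poly ` ?L"
  proof
    fix D assume "D \<in> {D. biunitary_divisor D S}"
    then have "degree D \<le> degree S"
      using assms by (auto simp: biunitary_divisor_def intro: dvd_imp_degree_le)
    then have "coeffs D \<in> ?L" by (cases "D = 0") (auto simp: length_coeffs_degree)
    then show "D \<in> Poly ` ?L" by (intro image_eqI[where x = "coeffs D"]) simp_all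
  qed
qed

lemma unitary_divisor_lcm:
  assumes "S \<noteq> 0" "unitary_divisor D S" "unitary_divisor E S"
  shows "unitary_divisor (lcm D E) S"
proof -
  have dvd: "D dvd S" "E dvd S" and cop: "coprime D (S div D)" "coprime E (S div E)"
    using assms(2,3) by (auto simp: unitary_divisor_def coprime_iff_gcd_eq_1)
  define L where "L = lcm D E"
  have L: "L dvd S" "D dvd L" "E dvd L" "L dvd D * E"
    using dvd by (auto simp: L_def)
  have "S div L dvd S div D" "S div L dvd S div E"
    using L dvd assms(1) by (auto simp: div_dvd_div elim!: dvdE)
  then have "coprime D (S div L)" "coprime E (S div L)"
    using cop by (meson coprime_divisors dvd_refl)+
  then have "coprime (D * E) (S div L)" by simp
  then have "coprime L (S div L)" using L(4) by (meson coprime_divisors dvd_refl)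
  then show ?thesis using L(1) by (simp add: unitary_divisor_def L_def coprime_iff_gcd_eq_1)
qed

lemma gcd_unitary_unique:
  assumes "S \<noteq> 0" "T \<noteq> 0"
  shows "unitary_divisor D S \<and> unitary_divisor D T \<and>
           (\<forall>E. unitary_divisor E S \<and> unitary_divisor E T \<longrightarrow> degree E \<le> degree D)
         \<longleftrightarrow> D = gcd_unitary S T"
    and "unitary_divisor E S \<Longrightarrow> unitary_divisor E T \<Longrightarrow> E dvd gcd_unitary S T"
proof -
  let ?P = "\<lambda>D. unitary_divisor D S \<and> unitary_divisor D T"
  let ?M = "\<lambda>D. ?P D \<and> (\<forall>E. ?P E \<longrightarrow> degree E \<le> degree D)"
  have "?P 1" by (simp add: unitary_divisor_def)
  moreover have "\<forall>E. ?P E \<longrightarrow> degree E < Suc (degree S)"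
    using assms(1) by (auto simp: unitary_divisor_def less_Suc_eq_le intro: dvd_imp_degree_le)
  ultimately have max: "?M (gcd_unitary S T)"
    unfolding gcd_unitary_def by (rule arg_max_nat_lemma)
  have dvd: "E dvd D" if D: "?M D" and E: "?P E" for D E
  proof -
    have "?P (lcm D E)" using unitary_divisor_lcm assms D E by blast
    then have "degree (lcm D E) \<le> degree D" "lcm D E \<noteq> 0"
      using D assms by (auto simp: unitary_divisor_def)
    moreover obtain k where k: "lcm D E = D * k" using dvd_lcm1[of D E] by (elim dvdE)
    ultimately have "degree k = 0" "k \<noteq> 0" by (auto simp: degree_mult_eq)
    then have "is_unit k" by (simp add: is_unit_iff_degree)
    then show ?thesis using k by (metis dvd_lcm2 dvd_mult_unit_iff)
  qed
  have "?M D \<longleftrightarrow> D = gcd_unitary S T"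
    using dvd max associated_eqI[of D "gcd_unitary S T"] by auto
  then show "unitary_divisor D S \<and> unitary_divisor D T \<and>
           (\<forall>E. unitary_divisor E S \<and> unitary_divisor E T \<longrightarrow> degree E \<le> degree D)
         \<longleftrightarrow> D = gcd_unitary S T"
    by (simp only: conj_assoc)
  show "E dvd gcd_unitary S T" if "unitary_divisor E S" "unitary_divisor E T"
    using dvd max that by blast
qed

end

theory Submission
  imports Defs
begin

text \<open>
  Write \<open>geo Z n = 1 + Z + \<dots> + Z ^ (n - 1)\<close> and \<open>Y = X + 1\<close>. Multiplicativity and the formula
  \<open>\<sigma>\<^sup>*\<^sup>*(Z\<^sup>a) = (1 + Z) * geo Z ((a + 1) div 2) * geo Z (a div 2 + 1)\<close> show that \<open>1 + Z\<close> divides \<open>A\<close> for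
  every prime factor \<open>Z\<close>. Hence \<open>A = X\<^sup>a Y\<^sup>b P\<^sup>c Q\<^sup>d\<close>, where (with \<open>degree P \<le> degree Q\<close>)
  \<open>P = 1 + X\<^sup>i Y\<^sup>j\<close> and \<open>Q = 1 + X\<^sup>k Y\<^sup>l P\<^sup>e\<close>.

  Splitting off powers of two from the indices leaves the factors \<open>geo Z u\<close> with \<open>u\<close> odd. Such a
  \<open>geo Q u\<close> is trivial, \<open>geo P u\<close> is \<open>1\<close> or \<open>Q\<close> by a derivative argument, and \<open>geo X u\<close> is squarefree,
  so that it lies in \<open>{1, P, Q, P * Q}\<close>. The shapes of \<open>P\<close> and \<open>Q\<close>, invariance under reciprocal
  polynomials and the fact that \<open>geo Z (2 ^ n + 1)\<close> is irreducible only for \<open>n \<le> 2\<close> leave few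
  possibilities for \<open>u\<close>, \<open>P\<close> and \<open>Q\<close>. In each of them, comparing the exponents of \<open>X\<close>, \<open>Y\<close>, \<open>P\<close>
  and \<open>Q\<close> in \<open>\<sigma>\<^sup>*\<^sup>*(A) = A\<close> determines \<open>a\<close>, \<open>b\<close>, \<open>c\<close> and \<open>d\<close>.
\<close>

section \<open>Polynomials over the field with two elements\<close>

text \<open>The order \<open>degree P \<le> degree Q\<close> is what keeps \<open>Q\<close> out of
  \<open>1 + P\<close>. No degree is bounded at first: comparing
  \<open>1 + geo Z u = Z * geo Z (u - 1)\<close> with the known factors of \<open>1 + P\<close> or
  \<open>1 + Q\<close> makes an index descend until the irreducibility bound applies. One infinite
  family survives this descent, \<open>P = geo X w\<close> and
  \<open>Q = geo X (2 ^ m * w + 1)\<close> with \<open>w\<close> 3 or 5. Apart from index 7, which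
  factors, its members are not tested for irreducibility but refuted by the exponent equations
  modulo 4. The equations can be solved by cases because every \<open>geo Q u\<close> is trivial, so
  \<open>d\<close> is 2 or one less than a power of two, and an even \<open>d\<close> must be 2. The
  same holds for \<open>c\<close> unless some \<open>geo P u\<close> equals \<open>Q\<close>; this
  dichotomy separates the \<open>C\<close> solutions from \<open>D_1\<close> and \<open>D_2\<close>.
  Since \<open>bar\<close> exchanges \<open>X\<close> and \<open>Y\<close>, only sums in
  \<open>X\<close> have to be studied.\<close>

lemma bit_poly_add_self [simp]: "p + p = (0 :: bit poly)"
proof (rule poly_eqI)
  fix n
  show "coeff (p + p) n = coeff 0 n"
    by (simp only: coeff_add coeff_0) (cases "coeff p n"; simp)
qed

lemma bit_poly_add_self_left [simp]: "p + (p + q) = (q :: bit poly)"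
  by (simp add: add.assoc[symmetric])

lemma bit_poly_uminus [simp]: "- p = (p :: bit poly)"
  using bit_poly_add_self[of p] by (rule minus_unique)

lemma bit_poly_diff [simp]: "p - q = p + (q :: bit poly)"
  by (simp only: diff_conv_add_uminus bit_poly_uminus)

lemma bit_poly_two [simp]: "(2 :: bit poly) = 0"
  using bit_poly_add_self[of 1] by (simp only: one_add_one)

lemma bit_poly_add_eq_iff: "p + q = r \<longleftrightarrow> p = q + (r :: bit poly)"
  by (metis bit_poly_add_self_left add.commute)

lemma prime_bit_poly_iff: "prime p \<longleftrightarrow> irreducible (p :: bit poly)"
  by (metis field_poly_irreducible_imp_prime normalize_bit_poly prime_def prime_elem_imp_irreducible)

lemma bit_poly_dvd_antisym: "p dvd q \<Longrightarrow> q dvd p \<Longrightarrow> p = (q :: bit poly)"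
  by (rule associated_eqI) simp_all

lemma is_unit_bit_poly_iff: "is_unit (p :: bit poly) \<longleftrightarrow> p = 1"
  using bit_poly_dvd_antisym[of p 1] by auto

lemma prime_degree_pos: "prime p \<Longrightarrow> degree (p :: bit poly) > 0"
  by (metis is_unit_iff_degree not_prime_0 not_prime_unit neq0_conv)

lemma bit_poly_dvd_degree_eq:
  assumes "p dvd q" "degree q \<le> degree p" "q \<noteq> (0 :: bit poly)"
  shows "p = q"
proof -
  obtain r where r: "q = p * r" using assms(1) by (elim dvdE)
  then have "degree r = 0" "r \<noteq> 0" using assms by (auto simp: degree_mult_eq)
  then have "r = 1" by (metis is_unit_bit_poly_iff is_unit_iff_degree)
  then show ?thesis using r by simp
qed

lemma dvd_prime_power_bit_poly:
  assumes "prime p" "q dvd p ^ n"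
  shows "\<exists>m\<le>n. q = (p :: bit poly) ^ m"
  using divides_primepow[OF assms] normalize_bit_poly by metis

lemma power_two_power_add: "(p + q) ^ (2 ^ k) = p ^ (2 ^ k) + (q :: bit poly) ^ (2 ^ k)"
proof (induction k)
  case (Suc k)
  have "(p + q) ^ (2 ^ Suc k) = ((p + q) ^ (2 ^ k))\<^sup>2"
    by (simp add: power_mult[symmetric] mult.commute)
  also have "\<dots> = p ^ (2 ^ Suc k) + q ^ (2 ^ Suc k)"
    by (simp add: Suc power2_sum power_mult[symmetric] mult.commute)
  finally show ?case .
qed simp

lemma of_nat_bit_poly: "(of_nat n :: bit poly) = (if odd n then 1 else 0)"
  by (induction n) auto

section \<open>The sum of bi-unitary divisors\<close>

text \<open>With \<open>S = D * E\<close>, coprimality means that no prime of \<open>D\<close> is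
  left in \<open>E\<close>. This turns the gcd condition into one that is checked prime by
  prime.\<close>

lemma unitary_divisor_iff_multiplicity:
  assumes "S \<noteq> 0"
  shows "unitary_divisor D S \<longleftrightarrow>
    D dvd S \<and> (\<forall>p. prime p \<longrightarrow> p dvd D \<longrightarrow> multiplicity p D = multiplicity p S)"
proof (cases "D dvd S")
  case True
  then obtain E where S: "S = D * E" by (elim dvdE)
  then have nz: "D \<noteq> 0" "E \<noteq> 0" using assms by auto
  have "coprime D E \<longleftrightarrow> (\<forall>p. prime p \<longrightarrow> p dvd D \<longrightarrow> \<not> p dvd E)"
  proof safe
    fix p assume "coprime D E" "prime p" "p dvd D" "p dvd E"
    then show False by (meson coprime_common_divisor not_prime_unit)
  next
    assume h: "\<forall>p. prime p \<longrightarrow> p dvd D \<longrightarrow> \<not> p dvd E"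
    show "coprime D E"
    proof (rule ccontr)
      assume "\<not> coprime D E"
      then have "gcd D E \<noteq> 0" "\<not> is_unit (gcd D E)" using nz by (auto simp: coprime_iff_gcd_eq_1 is_unit_bit_poly_iff)
      then obtain p where "prime p" "p dvd gcd D E" by (metis prime_divisorE)
      then show False using h by auto
    qed
  qed
  moreover have "multiplicity p D = multiplicity p S \<longleftrightarrow> \<not> p dvd E" if "prime p" for p
    using that nz by (simp add: S prime_elem_multiplicity_mult_distrib prime_elem_multiplicity_eq_zero_iff)
  ultimately show ?thesis
    using nz S by (simp add: unitary_divisor_def coprime_iff_gcd_eq_1[symmetric])
qed (simp add: unitary_divisor_def)

text \<open>If a prime of \<open>D\<close> has equal multiplicity in \<open>D\<close> and
  \<open>S div D\<close>, its full power is a common unitary divisor; conversely any prime of a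
  common unitary divisor has equal multiplicity in both. Equal multiplicities mean that
  \<open>D\<close> takes exactly half of that prime from \<open>S\<close>.\<close>

lemma biunitary_divisor_iff:
  assumes "S \<noteq> 0"
  shows "biunitary_divisor D S \<longleftrightarrow>
    D dvd S \<and> (\<forall>p. prime p \<longrightarrow> p dvd D \<longrightarrow> multiplicity p S \<noteq> 2 * multiplicity p D)"
proof (cases "D dvd S")
  case True
  then obtain E where S: "S = D * E" by (elim dvdE)
  then have nz: "D \<noteq> 0" "E \<noteq> 0" using assms by auto
  have eq: "multiplicity p S = multiplicity p D + multiplicity p E" if "prime p" for p
    using that nz by (simp add: S prime_elem_multiplicity_mult_distrib)
  have div: "S div D = E" using nz by (simp add: S)
  have "gcd_unitary D E = 1 \<longleftrightarrow>
    (\<forall>p. prime p \<longrightarrow> p dvd D \<longrightarrow> multiplicity p D \<noteq> multiplicity p E)"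
  proof safe
    fix p assume p: "prime p" "p dvd D" "multiplicity p D = multiplicity p E" and g: "gcd_unitary D E = 1"
    let ?m = "multiplicity p D"
    have m: "?m > 0" using p(1,2) nz by (simp add: prime_multiplicity_gt_zero_iff)
    have 1: "multiplicity q (p ^ ?m) = multiplicity q R"
      if "prime q" "q dvd p ^ ?m" "?m = multiplicity p R" for q R
    proof -
      have "q = p" using that p(1) by (meson prime_dvd_power primes_dvd_imp_eq)
      then show ?thesis using that p(1) by simp
    qed
    have "unitary_divisor (p ^ ?m) D" "unitary_divisor (p ^ ?m) E"
      using 1[of _ D] 1[of _ E] p(3) nz multiplicity_dvd[of p D] multiplicity_dvd[of p E]
      by (simp_all add: unitary_divisor_iff_multiplicity)
    then have "p ^ ?m dvd 1" using gcd_unitary_unique(2)[OF nz] g by metis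
    then show False using p(1) m by (metis dvd_power dvd_trans not_prime_unit)
  next
    assume h: "\<forall>p. prime p \<longrightarrow> p dvd D \<longrightarrow> multiplicity p D \<noteq> multiplicity p E"
    define C where "C = gcd_unitary D E"
    have C: "unitary_divisor C D" "unitary_divisor C E"
      using gcd_unitary_unique(1)[OF nz, of C] by (auto simp: C_def)
    show "gcd_unitary D E = 1"
    proof (rule ccontr)
      assume "gcd_unitary D E \<noteq> 1"
      then have "\<not> is_unit C" by (simp add: is_unit_bit_poly_iff C_def)
      moreover have "C \<noteq> 0" using C nz by (auto simp: unitary_divisor_def)
      ultimately obtain p where p: "prime p" "p dvd C" by (metis prime_divisorE)
      then have "multiplicity p D = multiplicity p E" "p dvd D"
        using C nz by (auto simp: unitary_divisor_iff_multiplicity)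
      then show False using h p by blast
    qed
  qed
  then show ?thesis using True eq by (auto simp: biunitary_divisor_def div)
qed (simp add: biunitary_divisor_def)

lemma biunitary_divisor_mult:
  assumes cop: "coprime S T" and nz: "S \<noteq> 0" "T \<noteq> 0" and dvd: "D dvd S" "E dvd T"
  shows "biunitary_divisor (D * E) (S * T) \<longleftrightarrow> biunitary_divisor D S \<and> biunitary_divisor E T"
proof -
  have nz': "D \<noteq> 0" "E \<noteq> 0" using nz dvd by auto
  have S: "multiplicity p T = 0" "multiplicity p E = 0" "\<not> p dvd E" if "prime p" "p dvd S" for p
  proof -
    have T: "\<not> p dvd T" using that cop by (meson coprime_common_divisor not_prime_unit)
    then show "\<not> p dvd E" using dvd by (meson dvd_trans)
    then show "multiplicity p T = 0" "multiplicity p E = 0"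
      using T by (auto intro: not_dvd_imp_multiplicity_0)
  qed
  have T: "multiplicity p S = 0" "multiplicity p D = 0" "\<not> p dvd D" if "prime p" "p dvd T" for p
  proof -
    have T: "\<not> p dvd S" using that cop by (meson coprime_common_divisor not_prime_unit)
    then show "\<not> p dvd D" using dvd by (meson dvd_trans)
    then show "multiplicity p S = 0" "multiplicity p D = 0"
      using T by (auto intro: not_dvd_imp_multiplicity_0)
  qed
  have *: "(prime p \<longrightarrow> p dvd D * E \<longrightarrow> multiplicity p (S * T) \<noteq> 2 * multiplicity p (D * E)) \<longleftrightarrow>
    (prime p \<longrightarrow> p dvd D \<longrightarrow> multiplicity p S \<noteq> 2 * multiplicity p D) \<and>
    (prime p \<longrightarrow> p dvd E \<longrightarrow> multiplicity p T \<noteq> 2 * multiplicity p E)" for p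
  proof (cases "prime p")
    case True
    then have m: "multiplicity p (S * T) = multiplicity p S + multiplicity p T"
      "multiplicity p (D * E) = multiplicity p D + multiplicity p E"
      "p dvd D * E \<longleftrightarrow> p dvd D \<or> p dvd E"
      using nz nz' by (auto simp: prime_elem_multiplicity_mult_distrib prime_dvd_mult_iff)
    consider "p dvd D" | "p dvd E" | "\<not> p dvd D" "\<not> p dvd E" by blast
    then show ?thesis
    proof cases
      case 1
      then have "p dvd S" using dvd by (meson dvd_trans)
      then show ?thesis using S[OF True] m by auto
    next
      case 2
      then have "p dvd T" using dvd by (meson dvd_trans)
      then show ?thesis using T[OF True] m by auto
    qed (use m in auto)
  qed simp
  show ?thesis
    using nz dvd * by (simp add: biunitary_divisor_iff mult_dvd_mono) blast
qed

text \<open>Bi-unitarity is a condition at each prime separately, so over coprime \<open>S\<close>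
  and \<open>T\<close> the bi-unitary divisors of \<open>S * T\<close> are the products of those of
  \<open>S\<close> and \<open>T\<close>, each in one way only.\<close>

lemma sigma_biunitary_mult:
  assumes cop: "coprime S T" and nz: "S \<noteq> 0" "T \<noteq> 0"
  shows "sigma_biunitary (S * T) = sigma_biunitary S * sigma_biunitary T"
proof -
  let ?B = "\<lambda>S. {D. biunitary_divisor D S}"
  have "bij_betw (\<lambda>(D, E). D * E) (?B S \<times> ?B T) (?B (S * T))"
  proof (rule bij_betwI')
    fix u v assume "u \<in> ?B S \<times> ?B T" "v \<in> ?B S \<times> ?B T"
    then obtain D E D' E' where uv: "u = (D, E)" "v = (D', E')"
      and d: "D dvd S" "D' dvd S" "E dvd T" "E' dvd T"
      by (auto simp: biunitary_divisor_def)
    have cop': "coprime D E'" "coprime D' E" "coprime E D'" "coprime E' D"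
      using cop d by (meson coprime_divisors coprime_commute)+
    have "D = D' \<and> E = E'" if eq: "D * E = D' * E'"
    proof (intro conjI bit_poly_dvd_antisym)
      show "D dvd D'" using cop' eq by (metis coprime_dvd_mult_left_iff dvd_triv_left)
      show "D' dvd D" using cop' eq by (metis coprime_dvd_mult_left_iff dvd_triv_left)
      show "E dvd E'" using cop' eq by (metis coprime_dvd_mult_right_iff dvd_triv_right)
      show "E' dvd E" using cop' eq by (metis coprime_dvd_mult_right_iff dvd_triv_right)
    qed
    then show "((case u of (D, E) \<Rightarrow> D * E) = (case v of (D, E) \<Rightarrow> D * E)) = (u = v)"
      by (auto simp: uv)
  next
    fix u assume "u \<in> ?B S \<times> ?B T"
    then show "(case u of (D, E) \<Rightarrow> D * E) \<in> ?B (S * T)"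
      using biunitary_divisor_mult[OF cop nz] by (auto simp: biunitary_divisor_def)
  next
    fix C assume C: "C \<in> ?B (S * T)"
    then obtain D E where "C = D * E" "D dvd S" "E dvd T"
      using division_decomp by (metis biunitary_divisor_def mem_Collect_eq)
    then show "\<exists>u\<in>?B S \<times> ?B T. C = (case u of (D, E) \<Rightarrow> D * E)"
      using C biunitary_divisor_mult[OF cop nz] by auto
  qed
  then have "sigma_biunitary (S * T) = (\<Sum>(D, E)\<in>?B S \<times> ?B T. D * E)"
    by (simp add: sigma_biunitary_def sum.reindex_bij_betw[symmetric] case_prod_unfold)
  then show ?thesis
    by (simp add: sigma_biunitary_def sum_product sum.cartesian_product)
qed

lemma sigma_biunitary_prod_prime_powers:
  assumes "finite F" "\<And>p. p \<in> F \<Longrightarrow> prime p"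
  shows "sigma_biunitary (\<Prod>p\<in>F. p ^ f p) = (\<Prod>p\<in>F. sigma_biunitary (p ^ f p))"
  using assms
proof (induction F rule: finite_induct)
  case empty
  have "biunitary_divisor D 1 \<longleftrightarrow> D = 1" for D
    using biunitary_divisor_iff[of 1 D] by (auto simp: is_unit_bit_poly_iff)
  then show ?case by (simp add: sigma_biunitary_def)
next
  case (insert q F)
  have "coprime (q ^ f q) (\<Prod>p\<in>F. p ^ f p)"
    using insert
    by (intro prod_coprime_right)
      (metis coprime_power_left_iff coprime_power_right_iff insertCI primes_coprime)
  moreover have "q \<noteq> 0" "0 \<notin> F" using insert.prems not_prime_0 by blast+
  moreover from this have "(\<Prod>p\<in>F. p ^ f p) \<noteq> 0" using insert.hyps by auto
  ultimately show ?case using insert by (simp add: sigma_biunitary_mult)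
qed

definition geo :: "bit poly \<Rightarrow> nat \<Rightarrow> bit poly" where
  "geo Z n = (\<Sum>i<n. Z ^ i)"

lemma geo_0 [simp]: "geo Z 0 = 0" and geo_1 [simp]: "geo Z (Suc 0) = 1"
  and geo_Suc: "geo Z (Suc n) = geo Z n + Z ^ n"
  by (simp_all add: geo_def)

lemma geo_Suc': "geo Z (Suc n) = 1 + Z * geo Z n"
  by (simp add: geo_def sum.lessThan_Suc_shift sum_distrib_left del: sum.lessThan_Suc)

lemma geo_mult: "(1 + Z) * geo Z n = 1 + Z ^ n"
proof (induction n)
  case (Suc n)
  then show ?case by (simp add: geo_Suc algebra_simps)
qed simp

text \<open>Only the middle power of \<open>p\<close>, present for even \<open>a\<close>, fails to
  be bi-unitary. After multiplication by \<open>1 + p\<close> the sum telescopes to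
  \<open>(1 + p ^ (n + 1))\<^sup>2\<close> for \<open>a = 2 * n + 1\<close> and to
  \<open>(1 + p ^ n) * (1 + p ^ (n + 1))\<close> for \<open>a = 2 * n\<close>.\<close>

lemma sigma_biunitary_prime_power:
  assumes p: "prime p" and a: "a > 0"
  shows "sigma_biunitary (p ^ a) = (1 + p) * geo p ((a + 1) div 2) * geo p (a div 2 + 1)"
proof -
  have p0: "p \<noteq> 0" "p \<noteq> 1" using p by auto
  have inj: "inj_on (\<lambda>i. p ^ i) A" for A
  proof (rule inj_onI)
    fix i k assume "p ^ i = p ^ k"
    then show "i = k" using p by (metis multiplicity_prime_power prime_imp_prime_elem)
  qed
  let ?I = "{i. i \<le> a \<and> 2 * i \<noteq> a}"
  have "biunitary_divisor D (p ^ a) \<longleftrightarrow> D \<in> (\<lambda>i. p ^ i) ` ?I" for D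
  proof
    assume D: "biunitary_divisor D (p ^ a)"
    then obtain m where m: "m \<le> a" "D = p ^ m"
      using dvd_prime_power_bit_poly[OF p] unfolding biunitary_divisor_def by blast
    have "2 * m \<noteq> a"
    proof
      assume "2 * m = a"
      then have "p dvd D" "multiplicity p (p ^ a) = 2 * multiplicity p D"
        using m a p by auto
      moreover have "multiplicity p (p ^ a) \<noteq> 2 * multiplicity p D" if "p dvd D"
        by (rule biunitary_divisor_iff[OF power_not_zero[OF p0(1)], THEN iffD1, OF D,
              THEN conjunct2, rule_format, OF p that])
      ultimately show False by metis
    qed
    then show "D \<in> (\<lambda>i. p ^ i) ` ?I" using m by auto
  next
    assume "D \<in> (\<lambda>i. p ^ i) ` ?I"
    then obtain m where m: "m \<le> a" "2 * m \<noteq> a" "D = p ^ m" by auto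
    have q: "q = p" if "prime q" "q dvd p ^ m" for q
      using that p by (meson prime_dvd_power primes_dvd_imp_eq)
    show "biunitary_divisor D (p ^ a)"
      unfolding biunitary_divisor_iff[OF power_not_zero[OF p0(1)]]
    proof (intro conjI allI impI)
      show "D dvd p ^ a" using m by (simp add: le_imp_power_dvd)
      fix q assume "prime q" "q dvd D"
      then show "multiplicity q (p ^ a) \<noteq> 2 * multiplicity q D" using q[of q] m p by simp
    qed
  qed
  then have "sigma_biunitary (p ^ a) = (\<Sum>i\<in>?I. p ^ i)"
    by (simp add: sigma_biunitary_def sum.reindex[OF inj])
  also have "\<dots> = (1 + p) * geo p ((a + 1) div 2) * geo p (a div 2 + 1)"
  proof (cases "even a")
    case False
    then obtain n where n: "a = 2 * n + 1" by (elim oddE)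
    have "?I = {..<2 * (n + 1)}"
    proof (intro set_eqI)
      fix i
      show "i \<in> ?I \<longleftrightarrow> i \<in> {..<2 * (n + 1)}" unfolding n mem_Collect_eq lessThan_iff by presburger
    qed
    then have "(1 + p) * (\<Sum>i\<in>?I. p ^ i) = 1 + p ^ (2 * (n + 1))"
      by (simp only: geo_mult[symmetric] geo_def)
    also have "\<dots> = (1 + p ^ (n + 1))\<^sup>2"
      by (simp only: power_even_eq power2_sum) simp
    also have "\<dots> = (1 + p) * ((1 + p) * geo p ((a + 1) div 2) * geo p (a div 2 + 1))"
      unfolding geo_mult[symmetric] power2_eq_square by (simp add: n mult_ac)
    finally show ?thesis using p0 by (simp add: add_eq_0_iff)
  next
    case True
    then obtain n where n: "a = 2 * n" by (elim evenE)
    then have I: "{..<2 * n + 1} = insert n ?I" "n \<notin> ?I" by auto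
    have "geo p (2 * n + 1) = p ^ n + (\<Sum>i\<in>?I. p ^ i)"
      unfolding geo_def I(1) using I(2) by (subst sum.insert) auto
    then have "(\<Sum>i\<in>?I. p ^ i) = p ^ n + geo p (2 * n + 1)" by simp
    then have "(1 + p) * (\<Sum>i\<in>?I. p ^ i) = (1 + p) * p ^ n + (1 + p ^ (2 * n + 1))"
      by (simp only: distrib_left geo_mult)
    also have "\<dots> = (1 + p ^ n) * (1 + p ^ (n + 1))"
      by (simp add: algebra_simps power_add[symmetric] mult_2[symmetric])
    also have "\<dots> = (1 + p) * ((1 + p) * geo p ((a + 1) div 2) * geo p (a div 2 + 1))"
      unfolding geo_mult[symmetric] by (simp add: n mult_ac)
    finally show ?thesis using p0 by (simp add: add_eq_0_iff)
  qed
  finally show ?thesis .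
qed

section \<open>Geometric sums\<close>

lemma geo_add: "geo Z (m + n) = geo Z m + Z ^ m * geo Z n"
  by (induction n) (simp_all add: geo_Suc algebra_simps power_add)

lemma geo_mult_index: "geo Z (m * n) = geo Z m * geo (Z ^ m) n"
proof (induction n)
  case (Suc n)
  then show ?case using geo_add[of Z "m * n" m] by (simp add: geo_Suc algebra_simps power_mult)
qed simp

text \<open>Frobenius gives \<open>1 + Z ^ (2 ^ k * u) = (1 + Z ^ u) ^ (2 ^ k)\<close>; one factor
  \<open>1 + Z\<close> is then cancelled.\<close>

lemma geo_two_power:
  assumes "Z \<noteq> 1"
  shows "geo Z (2 ^ k * u) = (1 + Z) ^ (2 ^ k - 1) * geo Z u ^ (2 ^ k)"
proof -
  have "(1 + Z) * geo Z (2 ^ k * u) = (1 + Z ^ u) ^ (2 ^ k)"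
    by (simp add: geo_mult power_two_power_add power_mult[symmetric] mult.commute)
  also have "\<dots> = (1 + Z) ^ (2 ^ k) * geo Z u ^ (2 ^ k)"
    by (simp add: geo_mult[symmetric] power_mult_distrib)
  also have "\<dots> = (1 + Z) * ((1 + Z) ^ (2 ^ k - 1) * geo Z u ^ (2 ^ k))"
    using power_minus_mult[of "2 ^ k" "1 + Z"] by (simp add: mult_ac)
  finally show ?thesis using assms by (simp add: add_eq_0_iff)
qed

lemma geo_mod_base: "Z dvd geo Z (Suc n) + 1"
  by (simp add: geo_Suc')

lemma prime_dvd_geo_not_dvd_base:
  assumes "prime p" "p dvd geo Z n" "n > 0"
  shows "\<not> p dvd Z"
proof
  assume "p dvd Z"
  then have "p dvd geo Z n + 1" using assms(3) geo_mod_base[of Z "n - 1"] by (metis Suc_pred' dvd_trans)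
  then have "p dvd 1" using assms(2) by (metis dvd_add_right_iff)
  then show False using assms(1) by (meson not_prime_unit)
qed

lemma degree_geo_Suc: "degree Z > 0 \<Longrightarrow> degree (geo Z (Suc n)) = n * degree Z"
proof (cases "n = 0")
  case False
  assume Z: "degree Z > 0"
  then have nz: "Z \<noteq> 0" by auto
  have "degree (geo Z (Suc n)) \<le> n * degree Z" for n
    using nz by (induction n) (auto simp: geo_Suc[of _ "Suc _"] degree_power_eq degree_mult_eq intro!: degree_add_le)
  from this[of "n - 1"] have "degree (geo Z n) < degree (Z ^ n)"
    using False Z nz by (cases n) (auto simp: degree_power_eq degree_mult_eq)
  then show ?thesis using nz by (simp add: geo_Suc degree_add_eq_right degree_power_eq)
qed simp

lemma degree_geo: "degree Z > 0 \<Longrightarrow> degree (geo Z n) = (n - 1) * degree Z"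
  by (cases n) (simp_all add: degree_geo_Suc)

lemma geo_nonzero: "degree Z > 0 \<Longrightarrow> n > 0 \<Longrightarrow> geo Z n \<noteq> 0"
proof
  assume *: "degree Z > 0" "n > 0" "geo Z n = 0"
  then have "n - 1 = 0" using degree_geo[of Z n] by simp
  then show False using * by (cases n) auto
qed

lemma geo_eq_1_iff: "degree Z > 0 \<Longrightarrow> geo Z n = 1 \<longleftrightarrow> n = 1"
proof
  assume *: "degree Z > 0" "geo Z n = 1"
  then have "n - 1 = 0" using degree_geo[of Z n] by simp
  moreover have "n \<noteq> 0" using * by (cases n) auto
  ultimately show "n = 1" by simp
qed simp

lemma geo_eq_geo_iff: "degree Z > 0 \<Longrightarrow> m > 0 \<Longrightarrow> n > 0 \<Longrightarrow> geo Z m = geo Z n \<longleftrightarrow> m = n"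
  using degree_geo[of Z m] degree_geo[of Z n] by auto

lemma pcompose_power_bit: "pcompose (p ^ n) q = pcompose p q ^ n" for p q :: "bit poly"
  by (induction n) (simp_all add: pcompose_mult pcompose_1)

lemma pcompose_geo: "pcompose (geo Z n) q = geo (pcompose Z q) n"
  by (simp add: geo_def pcompose_sum pcompose_power_bit)

lemma pcompose_X [simp]: "pcompose X q = (q :: bit poly)"
  by (simp add: pcompose_pCons)

lemma coeff_X_power: "coeff (X ^ n) m = (if n = m then 1 else 0)"
  by (metis monom_altdef smult_1_left coeff_monom)

lemma coeff_geo_X: "coeff (geo X n) m = (if m < n then 1 else 0)"
  by (simp add: geo_def coeff_sum coeff_X_power)

abbreviation Y :: "bit poly" where "Y \<equiv> [:1, 1:]"

lemma one_plus_X: "1 + X = Y" by (simp add: one_pCons)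

lemma one_plus_Y: "1 + Y = X" by (simp add: one_pCons)

lemma X_plus_one: "X + 1 = Y" by (simp add: one_pCons)

text \<open>A repeated factor of \<open>1 + X ^ u\<close> divides its derivative, which for odd
  \<open>u\<close> is \<open>X ^ (u - 1)\<close> and hence coprime to
  \<open>1 + X ^ u\<close>.\<close>

lemma geo_X_squarefree:
  assumes "odd u" "prime p"
  shows "\<not> p\<^sup>2 dvd geo X u"
proof
  assume "p\<^sup>2 dvd geo X u"
  then have "p\<^sup>2 dvd 1 + X ^ u" using geo_mult[of X u] by (metis dvd_mult)
  then obtain r where r: "1 + X ^ u = p * (p * r)" by (metis dvdE power2_eq_square mult.assoc)
  have "of_nat u * X ^ (u - 1) = pderiv (1 + X ^ u)"
    by (simp add: pderiv_add pderiv_power pderiv_pCons of_nat_poly)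
  also have "\<dots> = p * (pderiv p * r + pderiv (p * r))"
    by (simp add: r pderiv_mult algebra_simps)
  finally have "p dvd X ^ (u - 1)" using assms(1) by (simp add: of_nat_bit_poly)
  then have "p dvd X" using assms(2) by (metis prime_dvd_power)
  then have "p dvd X ^ u" using assms(1) by (metis dvd_power dvd_trans odd_pos)
  then have "p dvd 1" using r by (metis dvd_add_left_iff dvd_triv_left)
  then show False using assms(2) by (meson not_prime_unit)
qed

text \<open>Squaring shifts the summands by one place, so the sum and its square cancel except at
  the two ends.\<close>

lemma trace_square: "(\<Sum>i<m. X ^ (2 ^ i))\<^sup>2 + (\<Sum>i<m. X ^ (2 ^ i)) = X ^ (2 ^ m) + X"
proof (induction m)
  case (Suc m)
  let ?S = "\<Sum>i<m. X ^ (2 ^ i)"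
  have "(?S + X ^ (2 ^ m))\<^sup>2 + (?S + X ^ (2 ^ m)) = (?S\<^sup>2 + ?S) + X ^ (2 ^ m) + X ^ (2 ^ Suc m)"
    by (simp add: power2_sum power_mult[symmetric] mult.commute algebra_simps)
  then show ?case unfolding Suc by (simp add: algebra_simps)
qed simp

text \<open>
  The trace polynomial \<open>\<Sum>i<2k. X ^ (2 ^ i)\<close>, reduced modulo \<open>X ^ (2 ^ k + 1) + 1\<close>, is
  idempotent there. An irreducible \<open>geo Z (2 ^ k + 1)\<close> therefore divides it or its successor
  (evaluated at \<open>Z\<close>), and the degrees leave only the possibility that the two agree up to a constant.
\<close>

lemma prime_geo_two_power_plus_one:
  assumes pr: "prime (geo Z (2 ^ k + 1))" and Z: "degree Z > 0"
  shows "k \<le> 2"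
proof (rule ccontr)
  assume "\<not> k \<le> 2"
  then have k: "k \<ge> 3" by simp
  define N :: nat where "N = 2 ^ k"
  have N8: "8 dvd N" using le_imp_power_dvd[OF k, of "2::nat"] by (simp add: N_def)
  have N: "N \<ge> 8" using power_increasing[OF k, of "2::nat"] by (simp add: N_def)
  \<comment> \<open>\<open>r i\<close> is the residue of \<open>2 ^ i\<close> modulo
    \<open>N + 1\<close>: since \<open>N = 2 ^ k\<close> is -1 there, exponents \<open>i > k\<close>
    give the negative of \<open>2 ^ (i - k)\<close>.\<close>
  define r where "r i = (if i \<le> k then 2 ^ i else N + 1 - 2 ^ (i - k))" for i
  define t where "t = (\<Sum>i<2 * k. X ^ r i)"
  define T where "T = (\<Sum>i<2 * k. X ^ (2 ^ i))"
  let ?M = "1 + X ^ (N + 1)"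
  have M: "?M dvd 1 + X ^ ((N + 1) * m)" for m
    using geo_mult[of "X ^ (N + 1)" m] by (metis dvd_triv_left power_mult)
  have lt: "2 ^ (i - k) < N" if "i > k" "i < 2 * k" for i
    using that by (simp add: N_def)
  have "?M dvd X ^ (2 ^ i) + X ^ r i" if i: "i < 2 * k" for i
  proof (cases "i \<le> k")
    case False
    obtain m where m: "2 ^ (i - k) = Suc m" by (metis Suc_pred' zero_less_power zero_less_numeral)
    have "2 ^ i = N * 2 ^ (i - k)" using False by (simp add: N_def power_add[symmetric])
    then have "2 ^ i = r i + (N + 1) * m" using False lt[of i] i by (simp add: r_def m algebra_simps)
    then have "X ^ (2 ^ i) + X ^ r i = X ^ r i * (1 + X ^ ((N + 1) * m))"
      by (simp only: power_add distrib_left mult_1_right add.commute)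
    then show ?thesis using M by (metis dvd_mult)
  qed (simp add: r_def)
  then have "?M dvd (\<Sum>i<2 * k. X ^ (2 ^ i) + X ^ r i)" by (intro dvd_sum) simp
  then have dT: "?M dvd T + t" by (simp only: T_def t_def sum.distrib)
  \<comment> \<open>\<open>N * N - 1 = (N + 1) * (N - 1)\<close>, so the two end terms of the
    telescoped \<open>T\<^sup>2 + T\<close> agree modulo \<open>X ^ (N + 1) + 1\<close>.\<close>
  have "2 ^ (2 * k) = Suc ((N + 1) * (N - 1))"
    using N by (simp add: N_def power2_eq_square[symmetric] power_mult mult.commute algebra_simps)
  then have "T\<^sup>2 + T = X * (1 + X ^ ((N + 1) * (N - 1)))"
    unfolding T_def trace_square by (simp only: power_Suc distrib_left mult_1_right add.commute)
  then have "?M dvd T\<^sup>2 + T" using M by (metis dvd_mult)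
  moreover have "t * (1 + t) = (T\<^sup>2 + T) + (T + t) * (1 + (T + t))"
    by (simp add: algebra_simps power2_eq_square)
  ultimately have "?M dvd t * (1 + t)" using dT by (metis dvd_add dvd_mult2)
  then have "geo X (N + 1) dvd t * (1 + t)" using geo_mult[of X "N + 1"] by (metis dvd_mult_right)
  then obtain q where "t * (1 + t) = geo X (N + 1) * q" by (elim dvdE)
  then have "pcompose (t * (1 + t)) Z = geo Z (N + 1) * pcompose q Z"
    by (simp add: pcompose_mult pcompose_geo)
  then have "geo Z (N + 1) dvd pcompose t Z * pcompose (1 + t) Z"
    by (simp only: pcompose_mult dvd_triv_left)
  then obtain s where s: "s = t \<or> s = 1 + t" "geo Z (N + 1) dvd pcompose s Z"
    using pr unfolding N_def by (metis prime_dvd_mult_iff)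
  have "r i \<le> N" if "i < 2 * k" for i
    using that one_le_power[of "2::nat" "i - k"] by (auto simp: r_def N_def le_diff_conv intro: power_increasing)
  then have "degree t \<le> N" unfolding t_def by (intro degree_sum_le) (auto simp: degree_power_eq)
  then have "degree s \<le> N" using s(1) by (auto intro: degree_add_le)
  then have deg: "degree (pcompose s Z) \<le> degree (geo Z (N + 1))"
    using Z by (simp add: degree_geo degree_pcompose)
  have "s = 0 \<or> s = geo X (N + 1)"
  proof (cases "pcompose s Z = 0")
    case True
    then show ?thesis using Z by (simp add: pcompose_eq_0_iff)
  next
    case False
    then have "geo Z (N + 1) = pcompose s Z" by (intro bit_poly_dvd_degree_eq s deg)
    then have "pcompose (s - geo X (N + 1)) Z = 0"
      by (simp only: pcompose_diff pcompose_geo pcompose_X diff_self)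
    then show ?thesis using Z by (metis pcompose_eq_0_iff right_minus_eq)
  qed
  \<comment> \<open>Zero and the full geometric sum both have equal coefficients at 1 and 3. In
    \<open>t\<close> they differ: 1 is \<open>r 0\<close>, whereas 3 is no power of two and
    \<open>3 = N + 1 - 2 ^ j\<close> would need \<open>N - 2\<close> to be a power of two, which
    fails for \<open>N \<ge> 8\<close>. For \<open>N = 4\<close> the exponent 3 does occur.\<close>
  then have "coeff s 1 = coeff s 3" using N by (auto simp: coeff_geo_X)
  moreover have "coeff s n = coeff t n" if "n > 0" for n
    using s(1) that by (auto simp only: coeff_add coeff_1 of_bool_def add_0 less_irrefl if_False split: if_split)
  ultimately have eq: "coeff t 1 = coeff t 3" by simp
  have r1: "r i = 1 \<longleftrightarrow> i = 0" if "i < 2 * k" for i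
    using that lt[of i] by (cases "i = 0") (auto simp: r_def)
  have r3: "r i \<noteq> 3" if i: "i < 2 * k" for i
  proof (cases "i \<le> k")
    case True
    have "even ((2::nat) ^ i) \<or> (2::nat) ^ i = 1" by (cases i) auto
    then have "(2::nat) ^ i \<noteq> 3" by (metis numeral_eq_one_iff odd_numeral semiring_norm(86))
    then show ?thesis using True by (simp add: r_def)
  next
    case False
    then obtain m where m: "i - k = Suc m" by (metis Suc_diff_Suc not_le)
    have "N \<noteq> 2 + 2 * 2 ^ m"
    proof (cases m)
      case 0
      then show ?thesis using N by simp
    next
      case (Suc l)
      have "N \<noteq> 2 + 4 * x" for x using N8 by presburger
      from this[of "2 ^ l"] show ?thesis using Suc by simp
    qed
    then show ?thesis using False lt[of i] i N by (simp add: r_def m)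
  qed
  have "coeff t 1 = (\<Sum>i<2 * k. if i = 0 then 1 else 0)"
    unfolding t_def coeff_sum coeff_X_power by (intro sum.cong) (simp_all only: r1 lessThan_iff)
  also have "\<dots> = 1" using k by simp
  finally have "coeff t 1 = 1" .
  moreover have "coeff t 3 = 0"
    unfolding t_def coeff_sum coeff_X_power using r3 by (intro sum.neutral) auto
  ultimately show False using eq by simp
qed

section \<open>Exponents of the prime factors\<close>

lemma bit_poly_eval_cases: "poly (p :: bit poly) c = 0 \<or> poly p c = 1"
  using bit_not_zero_iff by blast

lemma X_dvd_iff: "X dvd p \<longleftrightarrow> poly p 0 = 0"
  using poly_eq_0_iff_dvd[of p 0] by simp

lemma Y_dvd_iff: "Y dvd p \<longleftrightarrow> poly p 1 = 0"
  using poly_eq_0_iff_dvd[of p 1] by simp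

lemma prime_X [simp]: "prime X" and prime_Y [simp]: "prime Y"
  by (simp_all add: prime_bit_poly_iff irreducible_linear_field_poly)

lemma dvd_X_Y_mult_iff:
  assumes "poly R 0 = 1" "poly R 1 = 1"
  shows "R dvd X ^ i * Y ^ j * T \<longleftrightarrow> R dvd T"
proof -
  have "coprime X R" "coprime Y R"
    using assms by (auto intro!: prime_imp_coprime simp: X_dvd_iff Y_dvd_iff)
  then have "coprime R (X ^ i * Y ^ j)" by (simp add: coprime_commute)
  then show ?thesis by (simp only: coprime_dvd_mult_right_iff)
qed

lemma of_nat_bit: "(of_nat n :: bit) = (if odd n then 1 else 0)"
  by (induction n) auto

lemma poly_geo_X_0: "n > 0 \<Longrightarrow> poly (geo X n) 0 = 1"
  by (cases n) (simp_all add: geo_Suc')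

lemma poly_geo_X_1: "poly (geo X n) 1 = (if odd n then 1 else 0)"
  by (simp add: geo_def poly_sum of_nat_bit)

lemma four_prime_powers_eq:
  assumes P: "prime P" "P \<noteq> X" "P \<noteq> Y" and Q: "prime Q" "Q \<noteq> X" "Q \<noteq> Y" and "P \<noteq> Q"
    and eq: "X ^ a * Y ^ b * P ^ c * Q ^ d = X ^ a' * Y ^ b' * P ^ c' * Q ^ d'"
  shows "a = a' \<and> b = b' \<and> c = c' \<and> d = d'"
proof -
  have nz: "P \<noteq> 0" "Q \<noteq> 0" using P Q by auto
  have m: "multiplicity R (X ^ a * Y ^ b * P ^ c * Q ^ d) =
    multiplicity R (X ^ a) + multiplicity R (Y ^ b) + multiplicity R (P ^ c) + multiplicity R (Q ^ d)"
    if "prime R" for R a b c d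
    using that nz by (simp add: prime_elem_multiplicity_mult_distrib)
  have *: "multiplicity R (S ^ n) = (if R = S then n else 0)" if "prime R" "prime S" for R S and n :: nat
    using that by (auto simp: multiplicity_distinct_prime_power)
  have XY: "X \<noteq> Y" by simp
  note ** = P Q P(2,3)[symmetric] Q(2,3)[symmetric] \<open>P \<noteq> Q\<close> \<open>P \<noteq> Q\<close>[symmetric]
  have "a = a'" using arg_cong[OF eq, of "multiplicity X"] ** by (simp add: m *)
  moreover have "b = b'" using arg_cong[OF eq, of "multiplicity Y"] ** by (simp add: m *)
  moreover have "c = c'" using arg_cong[OF eq, of "multiplicity P"] ** by (simp add: m *)
  moreover have "d = d'" using arg_cong[OF eq, of "multiplicity Q"] ** by (simp add: m *)
  ultimately show ?thesis by simp
qed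

lemma even_odd_decomposition: "n > 0 \<Longrightarrow> \<exists>k w. odd w \<and> n = 2 ^ k * (w :: nat)"
proof (induction n rule: less_induct)
  case (less n)
  show ?case
  proof (cases "even n")
    case True
    then obtain m where m: "n = 2 * m" by (elim evenE)
    then have "m < n" "m > 0" using less.prems by auto
    then obtain k w where "odd w" "m = 2 ^ k * w" using less.IH by blast
    then show ?thesis using m by (intro exI[of _ "Suc k"] exI[of _ w]) simp
  qed (auto intro: exI[of _ 0])
qed

lemma two_power_odd_eq:
  assumes "2 ^ k * u = 2 ^ l * (v :: nat)" "odd u" "odd v"
  shows "k = l \<and> u = v"
proof -
  have "multiplicity 2 (2 ^ k * u) = k" "multiplicity 2 (2 ^ l * v) = l"
    using assms(2,3) by (auto intro!: multiplicity_decomposeI)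
  then have "k = l" using assms(1) by simp
  then show ?thesis using assms(1) by simp
qed

text \<open>This is \<open>1 + geo Z u = Z * geo Z (u - 1)\<close> with the power of two split off
  from the even number \<open>u - 1\<close>. Its last factor has the odd index \<open>w < u\<close>,
  which drives the descent on indices.\<close>

lemma one_plus_geo:
  assumes "odd u" "u > 1" "Z \<noteq> 1"
  obtains k w where "k > 0" "odd w" "u = 2 ^ k * w + 1"
    "1 + geo Z u = Z * (1 + Z) ^ (2 ^ k - 1) * geo Z w ^ (2 ^ k)"
proof -
  obtain k w where kw: "odd w" "u - 1 = 2 ^ k * w"
    using even_odd_decomposition[of "u - 1"] assms by auto
  then have u: "u = Suc (2 ^ k * w)" using assms by simp
  have "k > 0" using kw assms by (cases k) auto
  moreover have "1 + geo Z u = Z * (1 + Z) ^ (2 ^ k - 1) * geo Z w ^ (2 ^ k)"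
    unfolding u geo_Suc' geo_two_power[OF assms(3)] by (simp add: mult.assoc)
  ultimately show ?thesis using that kw u by simp
qed

text \<open>
  \<open>exponent_split a K u v \<alpha>\<close> lists the exponents of
  \<open>\<sigma>\<^sup>*\<^sup>*(Z\<^sup>a) = (1 + Z)\<^sup>\<alpha> * (geo Z u)\<^sup>K * geo Z v\<close>. For odd \<open>a\<close> they come from
  \<open>a + 1 = K * u\<close>; for \<open>a = 2 * n\<close>, the even one of \<open>n\<close>, \<open>n + 1\<close> is \<open>K * u\<close> and the odd one is \<open>v\<close>.
\<close>

definition exponent_split :: "nat \<Rightarrow> nat \<Rightarrow> nat \<Rightarrow> nat \<Rightarrow> nat \<Rightarrow> bool" where
  "exponent_split a K u v \<alpha> \<longleftrightarrow> (\<exists>k>0. K = 2 ^ k) \<and> odd u \<and> odd v \<and>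
     (a + 1 = K * u \<and> v = 1 \<and> \<alpha> + 1 = K \<or>
      \<alpha> = K \<and> (a = 2 * v \<and> v + 1 = K * u \<or> a = 2 * (K * u) \<and> v = K * u + 1))"

lemma sigma_biunitary_split:
  assumes "prime Z" "a > 0"
  obtains K u v \<alpha> where "exponent_split a K u v \<alpha>"
    "sigma_biunitary (Z ^ a) = (1 + Z) ^ \<alpha> * geo Z u ^ K * geo Z v"
proof -
  have Z: "Z \<noteq> 1" using assms by auto
  have pw: "(1 + Z) * (1 + Z) ^ (2 ^ k - 1) = (1 + Z) ^ (2 ^ k)" for k :: nat
    using power_minus_mult[of "2 ^ k" "1 + Z"] by (simp add: mult_ac)
  show ?thesis
  proof (cases "even a")
    case False
    then obtain n where n: "a = 2 * n + 1" by (elim oddE)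
    obtain k u where ku: "odd u" "n + 1 = 2 ^ k * u" using even_odd_decomposition[of "n + 1"] by auto
    \<comment> \<open>For odd \<open>a\<close> the two geometric sums coincide, so all exponents
      double: one factor \<open>1 + Z\<close> from the front and \<open>2 ^ k - 1\<close> from each
      sum.\<close>
    have "2 * 2 ^ k - 1 = Suc ((2 ^ k - 1) + (2 ^ k - (1::nat)))"
      using one_le_power[of "2::nat" k] by linarith
    then have "(1 + Z) ^ (2 * 2 ^ k - 1) = (1 + Z) * (1 + Z) ^ (2 ^ k - 1) * (1 + Z) ^ (2 ^ k - 1)"
      by (simp only: power_Suc power_add mult.assoc)
    moreover have "sigma_biunitary (Z ^ a) = (1 + Z) * geo Z (2 ^ k * u) * geo Z (2 ^ k * u)"
      using sigma_biunitary_prime_power[OF assms] ku(2) by (simp add: n)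
    ultimately have "sigma_biunitary (Z ^ a) = (1 + Z) ^ (2 * 2 ^ k - 1) * geo Z u ^ (2 * 2 ^ k) * geo Z 1"
      unfolding geo_two_power[OF Z] by (simp add: mult_2 power_add mult_ac)
    moreover have "exponent_split a (2 * 2 ^ k) u 1 (2 * 2 ^ k - 1)"
      unfolding exponent_split_def using ku n by (auto intro: exI[of _ "Suc k"])
    ultimately show ?thesis using that by blast
  next
    case True
    then obtain n where n: "a = 2 * n" by (elim evenE)
    have s: "sigma_biunitary (Z ^ a) = (1 + Z) * geo Z n * geo Z (n + 1)"
      using sigma_biunitary_prime_power[OF assms] by (simp add: n)
    show ?thesis
    proof (cases "even n")
      case True
      obtain k u where ku: "odd u" "n = 2 ^ k * u"
        using even_odd_decomposition[of n] assms(2) by (auto simp: n)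
      have "k > 0" using ku True by (cases k) auto
      then have "exponent_split a (2 ^ k) u (n + 1) (2 ^ k)"
        unfolding exponent_split_def using ku n True by auto
      moreover have "sigma_biunitary (Z ^ a) = (1 + Z) ^ (2 ^ k) * geo Z u ^ (2 ^ k) * geo Z (n + 1)"
        using pw[of k] unfolding s using geo_two_power[OF Z, of k u] ku(2) by (simp add: mult.assoc[symmetric])
      ultimately show ?thesis using that by blast
    next
      case False
      obtain k u where ku: "odd u" "n + 1 = 2 ^ k * u"
        using even_odd_decomposition[of "n + 1"] by auto
      have "k > 0" using ku False by (cases k) auto
      then have "exponent_split a (2 ^ k) u n (2 ^ k)"
        unfolding exponent_split_def using ku n False by auto
      moreover have "sigma_biunitary (Z ^ a) = (1 + Z) ^ (2 ^ k) * geo Z u ^ (2 ^ k) * geo Z n"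
        unfolding s ku(2) geo_two_power[OF Z] pw[symmetric] by (simp add: mult_ac)
      ultimately show ?thesis using that by blast
    qed
  qed
qed

section \<open>Factorisations of geometric sums in the variable\<close>

lemma X_neq_1: "X \<noteq> 1"
  by (simp add: one_pCons)

text \<open>For odd \<open>w\<close> the sum \<open>geo X w\<close> vanishes neither at 0 nor at 1,
  so it can divide \<open>X ^ i * Y ^ j\<close> only if it is 1. Thus \<open>u - 1\<close> is a
  power of two, and the irreducibility bound applies.\<close>

lemma prime_geo_X_Mersenne:
  assumes "prime (geo X u)" "odd u" "1 + geo X u = X ^ i * Y ^ j"
  shows "u = 3 \<or> u = 5"
proof -
  have "u \<noteq> 1" using assms(1) by auto
  then have u1: "u > 1" using assms(2) by (cases u) auto
  obtain k w where kw: "k > 0" "odd w" "u = 2 ^ k * w + 1"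
    "1 + geo X u = X * (1 + X) ^ (2 ^ k - 1) * geo X w ^ (2 ^ k)"
    using one_plus_geo[OF assms(2) u1 X_neq_1] by blast
  have "geo X w dvd 1 + geo X u" unfolding kw(4) by (intro dvd_mult dvd_power) simp
  then have "geo X w dvd X ^ i * Y ^ j * 1" using assms(3) by simp
  then have "geo X w = 1"
    using kw(2) dvd_X_Y_mult_iff[of "geo X w" i j 1]
    by (simp add: poly_geo_X_0 poly_geo_X_1 odd_pos is_unit_bit_poly_iff)
  then have "w = 1" by (simp add: geo_eq_1_iff)
  then have "prime (geo X (2 ^ k + 1))" using assms(1) kw(3) by simp
  then have "k \<le> 2" by (rule prime_geo_two_power_plus_one) simp
  then have "k = 1 \<or> k = 2" using kw(1) by auto
  then show ?thesis using kw(3) \<open>w = 1\<close> by auto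
qed

section \<open>Reciprocal polynomials\<close>

lemma reflect_poly_one_plus:
  assumes "degree R > 0"
  shows "reflect_poly (1 + R) = X ^ degree R + reflect_poly (R :: bit poly)"
proof (rule poly_eqI)
  fix n
  have d: "degree (1 + R) = degree R" using assms by (simp add: degree_add_eq_right)
  show "coeff (reflect_poly (1 + R)) n = coeff (X ^ degree R + reflect_poly R) n"
    by (auto simp: coeff_reflect_poly d coeff_X_power)
qed

lemma reflect_poly_X_Y: "reflect_poly (X ^ i * Y ^ j) = Y ^ j"
proof -
  have "reflect_poly X = 1" "reflect_poly Y = Y" by (simp_all add: reflect_poly_def one_pCons)
  then show ?thesis by (simp only: reflect_poly_mult reflect_poly_power power_one mult_1_left)
qed

lemma degree_X_Y: "degree (X ^ i * Y ^ j) = i + j"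
  by (simp add: degree_mult_eq degree_power_eq)

lemma reflect_poly_Mersenne:
  assumes "i > 0"
  shows "reflect_poly (1 + X ^ i * Y ^ j) = X ^ (i + j) + Y ^ j"
  using reflect_poly_one_plus[of "X ^ i * Y ^ j"] assms
  by (simp only: degree_X_Y reflect_poly_X_Y)

lemma reflect_poly_geo_X: "reflect_poly (geo X n) = geo X n"
proof (rule poly_eqI)
  fix m
  show "coeff (reflect_poly (geo X n)) m = coeff (geo X n) m"
    by (cases n) (auto simp: coeff_reflect_poly coeff_geo_X degree_geo)
qed

text \<open>With nonzero constant terms, reciprocation keeps degrees and permutes the prime factors
  of the self-reciprocal product, so it either fixes both or swaps them.\<close>

lemma reflect_poly_prime_pair:
  assumes P: "prime P" and Q: "prime Q" and "P \<noteq> Q" "poly P 0 = 1" "poly Q 0 = 1" "degree P \<le> degree Q"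
    and refl: "reflect_poly (P * Q) = P * (Q :: bit poly)"
  shows "reflect_poly P = P \<and> reflect_poly Q = Q \<or> reflect_poly P = Q"
proof -
  have c: "coeff P 0 \<noteq> 0" "coeff Q 0 \<noteq> 0" using assms by (simp_all add: poly_0_coeff_0)
  have d: "degree (reflect_poly P) = degree P" "degree (reflect_poly Q) = degree Q"
    using c by (simp_all add: degree_reflect_poly_eq)
  have nz: "reflect_poly P \<noteq> 0" "reflect_poly Q \<noteq> 0" using P Q by auto
  have r: "reflect_poly P * reflect_poly Q = P * Q" using refl by (simp only: reflect_poly_mult)
  show ?thesis
  proof (cases "P dvd reflect_poly P")
    case True
    then have "P = reflect_poly P" using d nz by (intro bit_poly_dvd_degree_eq) auto
    then show ?thesis using r P by (metis mult_cancel_left not_prime_0)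
  next
    case False
    then have PQ: "P dvd reflect_poly Q" using r P by (metis dvd_triv_left prime_dvd_mult_iff)
    have "\<not> Q dvd reflect_poly Q"
    proof
      assume "Q dvd reflect_poly Q"
      then have "Q = reflect_poly Q" using d nz by (intro bit_poly_dvd_degree_eq) auto
      then show False using PQ P Q \<open>P \<noteq> Q\<close> primes_dvd_imp_eq by metis
    qed
    then have "Q dvd reflect_poly P" using r Q by (metis dvd_triv_right prime_dvd_mult_iff)
    then have "Q = reflect_poly P" using d nz assms(6) by (intro bit_poly_dvd_degree_eq) auto
    then show ?thesis by simp
  qed
qed

lemma bit_poly_add_swap: "a + b = c + d \<Longrightarrow> a + c = b + (d :: bit poly)"
proof -
  assume eq: "a + b = c + d"
  have "a + c = (a + b) + (b + c)" by (simp add: ac_simps)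
  also have "\<dots> = b + d" unfolding eq by (simp add: ac_simps)
  finally show ?thesis .
qed

text \<open>All low coefficients of \<open>geo X u\<close> are 1. The coefficient of
  \<open>X\<close> in \<open>P * Q\<close> forces \<open>j\<close> to be even, because that of
  \<open>Y ^ j\<close> is \<open>j\<close>. Comparing orders at \<open>Y\<close> then gives
  \<open>l = 1\<close> and turns \<open>P\<close> and \<open>Q\<close> into trinomials, and the
  coefficient of \<open>X\<^sup>2\<close> leaves only \<open>j = 2\<close>.\<close>

lemma reciprocal_Mersenne_pair:
  assumes P: "P = 1 + X * Y ^ j" and Q: "Q = 1 + X ^ k * Y ^ l" and pos: "j > 0" "k > 0" "l > 0"
    and refl: "reflect_poly P = Q" and geo: "P * Q = geo X u"
  shows "P = M_2 \<and> Q = M_3"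
proof -
  have Qr: "Q = X ^ (1 + j) + Y ^ j" using reflect_poly_Mersenne[of 1 j] refl P by simp
  have "degree Q \<le> u - 1" and "degree Q = 1 + j"
  proof -
    have "degree (Y ^ j) < degree (X ^ (1 + j))" by (simp add: degree_power_eq degree_mult_eq)
    then show dQ: "degree Q = 1 + j" unfolding Qr by (simp add: degree_add_eq_left degree_power_eq degree_mult_eq)
    then have "Q \<noteq> 0" by auto
    have "degree P = 1 + j"
      unfolding P using degree_X_Y[of 1 j] by (simp add: degree_add_eq_right)
    then have "P \<noteq> 0" by auto
    have "degree (P * Q) = u - 1" by (simp add: geo degree_geo)
    then show "degree Q \<le> u - 1" using \<open>P \<noteq> 0\<close> \<open>Q \<noteq> 0\<close> by (simp add: degree_mult_eq)
  qed
  then have u: "u > 2" using pos by simp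
  have c0: "coeff P 0 = 1" "coeff Q 0 = 1" using pos by (simp_all add: P Q coeff_0_power coeff_mult_0)
  have "coeff P 1 = 1" by (simp add: P coeff_0_power)
  moreover have "coeff (P * Q) 1 = coeff P 0 * coeff Q 1 + coeff P 1 * coeff Q 0"
    by (simp only: coeff_mult One_nat_def sum.atMost_Suc atMost_0 sum.insert finite.emptyI empty_iff
        not_False_eq_True sum.empty add_0_right diff_zero diff_self_eq_0)
  moreover have "coeff (P * Q) 1 = 1" using u by (simp add: geo coeff_geo_X)
  ultimately have Q1: "coeff Q 1 = 0" using c0 by simp
  have "coeff (Y ^ j) 1 = of_nat j"
  proof (induction j)
    case (Suc j)
    have "coeff (Y ^ j) 0 = 1" by (simp add: coeff_0_power)
    then show ?case using Suc by (simp add: algebra_simps)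
  qed simp
  then have "even j" using Q1 pos unfolding Qr by (auto simp: coeff_X_power of_nat_bit split: if_splits)
  then obtain h where h: "j = 2 * h" "h > 0" using pos by (auto elim: evenE)
  have XY: "1 + X ^ (1 + j) = Y ^ j + X ^ k * Y ^ l"
    using Q Qr bit_poly_add_swap[of 1 "X ^ k * Y ^ l" "X ^ (1 + j)" "Y ^ j"] by (simp only: add.commute)
  \<comment> \<open>As \<open>1 + j\<close> is odd, \<open>Y\<close> divides the left side of
    \<open>XY\<close> exactly once, while \<open>Y\<^sup>2\<close> divides
    \<open>Y ^ j\<close>.\<close>
  have "l = 1"
  proof (rule ccontr)
    assume "l \<noteq> 1"
    then have "l \<ge> 2" using pos by simp
    then have "Y\<^sup>2 dvd Y ^ l" "Y\<^sup>2 dvd Y ^ j" using h by (auto intro: le_imp_power_dvd)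
    then have "Y\<^sup>2 dvd 1 + X ^ (1 + j)" unfolding XY by (intro dvd_add dvd_mult)
    then have "Y * Y dvd Y * geo X (1 + j)" unfolding geo_mult[symmetric] one_plus_X power2_eq_square .
    then have "Y dvd geo X (1 + j)" by (subst (asm) dvd_mult_cancel_left) auto
    then show False using h by (simp add: Y_dvd_iff poly_geo_X_1)
  qed
  moreover have "degree Q = k + l"
    unfolding Q using degree_X_Y[of k l] pos by (simp add: degree_add_eq_right)
  ultimately have "k = j" using \<open>degree Q = 1 + j\<close> by simp
  have "Y ^ j = 1 + X ^ j"
  proof -
    have "X ^ k * Y ^ l = X ^ j + X ^ (1 + j)"
      unfolding \<open>l = 1\<close> \<open>k = j\<close> power_one_right one_plus_X[symmetric] distrib_left
      by (simp only: power_add power_one_right mult_1_right mult_1_left mult.commute)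
    then have "1 + X ^ (1 + j) = (Y ^ j + X ^ j) + X ^ (1 + j)" using XY by (simp only: add.assoc)
    then have "1 = Y ^ j + X ^ j" by (simp only: add_right_cancel)
    then show ?thesis by (metis add.commute bit_poly_add_eq_iff)
  qed
  then have P': "P = 1 + X + X ^ (1 + j)"
    by (simp only: P distrib_left mult_1_right power_add power_one_right add.assoc)
  have Q': "Q = 1 + X ^ j + X ^ (1 + j)" using Qr \<open>Y ^ j = 1 + X ^ j\<close> by (simp only: add_ac)
  have "j = 2"
  proof (rule ccontr)
    assume "j \<noteq> 2"
    \<comment> \<open>Then \<open>P * Q\<close> is \<open>1 + X\<close> modulo \<open>X ^ 3\<close>,
      against the coefficient 1 of \<open>X\<^sup>2\<close> in \<open>geo X u\<close>.\<close>
    then have "j \<ge> 3" using h by linarith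
    then obtain g where g: "j = 3 + g" by (metis le_Suc_ex)
    have "(1 + x + x ^ (1 + j)) * (1 + x ^ j + x ^ (1 + j)) =
      1 + x + x ^ 3 * (x ^ Suc g * (1 + x ^ j + x ^ (1 + j)) + (1 + x) * (x ^ g + x ^ Suc g))"
      for x :: "bit poly"
      by (simp add: g algebra_simps power_add numeral_eq_Suc)
    from this[of X] have "P * Q = 1 + X + X ^ 3 * (X ^ Suc g * Q + (1 + X) * (X ^ g + X ^ Suc g))"
      unfolding P' Q' .
    then have "coeff (P * Q) 2 = 0" by (simp add: numeral_eq_Suc)
    then show False using u by (simp add: geo coeff_geo_X)
  qed
  then show ?thesis unfolding P' Q' by (simp add: M_2_def M_3_def numeral_eq_Suc one_pCons)
qed

lemma Y_power_mult_eq: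
  assumes "Y ^ a * R = Y ^ b * S" "poly R 1 = 1" "poly S 1 = 1"
  shows "a = b \<and> R = S"
proof -
  have "multiplicity Y (Y ^ a * R) = a" "multiplicity Y (Y ^ b * S) = b"
    using assms(2,3) by (auto intro!: multiplicity_decomposeI simp: Y_dvd_iff)
  then have "a = b" using assms(1) by simp
  then show ?thesis using assms(1) by simp
qed

text \<open>Self-reciprocity reads \<open>1 + X ^ (i + j) = Y ^ j * (1 + X ^ i)\<close>. With
  \<open>i + j = 2 ^ \<beta> * m\<close> and \<open>i = 2 ^ \<alpha> * n\<close>, the order at
  \<open>Y\<close> gives \<open>2 ^ \<beta> = j + 2 ^ \<alpha>\<close>, so \<beta> exceeds \<alpha>.
  A prime of \<open>geo X m\<close> would occur at least \<open>2 ^ \<beta>\<close> times on the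
  left but, by squarefreeness, at most \<open>2 ^ \<alpha>\<close> times on the right. Hence
  \<open>m = n = 1\<close>. If \<alpha> were positive, \<open>P\<close> would be a square; so
  \<open>P = geo X (2 ^ \<beta> + 1)\<close>.\<close>

lemma self_reciprocal_Mersenne:
  assumes P: "P = 1 + X ^ i * Y ^ j" "prime P" and pos: "i > 0" "j > 0" and refl: "reflect_poly P = P"
  shows "P = geo X 3 \<or> P = geo X 5"
proof -
  have "1 + X ^ i * Y ^ j = X ^ (i + j) + Y ^ j" using reflect_poly_Mersenne[OF pos(1), of j] refl P by simp
  then have eq: "1 + X ^ (i + j) = Y ^ j * (1 + X ^ i)"
    using bit_poly_add_swap[of 1 "X ^ i * Y ^ j" "X ^ (i + j)" "Y ^ j"]
    by (simp only: distrib_left mult_1_right mult_1_left mult.commute add.commute)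
  obtain \<beta> m where m: "odd m" "i + j = 2 ^ \<beta> * m" using even_odd_decomposition[of "i + j"] pos by auto
  obtain \<alpha> n where n: "odd n" "i = 2 ^ \<alpha> * n" using even_odd_decomposition[of i] pos by auto
  have XY: "1 + X ^ (2 ^ k * w) = Y ^ (2 ^ k) * geo X w ^ (2 ^ k)" for k w
  proof -
    have "1 + X ^ (2 ^ k * w) = (1 + X ^ w) ^ (2 ^ k)"
      by (simp add: power_two_power_add power_mult[symmetric] mult.commute)
    then show ?thesis by (simp only: geo_mult[symmetric] one_plus_X power_mult_distrib)
  qed
  have "Y ^ (2 ^ \<beta>) * geo X m ^ (2 ^ \<beta>) = Y ^ (j + 2 ^ \<alpha>) * geo X n ^ (2 ^ \<alpha>)"
    using eq unfolding m(2) unfolding n(2) XY by (simp add: power_add mult_ac)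
  then have \<beta>: "2 ^ \<beta> = j + 2 ^ \<alpha>" and geq: "geo X m ^ (2 ^ \<beta>) = geo X n ^ (2 ^ \<alpha>)"
    using Y_power_mult_eq[of "2 ^ \<beta>" "geo X m ^ (2 ^ \<beta>)" "j + 2 ^ \<alpha>" "geo X n ^ (2 ^ \<alpha>)"] m(1) n(1)
    by (simp_all add: poly_geo_X_1)
  have nz: "geo X m \<noteq> 0" "geo X n \<noteq> 0" using m n by (simp_all add: geo_nonzero odd_pos)
  have "geo X m = 1"
  proof (rule ccontr)
    assume "geo X m \<noteq> 1"
    then obtain p where p: "prime p" "p dvd geo X m"
      using nz by (metis is_unit_bit_poly_iff prime_divisorE)
    have "\<not> multiplicity p (geo X n) \<ge> 2"
      using geo_X_squarefree[OF n(1) p(1)] multiplicity_dvd' by blast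
    moreover have "multiplicity p (geo X m) \<ge> 1"
      using p nz by (simp add: Suc_le_eq prime_multiplicity_gt_zero_iff)
    moreover have "2 ^ \<beta> * multiplicity p (geo X m) = 2 ^ \<alpha> * multiplicity p (geo X n)"
      using arg_cong[OF geq, of "multiplicity p"] p nz by (simp add: prime_elem_multiplicity_power_distrib)
    moreover have "2 ^ \<beta> * a \<noteq> 2 ^ \<alpha> * b" if "a \<ge> 1" "\<not> b \<ge> 2" for a b :: nat
    proof -
      have "2 ^ \<alpha> * b \<le> 2 ^ \<alpha> * 1" using that by (intro mult_le_mono2) simp
      also have "\<dots> < 2 ^ \<beta> * 1" using \<beta> pos by simp
      also have "\<dots> \<le> 2 ^ \<beta> * a" using that by (intro mult_le_mono2)
      finally show ?thesis by simp
    qed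
    ultimately show False by blast
  qed
  then have "m = 1" by (simp add: geo_eq_1_iff)
  then have ij: "i + j = 2 ^ \<beta>" using m by simp
  then have "n = 1" using \<beta> n(2) by simp
  have \<beta>0: "\<beta> > 0" using ij pos by (cases \<beta>) auto
  have "\<alpha> = 0"
  proof (rule ccontr)
    assume "\<alpha> \<noteq> 0"
    then have "even i" using n by simp
    moreover have "even (i + j)" using ij \<beta>0 by simp
    ultimately obtain g h where "i = 2 * g" "j = 2 * h" by (metis even_add evenE)
    then have "P = (1 + X ^ g * Y ^ h)\<^sup>2"
      by (simp only: P(1) power2_sum power_even_eq power_mult_distrib) simp
    then show False using P(2) by (simp add: prime_power_iff)
  qed
  then have "i = 1" "j = 2 ^ \<beta> - 1" using n \<open>n = 1\<close> ij by auto
  moreover have "geo X (2 ^ \<beta> + 1) = 1 + X * Y ^ (2 ^ \<beta> - 1)"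
    using geo_two_power[OF X_neq_1, of \<beta> 1] by (simp add: geo_Suc' one_plus_X)
  ultimately have "P = geo X (2 ^ \<beta> + 1)" using P(1) by simp
  moreover from this have "\<beta> \<le> 2" using prime_geo_two_power_plus_one[of X \<beta>] P(2) by simp
  then have "\<beta> = 1 \<or> \<beta> = 2" using \<beta>0 by auto
  ultimately show ?thesis by auto
qed

text \<open>The exponents of \<open>X\<close> and \<open>Y\<close> are positive because an
  irreducible polynomial other than these two takes the value 1 at both 0 and 1. The locale is
  closed under \<open>bar\<close>, which swaps \<open>i\<close> with \<open>j\<close> and
  \<open>k\<close> with \<open>l\<close>.\<close>

locale odd_prime_pair =
  fixes P Q :: "bit poly" and i j k l e :: nat
  assumes prime_P: "prime P" and prime_Q: "prime Q" and P_neq_Q: "P \<noteq> Q"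
    and degree_le: "degree P \<le> degree Q"
    and P_eq: "P = 1 + X ^ i * Y ^ j" and Q_eq: "Q = 1 + X ^ k * Y ^ l * P ^ e"
    and pos: "i > 0" "j > 0" "k > 0" "l > 0"
begin

lemma P_eval: "poly P 0 = 1" "poly P 1 = 1"
  using pos by (simp_all add: P_eq)

lemma Q_eval: "poly Q 0 = 1" "poly Q 1 = 1"
  using pos by (simp_all add: Q_eq)

lemma neq_X_Y: "P \<noteq> X" "P \<noteq> Y" "Q \<noteq> X" "Q \<noteq> Y"
  using P_eval Q_eval by auto

lemma degree_P: "degree P = i + j"
  using pos degree_X_Y[of i j] unfolding P_eq by (subst degree_add_eq_right) auto

lemma degree_Q: "degree Q = k + l + e * degree P"
proof -
  have "P \<noteq> 0" using prime_P by auto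
  then have "degree (X ^ k * Y ^ l * P ^ e) = k + l + e * degree P"
    by (subst degree_mult_eq) (auto simp: degree_X_Y degree_power_eq)
  then show ?thesis unfolding Q_eq using pos by (subst degree_add_eq_right) auto
qed

lemma exponents_eq:
  "X ^ a * Y ^ b * P ^ c * Q ^ d = X ^ a' * Y ^ b' * P ^ c' * Q ^ d' \<Longrightarrow>
    a = a' \<and> b = b' \<and> c = c' \<and> d = d'"
  using four_prime_powers_eq[OF prime_P neq_X_Y(1,2) prime_Q neq_X_Y(3,4) P_neq_Q] .

lemma exponents_eq3:
  assumes "X ^ a * Y ^ b * P ^ c = X ^ a' * Y ^ b' * P ^ c'"
  shows "a = a' \<and> b = b' \<and> c = c'"
  using exponents_eq[of a b c 0 a' b' c' 0] assms by simp

lemma geo_X_dvd_cases: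
  assumes u: "odd u" and dvd: "geo X u dvd X ^ a * Y ^ b * (P ^ c * Q ^ d)"
  obtains p q where "p \<le> 1" "q \<le> 1" "geo X u = P ^ p * Q ^ q"
proof -
  have "geo X u dvd P ^ c * Q ^ d"
    using dvd u by (simp add: dvd_X_Y_mult_iff poly_geo_X_0 poly_geo_X_1 odd_pos)
  then obtain R S where RS: "geo X u = R * S" "R dvd P ^ c" "S dvd Q ^ d"
    using division_decomp by blast
  then obtain p q where pq: "R = P ^ p" "S = Q ^ q"
    using dvd_prime_power_bit_poly prime_P prime_Q by blast
  have "p \<le> 1"
  proof (rule ccontr)
    assume "\<not> p \<le> 1"
    then have "P\<^sup>2 dvd geo X u" unfolding RS(1) pq by (intro dvd_mult2 le_imp_power_dvd) simp
    then show False using geo_X_squarefree[OF u prime_P] by blast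
  qed
  moreover have "q \<le> 1"
  proof (rule ccontr)
    assume "\<not> q \<le> 1"
    then have "Q\<^sup>2 dvd geo X u" unfolding RS(1) pq by (intro dvd_mult le_imp_power_dvd) simp
    then show False using geo_X_squarefree[OF u prime_Q] by blast
  qed
  ultimately show ?thesis using that RS(1) pq by blast
qed

lemma geo_X_eq_P:
  assumes "odd u" "geo X u = P"
  shows "u = 3 \<or> u = 5"
  using prime_geo_X_Mersenne[of u i j] assms prime_P by (simp add: P_eq)

text \<open>The factorisation of \<open>1 + geo X u\<close> is compared with
  \<open>1 + Q = X ^ k * Y ^ l * P ^ e\<close>: the inner sum \<open>geo X w\<close> is 1 or
  \<open>P\<close>. The first leads to the irreducibility bound. The second is the infinite family,
  which is not excluded here but by the exponent equations in
  \<open>no_solution_power_family\<close>.\<close>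

lemma geo_X_eq_Q:
  assumes u: "odd u" "geo X u = Q"
  obtains "u = 3 \<or> u = 5" "e = 0"
  | m w where "m > 0" "w = 3 \<or> w = 5" "geo X w = P" "u = 2 ^ m * w + 1"
      "k = 1" "l = 2 ^ m - 1" "e = 2 ^ m"
proof -
  have "u \<noteq> 1" using u prime_Q by auto
  then have u1: "u > 1" using u(1) by (cases u) auto
  obtain m w where mw: "m > 0" "odd w" "u = 2 ^ m * w + 1"
    "1 + geo X u = X * (1 + X) ^ (2 ^ m - 1) * geo X w ^ (2 ^ m)"
    using one_plus_geo[OF u(1) u1 X_neq_1] by blast
  have "1 + geo X u = X ^ k * Y ^ l * P ^ e" unfolding u(2) by (simp add: Q_eq)
  then have eq: "X ^ k * Y ^ l * P ^ e = X ^ 1 * Y ^ (2 ^ m - 1) * geo X w ^ (2 ^ m)"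
    using mw(4) unfolding one_plus_X by (simp only: power_one_right)
  have "geo X w dvd X ^ k * Y ^ l * P ^ e" unfolding eq by (intro dvd_mult dvd_power) simp
  then have "geo X w dvd X ^ k * Y ^ l * (P ^ e * Q ^ 0)" by simp
  then obtain p q where pq: "p \<le> 1" "q \<le> 1" "geo X w = P ^ p * Q ^ q"
    using geo_X_dvd_cases[OF mw(2)] by blast
  have "X ^ k * Y ^ l * P ^ e * Q ^ 0 = X ^ 1 * Y ^ (2 ^ m - 1) * P ^ (p * 2 ^ m) * Q ^ (q * 2 ^ m)"
    using eq unfolding pq(3) by (simp only: power_mult_distrib power_mult power_0 mult_1_right mult.assoc)
  then have ex: "k = 1" "l = 2 ^ m - 1" "e = p * 2 ^ m" "0 = q * 2 ^ m"
    using exponents_eq by blast+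
  then have "q = 0" by simp
  show ?thesis
  proof (cases "p = 0")
    case True
    then have "geo X w = 1" using pq(3) \<open>q = 0\<close> by simp
    then have "w = 1" by (simp add: geo_eq_1_iff)
    then have "prime (geo X (2 ^ m + 1))" using prime_Q u(2) mw(3) by simp
    then have "m \<le> 2" by (rule prime_geo_two_power_plus_one) simp
    then have "m = 1 \<or> m = 2" using mw(1) by auto
    then have "u = 3 \<or> u = 5" using mw(3) \<open>w = 1\<close> by auto
    then show ?thesis using that(1) ex True by simp
  next
    case False
    then have "p = 1" using pq(1) by simp
    then have "geo X w = P" using pq(3) \<open>q = 0\<close> by simp
    moreover from this have "w = 3 \<or> w = 5" using geo_X_eq_P mw(2) by simp
    ultimately show ?thesis using that(2)[of m w] mw ex \<open>p = 1\<close> by simp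
  qed
qed

text \<open>\<open>geo X u\<close> is self-reciprocal, so reciprocation swaps or fixes
  \<open>P\<close> and \<open>Q\<close>. If it swaps them, their degrees agree,
  \<open>e = 0\<close>, and the coefficient of \<open>X\<close> makes one of \<open>i\<close>,
  \<open>k\<close> equal to 1, which leads to \<open>M_2\<close> and \<open>M_3\<close>. If it fixes
  them, \<open>P\<close> is \<open>geo X 3\<close> or \<open>geo X 5\<close>, and divisibility
  determines the index.\<close>

lemma geo_X_eq_PQ:
  assumes u: "odd u" "geo X u = P * Q"
  obtains "u = 7" "P = M_2 \<and> Q = M_3 \<or> P = M_3 \<and> Q = M_2"
  | w where "w = 3 \<or> w = 5" "geo X w = P" "u = w * w" "Q = geo (X ^ w) w"
proof -
  have "reflect_poly (P * Q) = P * Q" using reflect_poly_geo_X[of u] u(2) by simp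
  then consider "reflect_poly P = Q" | "reflect_poly P = P"
    using reflect_poly_prime_pair[OF prime_P prime_Q P_neq_Q P_eval(1) Q_eval(1) degree_le] by blast
  then show ?thesis
  proof cases
    case 1
    have c0: "coeff P 0 = 1" "coeff Q 0 = 1" using P_eval Q_eval by (simp_all add: poly_0_coeff_0)
    then have "degree Q = degree P" using 1 degree_reflect_poly_eq[of P] by simp
    moreover have e: "e = 0"
    proof (rule ccontr)
      assume "e \<noteq> 0"
      then have "degree P \<le> e * degree P" by simp
      then show False using degree_Q \<open>degree Q = degree P\<close> pos by linarith
    qed
    have Q': "Q = 1 + X ^ k * Y ^ l" using Q_eq e by simp
    have refl': "reflect_poly Q = P" using 1 c0 reflect_poly_reflect_poly[of P] by simp
    have dPQ: "degree (P * Q) = 2 * degree P"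
      using prime_P prime_Q \<open>degree Q = degree P\<close> by (subst degree_mult_eq) auto
    then have "2 * degree P = u - 1" using degree_geo[of X u] u(2) by simp
    then have u4: "u > 2" using degree_P pos by linarith
    have c1: "coeff (1 + X ^ n * Y ^ m) 1 = (if n = 1 then 1 else 0)" if "n > 0" for n m
    proof (cases n)
      case (Suc n')
      then have "coeff (1 + X ^ n * Y ^ m) 1 = coeff (X ^ n' * Y ^ m) 0" by (simp add: mult.assoc)
      then show ?thesis using Suc by (cases n') (simp_all add: coeff_0_power coeff_mult_0)
    qed (use that in simp)
    have "coeff (P * Q) 1 = coeff P 0 * coeff Q 1 + coeff P 1 * coeff Q 0"
      by (simp only: coeff_mult One_nat_def sum.atMost_Suc atMost_0 sum.insert finite.emptyI empty_iff
          not_False_eq_True sum.empty add_0_right diff_zero diff_self_eq_0)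
    moreover have "coeff (P * Q) 1 = 1" using u4 by (simp add: u(2)[symmetric] coeff_geo_X)
    moreover have "coeff P 1 = (if i = 1 then 1 else 0)" "coeff Q 1 = (if k = 1 then 1 else 0)"
      using c1 pos by (simp_all only: P_eq Q')
    ultimately consider "i = 1" | "k = 1" using c0 by (auto split: if_splits)
    then have "P = M_2 \<and> Q = M_3 \<or> P = M_3 \<and> Q = M_2"
    proof cases
      case i: 1
      then have "P = 1 + X * Y ^ j" using P_eq by (simp only: power_one_right)
      then show ?thesis
        using reciprocal_Mersenne_pair[OF _ Q' _ _ _ 1, of j u] pos u(2) by simp
    next
      case k: 2
      then have "Q = 1 + X * Y ^ l" using Q' by (simp only: power_one_right)
      then show ?thesis
        using reciprocal_Mersenne_pair[OF _ P_eq _ _ _ refl', of l u] pos u(2) by (simp add: mult.commute)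
    qed
    moreover have "degree M_2 = 3" "degree M_3 = 3"
      by (simp_all add: M_2_def M_3_def numeral_eq_Suc one_pCons)
    ultimately have "u = 7" using \<open>2 * degree P = u - 1\<close> u4 by auto
    then show ?thesis using that(1) \<open>P = M_2 \<and> Q = M_3 \<or> P = M_3 \<and> Q = M_2\<close> by blast
  next
    case 2
    then have "P = geo X 3 \<or> P = geo X 5"
      using self_reciprocal_Mersenne[OF P_eq prime_P pos(1,2)] by simp
    then obtain w where w: "w = 3 \<or> w = 5" "geo X w = P" by auto
    \<comment> \<open>Division of the index: a nonzero remainder \<open>r\<close> would make
      \<open>P\<close> divide \<open>geo X r\<close>, which has smaller degree.\<close>
    define y r where "y = u div w" and "r = u mod w"
    have uyr: "u = w * y + r" by (simp add: y_def r_def)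
    have rw: "r < w" using w by (auto simp: r_def)
    have "r = 0"
    proof (rule ccontr)
      assume r0: "r \<noteq> 0"
      have "P dvd geo X (w * y)" unfolding geo_mult_index w(2) by simp
      moreover have "P dvd geo X (w * y + r)" using u(2) uyr by simp
      ultimately have "P dvd X ^ (w * y) * geo X r" unfolding geo_add by (metis dvd_add_right_iff)
      then have "P dvd X ^ (w * y) * Y ^ 0 * geo X r" by simp
      then have "P dvd geo X r" using dvd_X_Y_mult_iff[OF P_eval] by blast
      moreover have "geo X r \<noteq> 0" using r0 by (simp add: geo_nonzero)
      ultimately have "degree P \<le> degree (geo X r)" by (rule dvd_imp_degree_le)
      then show False using r0 rw w(2)[symmetric] by (simp add: degree_geo)
    qed
    then have uwy: "u = w * y" using uyr by simp
    then have "P * Q = P * geo (X ^ w) y" using u(2) geo_mult_index[of X w y] w(2) uwy by metis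
    then have Qw: "Q = geo (X ^ w) y" using prime_P by (metis mult_cancel_left not_prime_0)
    have y: "odd y" using u(1) uwy by simp
    have "y \<noteq> 1" using Qw prime_Q by auto
    then have y1: "y > 1" using y by (cases y) auto
    \<comment> \<open>\<open>w * y\<close> can also be split as \<open>y * w\<close>. The divisor
      \<open>geo X y\<close> has smaller degree than \<open>Q\<close>, hence divides
      \<open>P\<close>, and this gives \<open>y = w\<close>.\<close>
    have "geo X y dvd P * Q" using geo_mult_index[of X y w] u(2) uwy by (metis dvd_triv_left mult.commute)
    moreover have "degree (geo X y) < degree Q"
      using y1 w(1) by (auto simp: Qw degree_geo degree_power_eq)
    then have "\<not> Q dvd geo X y"
      using dvd_imp_degree_le[of Q "geo X y"] geo_nonzero[of X y] y1 by auto
    then have "coprime Q (geo X y)" using prime_Q by (intro prime_imp_coprime)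
    ultimately have "geo X y dvd P" by (metis coprime_commute coprime_dvd_mult_left_iff)
    then have "geo X y = 1 \<or> geo X y = P"
      using dvd_prime_power_bit_poly[OF prime_P, of "geo X y" 1] by (auto simp: le_Suc_eq)
    then have "geo X y = geo X w" using y1 w(2) geo_eq_1_iff[of X y] by auto
    then have "y = w" using y1 w(1) geo_eq_geo_iff[of X y w] by auto
    then show ?thesis using that(2)[OF w] uwy Qw by simp
  qed
qed

end

section \<open>Geometric sums that are prime powers\<close>

text \<open>This is the splitting into even and odd exponents; polynomials in
  \<open>X\<^sup>2\<close> are squares. The derivative of such a \<open>p\<close> is
  \<open>b\<^sup>2\<close>, so a vanishing derivative makes \<open>p\<close> a square.\<close>

lemma bit_poly_square_decomposition: "\<exists>a b. p = a\<^sup>2 + X * b\<^sup>2" for p :: "bit poly"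
proof (induction p)
  case 0
  show ?case by (rule exI[of _ 0], rule exI[of _ 0]) simp
next
  case (pCons c p)
  then obtain a b where ab: "p = a\<^sup>2 + X * b\<^sup>2" by blast
  have "[:c:]\<^sup>2 = [:c:]" by (cases c) (simp_all add: power2_eq_square)
  then have "pCons c p = ([:c:] + X * b)\<^sup>2 + X * a\<^sup>2"
    unfolding power2_sum ab by (simp add: power2_eq_square algebra_simps)
  then show ?case by blast
qed

lemma pderiv_square [simp]: "pderiv (a\<^sup>2) = (0 :: bit poly)"
  by (simp add: power2_eq_square pderiv_mult)

lemma prime_pderiv_nonzero:
  assumes "prime (p :: bit poly)"
  shows "pderiv p \<noteq> 0"
proof
  assume 0: "pderiv p = 0"
  obtain a b where ab: "p = a\<^sup>2 + X * b\<^sup>2" using bit_poly_square_decomposition by blast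
  have "pderiv p = b\<^sup>2" unfolding ab by (simp add: pderiv_add pderiv_mult pderiv_pCons)
  then have "p = a\<^sup>2" using 0 ab by simp
  then show False using assms by (simp add: prime_power_iff)
qed

text \<open>Differentiating \<open>(1 + R) * geo R u = 1 + R ^ u\<close> shows that
  \<open>S ^ (m - 1)\<close> divides \<open>R ^ (u - 1) * pderiv R\<close>, hence the nonzero
  \<open>pderiv R\<close>. So \<open>(m - 1) * degree S < degree R\<close>, whereas
  \<open>m * degree S = (u - 1) * degree R \<ge> 2 * degree R\<close>. For \<open>m \<ge> 2\<close>
  these contradict each other because \<open>m \<le> 2 * (m - 1)\<close>.\<close>

lemma geo_prime_power_eq:
  assumes R: "prime R" and S: "prime S" and u: "odd u" "u > 1" and eq: "geo R u = S ^ m"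
  shows "m = 1"
proof (rule ccontr)
  assume "m \<noteq> 1"
  have dR: "degree R > 0" using R by (rule prime_degree_pos)
  have "m \<noteq> 0" using eq u geo_eq_1_iff[OF dR, of u] by (cases m) auto
  then obtain n where n: "m = Suc n" "n > 0" using \<open>m \<noteq> 1\<close> by (cases m) auto
  have "pderiv (1 + R ^ u) = R ^ (u - 1) * pderiv R"
    using u(1) by (simp add: pderiv_add pderiv_power of_nat_bit)
  then have eq': "R ^ (u - 1) * pderiv R = (1 + R) * pderiv (S ^ m) + S ^ m * pderiv R"
    unfolding geo_mult[symmetric] pderiv_mult eq by (simp add: pderiv_add)
  have "S ^ n dvd S ^ m" unfolding n(1) by simp
  moreover have "S ^ n dvd pderiv (S ^ m)"
    unfolding n(1) pderiv_power_Suc by (intro dvd_mult2 dvd_smult dvd_refl)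
  ultimately have "S ^ n dvd R ^ (u - 1) * pderiv R"
    unfolding eq' by (intro dvd_add[OF dvd_mult dvd_mult2])
  moreover have "S dvd geo R u" using eq n by simp
  then have "\<not> S dvd R" using prime_dvd_geo_not_dvd_base[OF S] u by auto
  then have "coprime (S ^ n) (R ^ (u - 1))" using S by (simp add: prime_imp_coprime)
  ultimately have "S ^ n dvd pderiv R" by (simp only: coprime_dvd_mult_right_iff)
  then have "degree (S ^ n) \<le> degree (pderiv R)"
    using prime_pderiv_nonzero[OF R] by (rule dvd_imp_degree_le)
  also have "\<dots> < degree R"
  proof -
    have "degree (pderiv R) \<le> degree R - 1" by (rule degree_le) (auto simp: coeff_pderiv coeff_eq_0)
    then show ?thesis using dR by linarith
  qed
  finally have "n * degree S < degree R" using S by (simp add: degree_power_eq)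
  moreover have "(u - 1) * degree R = m * degree S"
    using arg_cong[OF eq, of degree] S by (simp add: degree_geo[OF dR] degree_power_eq)
  moreover have "2 \<le> u - 1" using u by presburger
  then have "2 * degree R \<le> (u - 1) * degree R" by (rule mult_le_mono1)
  moreover have "m * degree S \<le> (2 * n) * degree S" using n by (intro mult_le_mono1) simp
  ultimately show False by linarith
qed

section \<open>The involution\<close>

lemma bar_add [simp]: "bar (p + q) = bar p + bar q"
  and bar_mult [simp]: "bar (p * q) = bar p * bar q"
  and bar_1 [simp]: "bar 1 = 1"
  and bar_X: "bar X = Y"
  by (simp_all add: bar_def pcompose_add pcompose_mult pcompose_1)

lemma bar_Y: "bar Y = X"
  using bar_add[of 1 X] by (simp only: one_plus_X bar_1 bar_X one_plus_Y)

lemma bar_power [simp]: "bar (p ^ n) = bar p ^ n"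
  by (simp add: bar_def pcompose_power_bit)

lemma bar_geo: "bar (geo Z n) = geo (bar Z) n"
  by (simp add: bar_def pcompose_geo)

lemma bar_bar [simp]: "bar (bar p) = p"
proof -
  have "pcompose [:1, 1:] [:1, 1:] = X" using bar_Y by (simp add: bar_def)
  then show ?thesis by (simp add: bar_def pcompose_assoc[symmetric] pcompose_idR)
qed

lemma bar_eq_iff [simp]: "bar p = bar q \<longleftrightarrow> p = q"
  by (metis bar_bar)

lemma degree_bar [simp]: "degree (bar p) = degree p"
  by (simp add: bar_def degree_pcompose)

lemma bar_dvd_iff [simp]: "bar p dvd bar q \<longleftrightarrow> p dvd q"
  by (metis bar_bar bar_mult dvd_def)

lemma prime_bar [simp]: "prime (bar p) \<longleftrightarrow> prime p"
proof -
  have *: "prime (bar p)" if "prime p" for p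
  proof -
    have "degree p > 0" using that by (rule prime_degree_pos)
    then have "\<not> is_unit (bar p)" "bar p \<noteq> 0" by (metis degree_bar is_unit_iff_degree less_irrefl degree_0)+
    moreover have "bar p dvd a \<or> bar p dvd b" if "bar p dvd a * b" for a b
      using that \<open>prime p\<close> by (metis bar_bar bar_dvd_iff bar_mult prime_dvd_mult_iff)
    ultimately have "prime_elem (bar p)" by (intro prime_elemI)
    then show ?thesis by (simp add: prime_def)
  qed
  from *[of p] *[of "bar p"] show ?thesis by auto
qed

lemma bar_sigma_biunitary_prime_power:
  assumes "prime Z" "a > 0"
  shows "bar (sigma_biunitary (Z ^ a)) = sigma_biunitary (bar Z ^ a)"
  using assms by (simp add: sigma_biunitary_prime_power bar_geo)

context odd_prime_pair
begin

text \<open>Interpreting the locale at \<open>bar P\<close> and \<open>bar Q\<close> turns each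
  result about sums in \<open>X\<close> into one about sums in \<open>Y\<close>.\<close>

lemma odd_prime_pair_bar: "odd_prime_pair (bar P) (bar Q) j i l k e"
proof
  have "bar P = 1 + bar (X ^ i * Y ^ j)" using P_eq by (metis bar_1 bar_add)
  then show "bar P = 1 + X ^ j * Y ^ i" by (simp only: bar_mult bar_power bar_X bar_Y mult.commute)
  have "bar Q = 1 + bar (X ^ k * Y ^ l * P ^ e)" using Q_eq by (metis bar_1 bar_add)
  then show "bar Q = 1 + X ^ l * Y ^ k * bar P ^ e"
    by (simp only: bar_mult bar_power bar_X bar_Y mult.commute)
qed (use prime_P prime_Q P_neq_Q degree_le pos in auto)

lemma degree_P_pos: "degree P > 0"
  using degree_P pos by simp

text \<open>Being coprime to \<open>X\<close>, \<open>Y\<close> and \<open>P\<close>, a nontrivial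
  sum is a power of \<open>Q\<close>, hence \<open>Q\<close> itself by the derivative argument. The
  inner sum \<open>geo P w\<close> of \<open>1 + geo P u\<close> is likewise a power of
  \<open>Q\<close>, but it divides \<open>1 + Q\<close>; so \<open>w = 1\<close>, and the
  irreducibility bound leaves two indices.\<close>

lemma geo_P_dvd_cases:
  assumes u: "odd u" and dvd: "geo P u dvd X ^ a * Y ^ b * (P ^ c * Q ^ d)"
  obtains "u = 1"
  | N where "N = 2 \<or> N = 4" "u = N + 1" "geo P u = Q" "e = 1" "k = i * (N - 1)" "l = j * (N - 1)"
proof (cases "u = 1")
  case False
  then have u1: "u > 1" using u by (cases u) auto
  have P1: "P \<noteq> 1" using prime_P by auto
  \<comment> \<open>Applied below with \<open>d' = d\<close> to the sum itself and with
    \<open>d' = 0\<close> to the inner sum.\<close>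
  have red: "geo P w dvd Q ^ d'" if "odd w" "geo P w dvd X ^ a' * Y ^ b' * (P ^ c' * Q ^ d')" for w a' b' c' d'
  proof -
    have "poly (geo P w) 0 = 1" "poly (geo P w) 1 = 1"
      using P_eval \<open>odd w\<close> by (auto simp: geo_def poly_sum of_nat_bit)
    then have "geo P w dvd P ^ c' * Q ^ d'"
      using that(2) by (simp only: dvd_X_Y_mult_iff)
    moreover have "\<not> P dvd geo P w"
      using prime_dvd_geo_not_dvd_base[OF prime_P, of P w] odd_pos[OF \<open>odd w\<close>] by (metis dvd_refl)
    then have "coprime P (geo P w)" using prime_P by (intro prime_imp_coprime)
    then have "coprime (geo P w) (P ^ c')" by (subst coprime_commute) simp
    ultimately show ?thesis by (simp only: coprime_dvd_mult_right_iff)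
  qed
  obtain m where m: "geo P u = Q ^ m"
    using red[OF u dvd] dvd_prime_power_bit_poly[OF prime_Q] by blast
  then have "m = 1" using geo_prime_power_eq[OF prime_P prime_Q u u1] by blast
  then have uQ: "geo P u = Q" using m by simp
  obtain r w where rw: "r > 0" "odd w" "u = 2 ^ r * w + 1"
    "1 + geo P u = P * (1 + P) ^ (2 ^ r - 1) * geo P w ^ (2 ^ r)"
    using one_plus_geo[OF u u1 P1] by blast
  have Q': "1 + geo P u = X ^ k * Y ^ l * P ^ e" unfolding uQ by (simp add: Q_eq)
  have "geo P w dvd 1 + geo P u" unfolding rw(4) by (intro dvd_mult dvd_power) simp
  then have "geo P w dvd X ^ k * Y ^ l * (P ^ e * Q ^ 0)" unfolding Q' by simp
  then have "geo P w dvd Q ^ 0" by (rule red[OF rw(2)])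
  then have "geo P w = 1" by (simp add: is_unit_bit_poly_iff)
  then have "w = 1" using geo_eq_1_iff[OF degree_P_pos] by blast
  then have "prime (geo P (2 ^ r + 1))" using uQ prime_Q rw(3) by simp
  then have "r \<le> 2" using prime_geo_two_power_plus_one degree_P_pos by blast
  then have r: "r = 1 \<or> r = 2" using rw(1) by auto
  have "1 + P = X ^ i * Y ^ j" by (simp add: P_eq)
  then have "X ^ k * Y ^ l * P ^ e = X ^ (i * (2 ^ r - 1)) * Y ^ (j * (2 ^ r - 1)) * P ^ 1"
    using rw(4) unfolding Q' \<open>geo P w = 1\<close>
    by (simp only: power_mult_distrib power_mult[symmetric] power_one mult_1_right mult_1_left power_one_right mult_ac)
  then have ex: "k = i * (2 ^ r - 1) \<and> l = j * (2 ^ r - 1) \<and> e = 1" by (rule exponents_eq3)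
  have "(2::nat) ^ r = 2 \<or> (2::nat) ^ r = 4" using r by (elim disjE) simp_all
  moreover have "u = 2 ^ r + 1" using rw(3) \<open>w = 1\<close> by simp
  ultimately show ?thesis using that(2) uQ ex by blast
qed (use that in blast)

text \<open>A nontrivial sum would equal \<open>P\<close>, but its degree is at least
  \<open>2 * degree Q\<close>.\<close>

lemma geo_Q_dvd_cases:
  assumes u: "odd u" and dvd: "geo Q u dvd X ^ a * Y ^ b * (P ^ c * Q ^ d)"
  shows "u = 1"
proof (rule ccontr)
  assume "u \<noteq> 1"
  then have u1: "u > 1" using u by (cases u) auto
  have "poly (geo Q u) 0 = 1" "poly (geo Q u) 1 = 1"
    using Q_eval u by (auto simp: geo_def poly_sum of_nat_bit)
  then have "geo Q u dvd P ^ c * Q ^ d"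
    using dvd by (simp only: dvd_X_Y_mult_iff)
  moreover have "\<not> Q dvd geo Q u"
    using prime_dvd_geo_not_dvd_base[OF prime_Q, of Q u] odd_pos[OF u] by (metis dvd_refl)
  then have "coprime Q (geo Q u)" using prime_Q by (intro prime_imp_coprime)
  then have "coprime (geo Q u) (Q ^ d)" by (subst coprime_commute) simp
  ultimately have "geo Q u dvd P ^ c" by (simp only: coprime_dvd_mult_left_iff)
  then obtain m where m: "geo Q u = P ^ m" using dvd_prime_power_bit_poly[OF prime_P] by blast
  then have "m = 1" using geo_prime_power_eq[OF prime_Q prime_P u u1] by blast
  then have "(u - 1) * degree Q = degree P" using m degree_geo[of Q u] degree_P_pos degree_le by auto
  moreover have "2 \<le> u - 1" using u u1 by presburger
  then have "2 * degree Q \<le> (u - 1) * degree Q" by (rule mult_le_mono1)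
  ultimately show False using degree_le degree_P_pos by linarith
qed

end

section \<open>Arithmetic of the exponents\<close>

definition pow2 :: "nat \<Rightarrow> bool" where "pow2 K \<longleftrightarrow> (\<exists>k>0. K = 2 ^ k)"

text \<open>The cut at 32 suits the fixed index sets below: their largest index is 25, so
  \<open>K * u = v + 1\<close> and \<open>K * u + 1 = v\<close> keep \<open>K\<close> below
  32.\<close>

lemma pow2_cases:
  assumes "pow2 K"
  shows "K = 2 \<or> K = 4 \<or> K = 8 \<or> K = 16 \<or> (\<exists>m>0. K = 32 * m)"
proof -
  obtain k where k: "k > 0" "K = 2 ^ k" using assms by (auto simp: pow2_def)
  show ?thesis
  proof (cases "k < 5")
    case True
    then have "k = 1 \<or> k = 2 \<or> k = 3 \<or> k = 4" using k(1) by auto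
    then show ?thesis using k(2) by auto
  next
    case False
    then have "K = 32 * 2 ^ (k - 5)" using k(2) power_add[of "2::nat" 5 "k - 5"] by simp
    then show ?thesis by (metis zero_less_numeral zero_less_power)
  qed
qed

text \<open>The only consequence of ``\<open>c = 2\<close> or \<open>c + 1\<close> is a power of two'' that the case analysis needs.\<close>

definition mersenne_like :: "nat \<Rightarrow> bool" where
  "mersenne_like c \<longleftrightarrow> c = 1 \<or> c = 2 \<or> c = 3 \<or> c mod 8 = 7"

lemma pow2_even: "pow2 K \<Longrightarrow> even K \<and> K \<ge> 2"
  using pow2_cases by fastforce

lemma pow2_Suc_mersenne_like: "pow2 (Suc c) \<Longrightarrow> mersenne_like c"
  using pow2_cases[of "Suc c"] unfolding mersenne_like_def by presburger

lemma exponent_split_odd: "exponent_split a K u v \<alpha> \<Longrightarrow> odd u \<and> odd v \<and> K > 0"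
  by (auto simp: exponent_split_def)

lemma exponent_split_cases:
  assumes "exponent_split a K u v \<alpha>"
  obtains "pow2 K" "odd u" "odd v" "a + 1 = K * u" "v = 1" "\<alpha> + 1 = K"
  | "pow2 K" "odd u" "odd v" "\<alpha> = K" "a = 2 * v" "K * u = v + 1"
  | "pow2 K" "odd u" "odd v" "\<alpha> = K" "a + 2 = 2 * v" "K * u + 1 = v"
  using assms unfolding exponent_split_def pow2_def[symmetric] by fastforce


text \<open>
  A triple \<open>(u, x, y)\<close> stands for a factorisation \<open>geo X u = P ^ x * Q ^ y\<close>. If \<open>S\<close> contains all
  such triples, \<open>sided S a \<alpha> p q\<close> holds for the exponents in
  \<open>\<sigma>\<^sup>*\<^sup>*(X\<^sup>a) = (1 + X)\<^sup>\<alpha> * P\<^sup>p * Q\<^sup>q\<close>.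
\<close>

definition sided :: "(nat \<times> nat \<times> nat) set \<Rightarrow> nat \<Rightarrow> nat \<Rightarrow> nat \<Rightarrow> nat \<Rightarrow> bool" where
  "sided S a \<alpha> p q \<longleftrightarrow> (\<exists>K u v x y z t. exponent_split a K u v \<alpha> \<and>
     (u, x, y) \<in> S \<and> (v, z, t) \<in> S \<and> p = K * x + z \<and> q = K * y + t)"

lemma sided_mono: "sided S a \<alpha> p q \<Longrightarrow> S \<subseteq> T \<Longrightarrow> sided T a \<alpha> p q"
  unfolding sided_def by blast

lemma sided_pos: "sided S a \<alpha> p q \<Longrightarrow> q > 0 \<Longrightarrow> \<exists>u x y. (u, x, y) \<in> S \<and> y > 0"
  unfolding sided_def by (metis add_is_0 mult_0_right neq0_conv)

section \<open>Exponents produced by the index sets that occur\<close>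

lemma sided_1:
  assumes "sided {(1, 0, 0)} a \<alpha> p q"
  shows "p = 0 \<and> q = 0 \<and> a = \<alpha> \<and> mersenne_like a"
proof -
  obtain K u v x y z t where K: "exponent_split a K u v \<alpha>"
    "(u, x, y) \<in> {(1, 0, 0)}" "(v, z, t) \<in> {(1, 0, 0)}"
    "p = K * x + z" "q = K * y + t"
    using assms unfolding sided_def by blast
  have uv: "u = 1" "v = 1" using K(2,3) by auto
  from K(1) show ?thesis
  proof (cases rule: exponent_split_cases)
    case 1
    then show ?thesis using K(2-5) pow2_even[OF 1(1)] 1(1) by (auto simp: pow2_Suc_mersenne_like)
  next
    case 2
    have "u = 1 \<and> v = 1 \<and> K = 2"
      using 2(6) uv pow2_cases[OF 2(1)] by (elim disjE exE conjE; simp)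
    then show ?thesis using K(2-5) 2(4,5) by (elim disjE conjE; simp add: mersenne_like_def)
  next
    case 3
    have False
      using 3(6) uv pow2_cases[OF 3(1)] by (elim disjE exE conjE; simp)
    then show ?thesis by blast
  qed
qed

lemma sided_3:
  assumes "sided {(1, 0, 0), (3, 1, 0)} a \<alpha> p q"
  shows "q = 0 \<and> (p = 0 \<and> a = \<alpha> \<and> mersenne_like a \<or> p = 1 \<and> a = 4 \<and> \<alpha> = 2 \<or>
    p = 1 \<and> a = 6 \<and> \<alpha> = 4 \<or> even p \<and> p \<ge> 2 \<and> a + 1 = 3 * p \<and> \<alpha> + 1 = p)"
proof -
  obtain K u v x y z t where K: "exponent_split a K u v \<alpha>"
    "(u, x, y) \<in> {(1, 0, 0), (3, 1, 0)}" "(v, z, t) \<in> {(1, 0, 0), (3, 1, 0)}"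
    "p = K * x + z" "q = K * y + t"
    using assms unfolding sided_def by blast
  have uv: "u = 1 \<or> u = 3" "v = 1 \<or> v = 3" using K(2,3) by auto
  from K(1) show ?thesis
  proof (cases rule: exponent_split_cases)
    case 1
    then show ?thesis using K(2-5) pow2_even[OF 1(1)] 1(1) by (auto simp: pow2_Suc_mersenne_like)
  next
    case 2
    have "u = 1 \<and> v = 1 \<and> K = 2 \<or> u = 1 \<and> v = 3 \<and> K = 4"
      using 2(6) uv pow2_cases[OF 2(1)] by (elim disjE exE conjE; simp)
    then show ?thesis using K(2-5) 2(4,5) by (elim disjE conjE; simp add: mersenne_like_def)
  next
    case 3
    have "u = 1 \<and> v = 3 \<and> K = 2"
      using 3(6) uv pow2_cases[OF 3(1)] by (elim disjE exE conjE; simp)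
    then show ?thesis using K(2-5) 3(4,5) by (elim disjE conjE; simp add: mersenne_like_def)
  qed
qed

lemma sided_3_5:
  assumes "sided {(1, 0, 0), (3, 1, 0), (5, 0, 1)} a \<alpha> p q" "q > 0"
  shows "a = 8 \<and> \<alpha> = 4 \<and> p = 0 \<and> q = 1 \<or> a = 10 \<and> \<alpha> = 2 \<and> p = 2 \<and> q = 1 \<or>
    even q \<and> q \<ge> 2 \<and> p = 0 \<and> a + 1 = 5 * q \<and> \<alpha> + 1 = q"
proof -
  obtain K u v x y z t where K: "exponent_split a K u v \<alpha>"
    "(u, x, y) \<in> {(1, 0, 0), (3, 1, 0), (5, 0, 1)}" "(v, z, t) \<in> {(1, 0, 0), (3, 1, 0), (5, 0, 1)}"
    "p = K * x + z" "q = K * y + t"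
    using assms unfolding sided_def by blast
  have uv: "u = 1 \<or> u = 3 \<or> u = 5" "v = 1 \<or> v = 3 \<or> v = 5" using K(2,3) by auto
  from K(1) show ?thesis
  proof (cases rule: exponent_split_cases)
    case 1
    then show ?thesis using K(2-5) pow2_even[OF 1(1)] assms(2) by auto
  next
    case 2
    have "u = 1 \<and> v = 1 \<and> K = 2 \<or> u = 1 \<and> v = 3 \<and> K = 4 \<or> u = 3 \<and> v = 5 \<and> K = 2"
      using 2(6) uv pow2_cases[OF 2(1)] by (elim disjE exE conjE; simp)
    then show ?thesis using K(2-5) 2(4,5) assms(2) by (elim disjE conjE; simp add: mersenne_like_def)
  next
    case 3
    have "u = 1 \<and> v = 3 \<and> K = 2 \<or> u = 1 \<and> v = 5 \<and> K = 4"
      using 3(6) uv pow2_cases[OF 3(1)] by (elim disjE exE conjE; simp)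
    then show ?thesis using K(2-5) 3(4,5) assms(2) by (elim disjE conjE; simp add: mersenne_like_def)
  qed
qed

lemma sided_5_Q:
  assumes "sided {(1, 0, 0), (5, 0, 1)} a \<alpha> p q"
  shows "p = 0 \<and> (q = 0 \<or> a = 8 \<and> \<alpha> = 4 \<and> q = 1 \<or> even q \<and> q \<ge> 2 \<and> a + 1 = 5 * q \<and> \<alpha> + 1 = q)"
proof -
  obtain K u v x y z t where K: "exponent_split a K u v \<alpha>"
    "(u, x, y) \<in> {(1, 0, 0), (5, 0, 1)}" "(v, z, t) \<in> {(1, 0, 0), (5, 0, 1)}"
    "p = K * x + z" "q = K * y + t"
    using assms unfolding sided_def by blast
  have uv: "u = 1 \<or> u = 5" "v = 1 \<or> v = 5" using K(2,3) by auto
  from K(1) show ?thesis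
  proof (cases rule: exponent_split_cases)
    case 1
    then show ?thesis using K(2-5) pow2_even[OF 1(1)] 1(1) by (auto simp: pow2_Suc_mersenne_like)
  next
    case 2
    have "u = 1 \<and> v = 1 \<and> K = 2"
      using 2(6) uv pow2_cases[OF 2(1)] by (elim disjE exE conjE; simp)
    then show ?thesis using K(2-5) 2(4,5) by (elim disjE conjE; simp add: mersenne_like_def)
  next
    case 3
    have "u = 1 \<and> v = 5 \<and> K = 4"
      using 3(6) uv pow2_cases[OF 3(1)] by (elim disjE exE conjE; simp)
    then show ?thesis using K(2-5) 3(4,5) by (elim disjE conjE; simp add: mersenne_like_def)
  qed
qed

lemma sided_5_P:
  assumes "sided {(1, 0, 0), (5, 1, 0)} a \<alpha> p q"
  shows "q = 0 \<and> (p = 0 \<or> a = 8 \<and> \<alpha> = 4 \<and> p = 1 \<or> even p \<and> p \<ge> 2 \<and> a + 1 = 5 * p \<and> \<alpha> + 1 = p)"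
proof -
  obtain K u v x y z t where K: "exponent_split a K u v \<alpha>"
    "(u, x, y) \<in> {(1, 0, 0), (5, 1, 0)}" "(v, z, t) \<in> {(1, 0, 0), (5, 1, 0)}"
    "p = K * x + z" "q = K * y + t"
    using assms unfolding sided_def by blast
  have uv: "u = 1 \<or> u = 5" "v = 1 \<or> v = 5" using K(2,3) by auto
  from K(1) show ?thesis
  proof (cases rule: exponent_split_cases)
    case 1
    then show ?thesis using K(2-5) pow2_even[OF 1(1)] 1(1) by (auto simp: pow2_Suc_mersenne_like)
  next
    case 2
    have "u = 1 \<and> v = 1 \<and> K = 2"
      using 2(6) uv pow2_cases[OF 2(1)] by (elim disjE exE conjE; simp)
    then show ?thesis using K(2-5) 2(4,5) by (elim disjE conjE; simp add: mersenne_like_def)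
  next
    case 3
    have "u = 1 \<and> v = 5 \<and> K = 4"
      using 3(6) uv pow2_cases[OF 3(1)] by (elim disjE exE conjE; simp)
    then show ?thesis using K(2-5) 3(4,5) by (elim disjE conjE; simp add: mersenne_like_def)
  qed
qed

lemma sided_7:
  assumes "sided {(1, 0, 0), (7, 1, 1)} a \<alpha> p q"
  shows "p = q \<and> (p = 0 \<and> a = \<alpha> \<and> mersenne_like a \<or> p = 1 \<and> a = 14 \<and> \<alpha> = 8 \<or>
    even p \<and> p \<ge> 2 \<and> a + 1 = 7 * p \<and> \<alpha> + 1 = p)"
proof -
  obtain K u v x y z t where K: "exponent_split a K u v \<alpha>"
    "(u, x, y) \<in> {(1, 0, 0), (7, 1, 1)}" "(v, z, t) \<in> {(1, 0, 0), (7, 1, 1)}"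
    "p = K * x + z" "q = K * y + t"
    using assms unfolding sided_def by blast
  have uv: "u = 1 \<or> u = 7" "v = 1 \<or> v = 7" using K(2,3) by auto
  from K(1) show ?thesis
  proof (cases rule: exponent_split_cases)
    case 1
    then show ?thesis using K(2-5) pow2_even[OF 1(1)] 1(1) by (auto simp: pow2_Suc_mersenne_like)
  next
    case 2
    have "u = 1 \<and> v = 1 \<and> K = 2 \<or> u = 1 \<and> v = 7 \<and> K = 8"
      using 2(6) uv pow2_cases[OF 2(1)] by (elim disjE exE conjE; simp)
    then show ?thesis using K(2-5) 2(4,5) by (elim disjE conjE; simp add: mersenne_like_def)
  next
    case 3
    have False
      using 3(6) uv pow2_cases[OF 3(1)] by (elim disjE exE conjE; simp)
    then show ?thesis by blast
  qed
qed

lemma sided_9: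
  assumes "sided {(1, 0, 0), (3, 1, 0), (9, 1, 1)} a \<alpha> p q" "q > 0"
  shows "a = 16 \<and> \<alpha> = 8 \<and> p = 1 \<and> q = 1 \<or> even q \<and> q \<ge> 2 \<and> p = q"
proof -
  obtain K u v x y z t where K: "exponent_split a K u v \<alpha>"
    "(u, x, y) \<in> {(1, 0, 0), (3, 1, 0), (9, 1, 1)}" "(v, z, t) \<in> {(1, 0, 0), (3, 1, 0), (9, 1, 1)}"
    "p = K * x + z" "q = K * y + t"
    using assms unfolding sided_def by blast
  have uv: "u = 1 \<or> u = 3 \<or> u = 9" "v = 1 \<or> v = 3 \<or> v = 9" using K(2,3) by auto
  from K(1) show ?thesis
  proof (cases rule: exponent_split_cases)
    case 1
    then show ?thesis using K(2-5) pow2_even[OF 1(1)] assms(2) by auto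
  next
    case 2
    have "u = 1 \<and> v = 1 \<and> K = 2 \<or> u = 1 \<and> v = 3 \<and> K = 4"
      using 2(6) uv pow2_cases[OF 2(1)] by (elim disjE exE conjE; simp)
    then show ?thesis using K(2-5) 2(4,5) assms(2) by (elim disjE conjE; simp add: mersenne_like_def)
  next
    case 3
    have "u = 1 \<and> v = 3 \<and> K = 2 \<or> u = 1 \<and> v = 9 \<and> K = 8"
      using 3(6) uv pow2_cases[OF 3(1)] by (elim disjE exE conjE; simp)
    then show ?thesis using K(2-5) 3(4,5) assms(2) by (elim disjE conjE; simp add: mersenne_like_def)
  qed
qed

lemma sided_25:
  assumes "sided {(1, 0, 0), (5, 1, 0), (25, 1, 1)} a \<alpha> p q" "q > 0"
  shows "even q \<and> q \<ge> 2 \<and> p = q"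
proof -
  obtain K u v x y z t where K: "exponent_split a K u v \<alpha>"
    "(u, x, y) \<in> {(1, 0, 0), (5, 1, 0), (25, 1, 1)}" "(v, z, t) \<in> {(1, 0, 0), (5, 1, 0), (25, 1, 1)}"
    "p = K * x + z" "q = K * y + t"
    using assms unfolding sided_def by blast
  have uv: "u = 1 \<or> u = 5 \<or> u = 25" "v = 1 \<or> v = 5 \<or> v = 25" using K(2,3) by auto
  from K(1) show ?thesis
  proof (cases rule: exponent_split_cases)
    case 1
    then show ?thesis using K(2-5) pow2_even[OF 1(1)] assms(2) by auto
  next
    case 2
    have "u = 1 \<and> v = 1 \<and> K = 2"
      using 2(6) uv pow2_cases[OF 2(1)] by (elim disjE exE conjE; simp)
    then show ?thesis using K(2-5) 2(4,5) assms(2) by (elim disjE conjE; simp add: mersenne_like_def)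
  next
    case 3
    have "u = 1 \<and> v = 5 \<and> K = 4"
      using 3(6) uv pow2_cases[OF 3(1)] by (elim disjE exE conjE; simp)
    then show ?thesis using K(2-5) 3(4,5) assms(2) by (elim disjE conjE; simp add: mersenne_like_def)
  qed
qed

section \<open>Exponent equations of the individual configurations\<close>

lemma mersenne_likeD: "mersenne_like c \<Longrightarrow> c > 0 \<and> (even c \<longrightarrow> c = 2) \<and> (c mod 4 = 1 \<longrightarrow> c = 1)"
proof -
  assume "mersenne_like c"
  then consider "c = 1" | "c = 2" | "c = 3" | "c mod 8 = 7" unfolding mersenne_like_def by blast
  then show ?thesis
  proof cases
    case 4
    define m where "m = c div 8"
    have "c = 8 * m + 7" using div_mult_mod_eq[of c 8] 4 by (simp add: m_def)
    moreover have "(8 * m + 7) mod 4 = 3" by presburger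
    ultimately show ?thesis by simp
  qed simp_all
qed

text \<open>The system for \<open>P = M_1\<close>, \<open>Q = M_4\<close>; its solution belongs to
  \<open>bar C_10\<close>.\<close>

lemma solve_3_5:
  assumes "sided {(1, 0, 0), (3, 1, 0), (5, 0, 1)} a \<alpha> c1 d1" "d1 > 0"
    and "sided {(1, 0, 0), (3, 1, 0)} b \<beta> c2 d2"
    and "a = \<beta> + c + d" "b = \<alpha> + c + 3 * d" "c = c1 + c2" "d = d1 + d2"
    and "mersenne_like c" "mersenne_like d"
  shows "a = 10 \<and> b = 7 \<and> c = 2 \<and> d = 1"
  using sided_3_5[OF assms(1,2)] sided_3[OF assms(3)] assms(4-7)
    mersenne_likeD[OF assms(8)] mersenne_likeD[OF assms(9)]
  by (elim disjE conjE) auto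

text \<open>The system for \<open>P = M_5\<close>, \<open>Q = M_4\<close>. Each prime comes from one
  side only, so \<open>a\<close>, \<open>d\<close> and \<open>b\<close>, \<open>c\<close> are
  determined independently; the four combinations give \<open>C_8\<close>, \<open>C_9\<close>,
  \<open>bar C_9\<close> and \<open>C_12\<close>.\<close>

lemma solve_5_5:
  assumes "sided {(1, 0, 0), (5, 0, 1)} a \<alpha> c1 d1"
    and "sided {(1, 0, 0), (5, 1, 0)} b \<beta> c2 d2"
    and "a = \<beta> + 3 * c + d" "b = \<alpha> + c + 3 * d" "c = c1 + c2" "d = d1 + d2"
    and "mersenne_like c" "mersenne_like d"
  shows "(c = 1 \<and> b = 8 \<or> c = 2 \<and> b = 9) \<and> (d = 1 \<and> a = 8 \<or> d = 2 \<and> a = 9)"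
  using sided_5_Q[OF assms(1)] sided_5_P[OF assms(2)] assms(3-6)
    mersenne_likeD[OF assms(7)] mersenne_likeD[OF assms(8)]
  by (elim disjE conjE) auto

text \<open>The system for \<open>M_2\<close> and \<open>M_3\<close> in either order. Both primes
  always arrive together through index 7, so \<open>c = d\<close>, and only the sums
  \<open>i + k\<close> and \<open>j + l\<close> matter.\<close>

lemma solve_7:
  assumes "sided {(1, 0, 0), (7, 1, 1)} a \<alpha> c1 d1" "sided {(1, 0, 0), (7, 1, 1)} b \<beta> c2 d2"
    and "a = \<beta> + i * c + k * d" "b = \<alpha> + j * c + l * d" "c = c1 + c2" "d = d1 + d2"
    and "mersenne_like c" "i + k = 3" "j + l = 3"
  shows "c = 2 \<and> d = 2 \<and> (a = 14 \<and> b = 14 \<or> a = 13 \<and> b = 7 \<or> a = 7 \<and> b = 13)"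
proof -
  have "d = c" using sided_7[OF assms(1)] sided_7[OF assms(2)] assms(5,6) by auto
  moreover have "a = \<beta> + 3 * c" "b = \<alpha> + 3 * c"
    using assms(3,4,8,9) \<open>d = c\<close> by (simp_all add: add.assoc add_mult_distrib[symmetric])
  \<comment> \<open>If one side is trivial and the other contributes \<open>c = 1\<close> with
    exponent 14, the equations force the exponent 11 on the trivial side.\<close>
  moreover have "\<not> mersenne_like 11" by (simp add: mersenne_like_def)
  ultimately show ?thesis
    using sided_7[OF assms(1)] sided_7[OF assms(2)] assms(5) mersenne_likeD[OF assms(7)]
    by (elim disjE conjE) auto
qed

text \<open>The system for \<open>P = geo X 3\<close>, \<open>Q = geo (X ^ 3) 3\<close>, where index
  9 contributes both primes and \<open>1 + Q\<close> contributes \<open>P\<close> once more.\<close>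

lemma solve_9:
  assumes "sided {(1, 0, 0), (3, 1, 0), (9, 1, 1)} a \<alpha> c1 d1" "d1 > 0"
    and "sided {(1, 0, 0), (3, 1, 0)} b \<beta> c2 d2"
    and "b = \<alpha> + c + d" "c = c1 + c2 + d" "d = d1 + d2"
    and "mersenne_like c" "mersenne_like d"
  shows False
proof -
  \<comment> \<open>11 is the value of \<open>b\<close> for \<open>d = 1\<close>,
    \<open>c2 = 0\<close>; 5 is the value of \<open>c\<close> for \<open>d = 2\<close>,
    \<open>c2 = 1\<close>.\<close>
  have "\<not> mersenne_like 11" "\<not> mersenne_like 5" by (simp_all add: mersenne_like_def)
  then show ?thesis
    using sided_9[OF assms(1,2)] sided_3[OF assms(3)] assms(4-7)
    mersenne_likeD[OF assms(7)] mersenne_likeD[OF assms(8)]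
    by (elim disjE conjE) auto
qed

text \<open>The other side contributes nothing, so \<open>c = 4 * d\<close> with \<open>d\<close>
  even, whereas an even \<open>c\<close> must be 2.\<close>

lemma solve_25:
  assumes "sided {(1, 0, 0), (5, 1, 0), (25, 1, 1)} a \<alpha> c1 d1" "d1 > 0"
    and "sided {(1, 0, 0)} b \<beta> c2 d2"
    and "c = c1 + c2 + 3 * d" "d = d1 + d2"
    and "mersenne_like c" "mersenne_like d"
  shows False
  using sided_25[OF assms(1,2)] sided_1[OF assms(3)] assms(4,5)
    mersenne_likeD[OF assms(6)] mersenne_likeD[OF assms(7)]
  by auto

text \<open>A positive contribution is 1 or even, so an odd sum of two of them has exactly one equal
  to 1.\<close>

lemma odd_sum_sided_3:
  assumes "sided {(1, 0, 0), (3, 1, 0)} a \<alpha> c1 0" "sided {(1, 0, 0), (3, 1, 0)} b \<beta> c2 0"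
    and "odd (c1 + c2)" "c1 > 0" "c2 > 0"
  shows "c1 = 1 \<and> b + 1 = 3 * c2 \<and> \<beta> + 1 = c2 \<and> (a = 4 \<and> \<alpha> = 2 \<or> a = 6 \<and> \<alpha> = 4) \<or>
    c2 = 1 \<and> a + 1 = 3 * c1 \<and> \<alpha> + 1 = c1 \<and> (b = 4 \<and> \<beta> = 2 \<or> b = 6 \<and> \<beta> = 4)"
proof -
  consider "odd c1" "even c2" | "even c1" "odd c2" using assms(3) by auto
  then show ?thesis
  proof cases
    case 1
    then show ?thesis using sided_3[OF assms(1)] sided_3[OF assms(2)] assms(4,5) by auto
  next
    case 2
    then show ?thesis using sided_3[OF assms(1)] sided_3[OF assms(2)] assms(4,5) by auto
  qed
qed

text \<open>The system for \<open>P = M_1\<close>, \<open>Q = S_1\<close>. As \<open>d\<close> is 1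
  or 2, the index 3 in \<open>P\<close> leaves three values of \<open>c\<close>, and
  \<open>c - d = c1 + c2\<close> is 3 or 5 in each of them.\<close>

lemma solve_geo_P_3:
  assumes "sided {(1, 0, 0), (3, 1, 0)} a \<alpha> c1 0" "sided {(1, 0, 0), (3, 1, 0)} b \<beta> c2 0"
    and "sided {(1, 0, 0), (3, 1, 0)} c \<gamma> d 0"
    and "a = \<beta> + \<gamma> + d" "b = \<alpha> + \<gamma> + d" "c = c1 + c2 + d" "mersenne_like d" "c1 > 0" "c2 > 0"
  shows "(a = 4 \<and> b = 5 \<or> a = 5 \<and> b = 4) \<and> (c = 4 \<and> d = 1 \<or> c = 5 \<and> d = 2)"
proof -
  have c: "d = 1 \<and> c = 4 \<and> \<gamma> = 2 \<or> d = 1 \<and> c = 6 \<and> \<gamma> = 4 \<or> d = 2 \<and> c = 5 \<and> \<gamma> = 1"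
    using sided_3[OF assms(3)] mersenne_likeD[OF assms(7)] by auto
  then have n: "c1 + c2 = 3 \<or> c1 + c2 = 5" using assms(6) by (elim disjE conjE) simp_all
  then have "odd (c1 + c2)" by (elim disjE) simp_all
  from odd_sum_sided_3[OF assms(1,2) this assms(8,9)] show ?thesis
  proof (elim disjE)
    assume *: "c1 = 1 \<and> b + 1 = 3 * c2 \<and> \<beta> + 1 = c2 \<and> (a = 4 \<and> \<alpha> = 2 \<or> a = 6 \<and> \<alpha> = 4)"
    then have "c2 = 2 \<and> \<beta> = 1 \<and> b = 5 \<or> c2 = 4 \<and> \<beta> = 3 \<and> b = 11" using n by (elim disjE conjE) simp_all
    then show ?thesis using * c assms(4-6) by (elim disjE conjE) simp_all
  next
    assume *: "c2 = 1 \<and> a + 1 = 3 * c1 \<and> \<alpha> + 1 = c1 \<and> (b = 4 \<and> \<beta> = 2 \<or> b = 6 \<and> \<beta> = 4)"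
    then have "c1 = 2 \<and> \<alpha> = 1 \<and> a = 5 \<or> c1 = 4 \<and> \<alpha> = 3 \<and> a = 11" using n by (elim disjE conjE) simp_all
    then show ?thesis using * c assms(4-6) by (elim disjE conjE) simp_all
  qed
qed

text \<open>In both options for \<open>c\<close> one finds \<open>c1 + c2 = 7\<close> and
  \<open>\<gamma> + 3 * d = 7\<close>. Thus one contribution is 1 and the other 6, and the exponent
  that should be 4 or 6 comes out as 12.\<close>

lemma solve_geo_P_5:
  assumes "sided {(1, 0, 0), (3, 1, 0)} a \<alpha> c1 0" "sided {(1, 0, 0), (3, 1, 0)} b \<beta> c2 0"
    and "sided {(1, 0, 0), (5, 1, 0)} c \<gamma> d 0"
    and "a = \<beta> + \<gamma> + 3 * d" "b = \<alpha> + \<gamma> + 3 * d" "c = c1 + c2 + d" "mersenne_like d" "c1 > 0" "c2 > 0"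
  shows False
proof -
  have c: "d = 1 \<and> c = 8 \<and> \<gamma> = 4 \<or> d = 2 \<and> c = 9 \<and> \<gamma> = 1"
    using sided_5_P[OF assms(3)] mersenne_likeD[OF assms(7)] by auto
  then have n: "c1 + c2 = 7" using assms(6) by (elim disjE conjE) simp_all
  then have "odd (c1 + c2)" by simp
  from odd_sum_sided_3[OF assms(1,2) this assms(8,9)] show ?thesis
    using n c assms(4-6) by (elim disjE conjE) simp_all
qed

text \<open>With \<open>M = 2 ^ m\<close>, the top index \<open>M * w + 1\<close> can occur as
  \<open>u\<close> only for odd \<open>a\<close>. As \<open>v\<close> it needs \<open>K * u\<close>
  to be \<open>M * w\<close> or \<open>M * w + 2\<close>: the former has only the solution
  \<open>K = M\<close>, \<open>u = w\<close>, and the latter has none once index 7 is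
  excluded.\<close>

lemma sided_power_family:
  assumes "sided {(1, 0, 0), (w, 1, 0), (2 ^ m * w + 1, 0, 1)} a \<alpha> p q" "q > 0"
    and w: "w = 3 \<or> w = 5" and m: "m > 0" and not7: "\<not> (w = 3 \<and> m = 1)"
  shows "p = 2 ^ m \<and> q = 1 \<or> p = 0 \<and> even q"
proof -
  define M :: nat where "M = 2 ^ m"
  have M: "pow2 M" using m by (auto simp: pow2_def M_def)
  have M2: "M \<ge> 2" using pow2_even[OF M] by simp
  have M3: "M \<noteq> 2" if "w = 3"
  proof
    assume "M = 2"
    then have "m = 1" using power_inject_exp[of "2::nat" m 1] by (simp add: M_def)
    then show False using not7 that by simp
  qed
  let ?S = "{(1, 0, 0), (w, 1, 0), (M * w + 1, 0, 1)} :: (nat \<times> nat \<times> nat) set"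
  obtain K u v x y z t where K: "exponent_split a K u v \<alpha>" "(u, x, y) \<in> ?S" "(v, z, t) \<in> ?S"
    "p = K * x + z" "q = K * y + t"
    using assms(1) unfolding sided_def M_def by blast
  have MwP: "M * w + 1 > w" "M * w + 1 > 1" using M2 w by auto
  have u: "u = 1 \<and> x = 0 \<and> y = 0 \<or> u = w \<and> x = 1 \<and> y = 0 \<or> u = M * w + 1 \<and> x = 0 \<and> y = 1"
    and v: "v = 1 \<and> z = 0 \<and> t = 0 \<or> v = w \<and> z = 1 \<and> t = 0 \<or> v = M * w + 1 \<and> z = 0 \<and> t = 1"
    using K(2,3) by auto
  have small: "\<not> K * (M * w + 1) \<le> v + 1" if "K \<ge> 2"
  proof -
    have *: "\<not> K * U \<le> v + 1" if "v \<le> U" "U > 1" for U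
      using mult_le_mono1[OF \<open>K \<ge> 2\<close>, of U] that by linarith
    have "v \<le> M * w + 1" using v MwP by auto
    then show ?thesis using MwP * by blast
  qed
  from K(1) show ?thesis
  proof (cases rule: exponent_split_cases)
    case 1
    then have "z = 0 \<and> t = 0" using v w MwP by auto
    then show ?thesis using u K(4,5) pow2_even[OF 1(1)] assms(2) by auto
  next
    case 2
    have "K \<ge> 2" using pow2_even[OF 2(1)] by simp
    then have "u \<noteq> M * w + 1" using small 2(6) by auto
    then have "v = M * w + 1" using u v K(5) assms(2) by auto
    then have "K * u = M * w + 2" using 2(6) by simp
    moreover have "u = 1 \<or> u = w" using u \<open>u \<noteq> M * w + 1\<close> by auto
    ultimately have False
    proof (elim disjE)
      assume "K * u = M * w + 2" "u = w"
      then have "w dvd M * w + 2" by (metis dvd_triv_right)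
      then have "w dvd 2" using dvd_add_right_iff[of w "M * w" 2] by (metis dvd_triv_right)
      then show False using w by auto
    next
      assume "K * u = M * w + 2" "u = 1"
      then have K': "K = M * w + 2" by simp
      show False
      \<comment> \<open>\<open>K = M * w + 2\<close> fails modulo 4 unless \<open>M = 2\<close>.
        Then \<open>K\<close> is 8 or 12, and 8 belongs to \<open>w = 3\<close>, the excluded index
        7.\<close>
      proof (cases "M = 2")
        case True
        then show False using K' w M3 pow2_cases[OF 2(1)] by (elim disjE exE conjE; simp)
      next
        case False
        have four: "4 dvd L" if "pow2 L" "L \<noteq> 2" for L
          using pow2_cases[OF that(1)] that(2) by (elim disjE exE conjE) simp_all
        have "4 dvd M" "4 dvd K" using four[OF M False] four[OF 2(1)] K' M2 w by auto
        then have "4 dvd (2::nat)" using dvd_add_right_iff[of 4 "M * w" 2] K' by (metis dvd_mult2)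
        then show False by simp
      qed
    qed
    then show ?thesis ..
  next
    case 3
    have "K \<ge> 2" using pow2_even[OF 3(1)] by simp
    then have "u \<noteq> M * w + 1" using small 3(6) by auto
    then have vz: "v = M * w + 1" "z = 0" "t = 1" using u v K(5) assms(2) by auto
    then have Ku: "K * u = M * w" using 3(6) by simp
    obtain k where k: "K = 2 ^ k" using 3(1) by (auto simp: pow2_def)
    have "k = m \<and> u = w"
      using two_power_odd_eq[of k u m w] Ku 3(2) w by (auto simp: k M_def)
    then have "K = M" "x = 1" "y = 0" using u w \<open>u \<noteq> M * w + 1\<close> by (auto simp: k M_def)
    then show ?thesis using K(4,5) vz by (simp add: M_def)
  qed
qed

text \<open>Both alternatives for \<open>c1\<close> and \<open>d\<close> lead to
  \<open>c = 2 * M + c2\<close> with \<open>M = 2 ^ m\<close> even. So \<open>c\<close> agrees with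
  \<open>c2\<close> modulo 4: either \<open>c\<close> is 1 modulo 4, forcing \<open>c = 1\<close>,
  or it is even, forcing \<open>c = 2\<close>. Both are too small.\<close>

lemma solve_power_family:
  assumes "sided {(1, 0, 0), (w, 1, 0), (2 ^ m * w + 1, 0, 1)} a \<alpha> c1 d1" "d1 > 0"
    and w: "w = 3 \<or> w = 5" and m: "m > 0" and not7: "\<not> (w = 3 \<and> m = 1)"
    and "sided {(1, 0, 0), (3, 1, 0)} b \<beta> c2 d2"
    and eqs: "c = c1 + c2 + 2 ^ m * d" "d = d1 + d2" "mersenne_like c" "mersenne_like d"
  shows False
proof -
  define M :: nat where "M = 2 ^ m"
  have "pow2 M" using m by (auto simp: pow2_def M_def)
  then have M: "even M" "M \<ge> 2" using pow2_even by auto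
  have c2: "c2 = 0 \<or> c2 = 1 \<or> even c2" "d2 = 0" using sided_3[OF assms(6)] by auto
  have "c1 = M \<and> d1 = 1 \<or> c1 = 0 \<and> even d1"
    using sided_power_family[OF assms(1,2) w m not7] by (simp add: M_def)
  moreover have "d1 = 2" if "even d1" using that eqs(2) c2(2) mersenne_likeD[OF eqs(4)] by simp
  ultimately have "c = 2 * M + c2" using eqs(1,2) c2(2) by (auto simp: M_def)
  moreover obtain n where "M = 2 * n" using M(1) by (elim evenE)
  ultimately have c: "c = 4 * n + c2" "n > 0" using M(2) by auto
  from c2(1) show False
  proof (elim disjE)
    assume "c2 = 1"
    then have "c mod 4 = 1" using c by simp
    then show False using mersenne_likeD[OF eqs(3)] c by simp
  qed (use mersenne_likeD[OF eqs(3)] c in simp_all)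
qed

section \<open>Solving the system of exponents\<close>

definition X_side :: "bit poly \<Rightarrow> bit poly \<Rightarrow> (nat \<times> nat \<times> nat) set" where
  "X_side P Q = {(u, x, y). odd u \<and> x \<le> 1 \<and> y \<le> 1 \<and> geo X u = P ^ x * Q ^ y}"

definition listed :: "bit poly \<Rightarrow> bool" where
  "listed A \<longleftrightarrow> A \<in> {C_8, C_9, C_10, C_11, C_12, C_13, D_1, D_2} \<or>
    bar A \<in> {C_8, C_9, C_10, C_11, C_12, C_13, D_1, D_2}"

lemma listed_bar: "listed (bar A) \<longleftrightarrow> listed A"
  unfolding listed_def bar_bar by blast

section \<open>The named polynomials as geometric sums and in the form
  \<open>1 + X ^ i * Y ^ j\<close>\<close>

lemma geo_3: "geo Z 3 = 1 + Z * (1 + Z)" and geo_5: "geo Z 5 = 1 + Z * (1 + Z) ^ 3"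
  by (simp_all add: numeral_eq_Suc geo_Suc algebra_simps)

lemma geo_X_3_5: "w = 3 \<or> w = 5 \<Longrightarrow> geo X w = 1 + X ^ 1 * Y ^ (w - 2)"
proof (elim disjE)
  assume w: "w = 3"
  show ?thesis unfolding w geo_3 one_plus_X power_one_right by simp
next
  assume w: "w = 5"
  show ?thesis unfolding w geo_5 one_plus_X power_one_right by simp
qed

lemma geo_X_7: "geo X 7 = M_2 * M_3"
  by (simp add: geo_def M_2_def M_3_def numeral_eq_Suc one_pCons)

lemma degree_M_2_3: "degree M_2 = 3" "degree M_3 = 3"
  by (simp_all add: M_2_def M_3_def numeral_eq_Suc one_pCons)

lemma M_eq_geo: "M_1 = geo X 3" "M_4 = geo X 5"
  by (simp_all add: geo_def M_1_def M_4_def numeral_eq_Suc one_pCons)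

lemma M_eq: "M_1 = 1 + X ^ 1 * Y ^ 1" "M_2 = 1 + X ^ 1 * Y ^ 2" "M_3 = 1 + X ^ 2 * Y ^ 1"
  "M_4 = 1 + X ^ 1 * Y ^ 3" "M_5 = 1 + X ^ 3 * Y ^ 1"
  by (simp_all add: M_1_def M_2_def M_3_def M_4_def M_5_def numeral_eq_Suc one_pCons)

lemma S_1_eq: "S_1 = geo M_1 3"
  by (simp add: S_1_def M_1_def geo_def numeral_eq_Suc one_pCons)

lemma bar_Mersenne: "bar (1 + X ^ i * Y ^ j) = 1 + X ^ j * Y ^ i"
  by (simp only: bar_add bar_1 bar_mult bar_power bar_X bar_Y mult.commute)

lemma bar_M: "bar M_1 = M_1" "bar M_2 = M_3" "bar M_3 = M_2" "bar M_4 = M_5" "bar M_5 = M_4"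
  "bar S_1 = S_1"
proof -
  show "bar M_1 = M_1" unfolding M_eq bar_Mersenne ..
  then show "bar S_1 = S_1" unfolding S_1_eq bar_geo by simp
  show "bar M_2 = M_3" unfolding M_eq bar_Mersenne ..
  then show "bar M_3 = M_2" by (metis bar_bar)
  show "bar M_4 = M_5" unfolding M_eq bar_Mersenne ..
  then show "bar M_5 = M_4" by (metis bar_bar)
qed

lemma not_prime_geo_X_7: "\<not> prime (geo X 7)"
proof
  assume "prime (geo X 7)"
  then have "M_2 = 1 \<or> M_3 = 1"
    unfolding geo_X_7 by (metis is_unit_bit_poly_iff prime_elem_imp_irreducible irreducibleD prime_imp_prime_elem)
  then show False using degree_M_2_3 by auto
qed

lemma geo_X_index: "odd u \<Longrightarrow> geo X u = R \<Longrightarrow> u = degree R + 1"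
  using degree_geo[of X u] odd_pos[of u] by auto

context odd_prime_pair
begin

section \<open>Which products of \<open>P\<close> and \<open>Q\<close> are geometric sums in
  \<open>X\<close>\<close>

lemma X_side_cases:
  assumes "(u, x, y) \<in> X_side P Q"
  obtains "u = 1" "x = 0" "y = 0" | "odd u" "x = 1" "y = 0" "geo X u = P"
  | "odd u" "x = 0" "y = 1" "geo X u = Q" | "odd u" "x = 1" "y = 1" "geo X u = P * Q"
proof -
  have u: "odd u" "geo X u = P ^ x * Q ^ y" "x = 0 \<or> x = 1" "y = 0 \<or> y = 1"
    using assms by (auto simp: X_side_def)
  from u(3,4) show ?thesis
  proof (elim disjE)
    assume "x = 0" "y = 0"
    then show ?thesis using u that(1) geo_eq_1_iff[of X u] by simp
  qed (use u that in auto)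
qed

lemma X_side_subset:
  assumes "(1, 0, 0) \<in> S"
    and "\<And>u. odd u \<Longrightarrow> geo X u = P \<Longrightarrow> u = degree P + 1 \<Longrightarrow> (u, 1, 0) \<in> S"
    and "\<And>u. odd u \<Longrightarrow> geo X u = Q \<Longrightarrow> u = degree Q + 1 \<Longrightarrow> (u, 0, 1) \<in> S"
    and "\<And>u. odd u \<Longrightarrow> geo X u = P * Q \<Longrightarrow> (u, 1, 1) \<in> S"
  shows "X_side P Q \<subseteq> S"
proof (rule subsetI)
  fix t assume t: "t \<in> X_side P Q"
  obtain u x y where uxy: "t = (u, x, y)" by (cases t)
  from t[unfolded uxy] show "t \<in> S"
  proof (cases rule: X_side_cases)
    case 1
    then show ?thesis using assms(1) uxy by simp
  next
    case 2
    then show ?thesis using assms(2)[OF 2(1,4) geo_X_index[OF 2(1,4)]] uxy by simp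
  next
    case 3
    then show ?thesis using assms(3)[OF 3(1,4) geo_X_index[OF 3(1,4)]] uxy by simp
  next
    case 4
    then show ?thesis using assms(4)[OF 4(1,4)] uxy by simp
  qed
qed

lemma geo_X_P_exponents:
  assumes "w = 3 \<or> w = 5" "geo X w = P"
  shows "i = 1 \<and> j = w - 2"
proof -
  have "X ^ i * Y ^ j = X ^ 1 * Y ^ (w - 2)"
    using geo_X_3_5[OF assms(1)] assms(2) P_eq by (metis add_left_cancel)
  then show ?thesis using exponents_eq3[of i j 0 1 "w - 2" 0] by simp
qed

lemma geo_X_Q_exponents:
  assumes "w = 3 \<or> w = 5" "geo X w = Q"
  shows "k = 1 \<and> l = w - 2 \<and> e = 0"
proof -
  have "X ^ k * Y ^ l * P ^ e = X ^ 1 * Y ^ (w - 2)"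
    using geo_X_3_5[OF assms(1)] assms(2) Q_eq by (metis add_left_cancel)
  then show ?thesis using exponents_eq3[of k l e 1 "w - 2" 0] by simp
qed

text \<open>\<open>1 + X ^ w = Y * P\<close> is substituted into
  \<open>geo Z w = 1 + Z * (1 + Z) ^ (w - 2)\<close>, which holds for both values of
  \<open>w\<close>, at \<open>Z = X ^ w\<close>.\<close>

lemma geo_X_PQ_exponents:
  assumes w: "w = 3 \<or> w = 5" and P: "geo X w = P" and Q: "Q = geo (X ^ w) w"
  shows "k = w \<and> l = w - 2 \<and> e = w - 2"
proof -
  have "1 + X ^ w = Y * P" using geo_mult[of X w] by (simp only: P one_plus_X)
  moreover have "geo Z w = 1 + Z * (1 + Z) ^ (w - 2)" for Z
    using w geo_3[of Z] geo_5[of Z] by auto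
  ultimately have "Q = 1 + X ^ w * (Y * P) ^ (w - 2)" using Q by simp
  then have "X ^ k * Y ^ l * P ^ e = X ^ w * Y ^ (w - 2) * P ^ (w - 2)"
    using Q_eq by (metis add_left_cancel mult.assoc power_mult_distrib)
  then show ?thesis by (rule exponents_eq3)
qed

text \<open>The first equation gives \<open>j = u - 2\<close> and the second, read after
  \<open>bar\<close>, gives \<open>j = 1\<close>. So \<open>M_1\<close> is the only \<open>P\<close>
  that is a geometric sum in \<open>X\<close> and in \<open>Y\<close>.\<close>

lemma geo_X_P_bar:
  assumes "odd u" "geo X u = P" "odd v" "geo X v = bar P"
  shows "u = 3 \<and> v = 3"
proof -
  interpret bar: odd_prime_pair "bar P" "bar Q" j i l k e by (rule odd_prime_pair_bar)
  have u: "u = 3 \<or> u = 5" using geo_X_eq_P assms by blast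
  have v: "v = 3 \<or> v = 5" using bar.geo_X_eq_P assms by blast
  have "u = v" using geo_X_index[OF assms(1,2)] geo_X_index[OF assms(3,4)] by simp
  moreover have "j = u - 2" "j = 1"
    using geo_X_P_exponents[OF u assms(2)] bar.geo_X_P_exponents[OF v assms(4)] by auto
  ultimately show ?thesis using u v by auto
qed

lemma geo_X_neq_PQ_degree_4:
  assumes "degree Q = 4" "odd u"
  shows "geo X u \<noteq> P * Q"
proof
  assume "geo X u = P * Q"
  then show False
  proof (rule geo_X_eq_PQ[OF assms(2)])
    assume "P = M_2 \<and> Q = M_3 \<or> P = M_3 \<and> Q = M_2"
    then show False using assms(1) degree_M_2_3 by auto
  next
    fix w assume "w = 3 \<or> w = 5" "Q = geo (X ^ w) w"
    then show False using assms(1) by (auto simp: degree_geo degree_power_eq)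
  qed
qed

text \<open>Here \<open>Q = M_4\<close> has degree 4, which leaves few shapes for \<open>P\<close>:
  \<open>M_1\<close> and \<open>M_5\<close> give solutions, degree 3 is impossible, and the
  remaining two are \<open>Q\<close> itself and a square.\<close>

lemma solution_Q_geo_5:
  assumes Q5: "geo X 5 = Q"
    and sX: "sided (X_side P Q) a \<alpha> c1 d1" "d1 > 0" and sY: "sided (X_side (bar P) (bar Q)) b \<beta> c2 d2"
    and eqs: "a = \<beta> + i * c + k * d" "b = \<alpha> + j * c + l * d" "c = c1 + c2 + e * d" "d = d1 + d2"
    and ml: "mersenne_like c" "mersenne_like d"
  shows "listed (X ^ a * Y ^ b * P ^ c * Q ^ d)"
proof -
  interpret bar: odd_prime_pair "bar P" "bar Q" j i l k e by (rule odd_prime_pair_bar)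
  have QM: "Q = M_4" using Q5 M_eq_geo by simp
  have kle: "k = 1" "l = 3" "e = 0" using geo_X_Q_exponents[OF _ Q5] by auto
  have dQ: "degree Q = 4" using degree_Q kle by simp
  have "i + j \<le> 4" using degree_le degree_P dQ by simp
  have Qbar: "geo X u \<noteq> bar Q" if "odd u" for u
  proof
    assume u: "geo X u = bar Q"
    have "u = 5" using geo_X_index[OF that u] dQ by simp
    then show False using bar.geo_X_Q_exponents[of 5] u kle by simp
  qed
  have PQ: "geo X u \<noteq> P * Q" "geo X u \<noteq> bar P * bar Q" if "odd u" for u
    using geo_X_neq_PQ_degree_4[OF dQ that] bar.geo_X_neq_PQ_degree_4[of u] dQ that by auto
  consider "i = 1 \<and> j = 1" | "i + j = 3" | "i = 1 \<and> j = 3" | "i = 2 \<and> j = 2" | "i = 3 \<and> j = 1"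
    using pos(1,2) \<open>i + j \<le> 4\<close> by linarith
  then show ?thesis
  proof cases
    case 1
    then have PM: "P = M_1" using P_eq M_eq by simp
    then have P3: "geo X 3 = P" using M_eq_geo by simp
    have "X_side P Q \<subseteq> {(1, 0, 0), (3, 1, 0), (5, 0, 1)}"
      by (rule X_side_subset) (use degree_P 1 dQ PQ in auto)
    moreover have "X_side (bar P) (bar Q) \<subseteq> {(1, 0, 0), (3, 1, 0)}"
      by (rule bar.X_side_subset) (use degree_P 1 PQ Qbar in auto)
    ultimately have "a = 10 \<and> b = 7 \<and> c = 2 \<and> d = 1"
      using solve_3_5[OF sided_mono[OF sX(1)] sX(2) sided_mono[OF sY], of c d] eqs ml kle 1 by simp
    then have "X ^ a * Y ^ b * P ^ c * Q ^ d = bar C_10"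
      unfolding PM QM C_10_def X_plus_one bar_mult bar_power bar_M bar_X bar_Y by (simp only: power_one_right mult_ac)
    then show ?thesis by (simp add: listed_def)
  next
    case 2
    \<comment> \<open>Degree 3 would require the even index 4. So no sum in \<open>X\<close> or
      \<open>Y\<close> contributes \<open>P\<close>, and \<open>c\<close> would be 0.\<close>
    have P: "geo X u \<noteq> P" "geo X u \<noteq> bar P" if "odd u" for u
      using geo_X_index[OF that, of P] geo_X_index[OF that, of "bar P"] degree_P 2 that by auto
    have "X_side P Q \<subseteq> {(1, 0, 0), (5, 0, 1)}"
      by (rule X_side_subset) (use P dQ PQ in auto)
    then have "c1 = 0" using sided_5_Q[OF sided_mono[OF sX(1)]] by blast
    moreover have "X_side (bar P) (bar Q) \<subseteq> {(1, 0, 0)}"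
      by (rule bar.X_side_subset) (use P PQ Qbar in auto)
    then have "c2 = 0" using sided_1[OF sided_mono[OF sY]] by blast
    ultimately have "c = 0" using eqs(3) kle by simp
    then show ?thesis using mersenne_likeD[OF ml(1)] by simp
  next
    case 3
    then have "P = Q" using P_eq M_eq QM by simp
    then show ?thesis using P_neq_Q by blast
  next
    case 4
    then have "P = (1 + X ^ 1 * Y ^ 1)\<^sup>2" by (simp only: P_eq power2_sum power_mult_distrib power_one_right) simp
    then show ?thesis using prime_P by (simp add: prime_power_iff)
  next
    case 5
    then have PM: "P = M_5" using P_eq M_eq by simp
    have dP: "degree P = 4" using degree_P 5 by simp
    have P: "geo X u \<noteq> P" if "odd u" for u
    proof
      assume u: "geo X u = P"
      then have "u = 5" using geo_X_index[OF that u] dP by simp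
      then show False using u Q5 P_neq_Q by simp
    qed
    have "X_side P Q \<subseteq> {(1, 0, 0), (5, 0, 1)}"
      by (rule X_side_subset) (use P dQ PQ in auto)
    moreover have "X_side (bar P) (bar Q) \<subseteq> {(1, 0, 0), (5, 1, 0)}"
      by (rule bar.X_side_subset) (use dP PQ Qbar in auto)
    ultimately have abcd: "(c = 1 \<and> b = 8 \<or> c = 2 \<and> b = 9) \<and> (d = 1 \<and> a = 8 \<or> d = 2 \<and> a = 9)"
      using solve_5_5[OF sided_mono[OF sX(1)] sided_mono[OF sY], of c d] eqs ml kle 5 by simp
    have "X ^ 8 * Y ^ 8 * P ^ 1 * Q ^ 1 = C_8" "X ^ 8 * Y ^ 9 * P ^ 2 * Q ^ 1 = C_9"
      "X ^ 9 * Y ^ 9 * P ^ 2 * Q ^ 2 = C_12" "X ^ 9 * Y ^ 8 * P ^ 1 * Q ^ 2 = bar C_9"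
      unfolding PM QM C_8_def C_9_def C_12_def X_plus_one bar_mult bar_power bar_M bar_X bar_Y
      by (simp_all only: power_one_right mult_ac)
    then show ?thesis using abcd by (elim disjE conjE) (simp_all add: listed_def)
  qed
qed


lemma degree_PQ: "degree (P * Q) = degree P + degree Q"
  using prime_P prime_Q by (intro degree_mult_eq) auto

lemma solution_M_2_M_3:
  assumes PQ: "P = M_2 \<and> Q = M_3 \<or> P = M_3 \<and> Q = M_2"
    and sX: "sided (X_side P Q) a \<alpha> c1 d1" and sY: "sided (X_side (bar P) (bar Q)) b \<beta> c2 d2"
    and eqs: "a = \<beta> + i * c + k * d" "b = \<alpha> + j * c + l * d" "c = c1 + c2 + e * d" "d = d1 + d2"
    and ml: "mersenne_like c"
  shows "listed (X ^ a * Y ^ b * P ^ c * Q ^ d)"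
proof -
  interpret bar: odd_prime_pair "bar P" "bar Q" j i l k e by (rule odd_prime_pair_bar)
  have deg: "degree P = 3" "degree Q = 3" using PQ degree_M_2_3 by auto
  have e: "e = 0" using degree_Q deg pos by (cases e) auto
  have P: "X ^ i * Y ^ j * P ^ 0 = P + 1" and Q: "X ^ k * Y ^ l * P ^ 0 = Q + 1"
    using P_eq Q_eq e by (simp_all add: add.commute)
  have ex: "i + k = 3 \<and> j + l = 3"
  proof -
    have M: "M_2 + 1 = X ^ 1 * Y ^ 2 * P ^ 0" "M_3 + 1 = X ^ 2 * Y ^ 1 * P ^ 0"
      unfolding M_eq by (simp_all only: add_ac bit_poly_add_self bit_poly_add_self_left power_0 mult_1_right)
    from PQ show ?thesis
    proof (elim disjE conjE)
      assume "P = M_2" "Q = M_3"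
      then have "i = 1 \<and> j = 2 \<and> (0::nat) = 0" "k = 2 \<and> l = 1 \<and> (0::nat) = 0"
        using P Q M by (metis exponents_eq3)+
      then show ?thesis by simp
    next
      assume "P = M_3" "Q = M_2"
      then have "i = 2 \<and> j = 1 \<and> (0::nat) = 0" "k = 1 \<and> l = 2 \<and> (0::nat) = 0"
        using P Q M by (metis exponents_eq3)+
      then show ?thesis by simp
    qed
  qed
  have u7: "u = 7" if "odd u" "geo X u = P * Q \<or> geo X u = bar P * bar Q" for u
    using that geo_X_index[OF that(1), of "P * Q"] geo_X_index[OF that(1), of "bar P * bar Q"]
      degree_PQ bar.degree_PQ deg by auto
  have sub: "X_side P Q \<subseteq> {(1, 0, 0), (7, 1, 1)}"
    by (rule X_side_subset) (use deg u7 in auto)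
  have subb: "X_side (bar P) (bar Q) \<subseteq> {(1, 0, 0), (7, 1, 1)}"
    by (rule bar.X_side_subset) (use deg u7 in auto)
  have abcd: "c = 2 \<and> d = 2 \<and> (a = 14 \<and> b = 14 \<or> a = 13 \<and> b = 7 \<or> a = 7 \<and> b = 13)"
    by (rule solve_7[OF sided_mono[OF sX sub] sided_mono[OF sY subb] eqs(1,2) _ eqs(4) ml])
      (use eqs(3) ex e in auto)
  have "X ^ 14 * Y ^ 14 * P ^ 2 * Q ^ 2 = C_13" "X ^ 7 * Y ^ 13 * P ^ 2 * Q ^ 2 = C_11"
    "X ^ 13 * Y ^ 7 * P ^ 2 * Q ^ 2 = bar C_11"
    using PQ unfolding C_13_def C_11_def X_plus_one bar_mult bar_power bar_M bar_X bar_Y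
    by (auto simp only: mult_ac)
  then show ?thesis using abcd by (elim disjE conjE) (simp_all add: listed_def)
qed

text \<open>As \<open>k\<close> and \<open>e\<close> differ from the values in
  \<open>geo_X_eq_Q\<close>, the prime \<open>Q\<close> is not itself a sum in \<open>X\<close> and
  enters only through index \<open>w * w\<close>. In \<open>Y\<close> at most \<open>P\<close>
  occurs, and only for \<open>w = 3\<close>. The exponent equations then fail.\<close>

lemma no_solution_self_reciprocal:
  assumes w: "w = 3 \<or> w = 5" and Pw: "geo X w = P" and Qw: "Q = geo (X ^ w) w"
    and sX: "sided (X_side P Q) a \<alpha> c1 d1" "d1 > 0" and sY: "sided (X_side (bar P) (bar Q)) b \<beta> c2 d2"
    and eqs: "b = \<alpha> + j * c + l * d" "c = c1 + c2 + e * d" "d = d1 + d2"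
    and ml: "mersenne_like c" "mersenne_like d"
  shows False
proof -
  interpret bar: odd_prime_pair "bar P" "bar Q" j i l k e by (rule odd_prime_pair_bar)
  have ij: "i = 1" "j = w - 2" using geo_X_P_exponents[OF w Pw] by auto
  have kle: "k = w" "l = w - 2" "e = w - 2" using geo_X_PQ_exponents[OF w Pw Qw] by auto
  have dP: "degree P = w - 1" using degree_P ij w by auto
  have dQ: "degree Q = w * (w - 1)" using w by (auto simp: Qw degree_geo degree_power_eq)
  have odd_w: "odd w" using w by auto
  have Q: "geo X u \<noteq> Q" if "odd u" for u
  proof
    assume "geo X u = Q"
    then show False by (rule geo_X_eq_Q[OF that]) (use kle w in auto)
  qed
  have "X_side P Q \<subseteq> {(1, 0, 0), (w, 1, 0), (w * w, 1, 1)}"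
  proof (rule X_side_subset)
    fix u assume "odd u" "geo X u = P * Q"
    then have "u = w * w" using geo_X_index[of u "P * Q"] degree_PQ dP dQ w by auto
    then show "(u, 1, 1) \<in> {(1, 0, 0), (w, 1, 0), (w * w, 1, 1)}" by simp
  qed (use dP w Q in auto)
  note sX' = sided_mono[OF sX(1) this]
  have Pb: "u = 3" "w = 3" if "odd u" "geo X u = bar P" for u
    using geo_X_P_bar[OF odd_w Pw that] by auto
  have Qb: "geo X u \<noteq> bar Q" if "odd u" for u
  proof
    assume "geo X u = bar Q"
    then show False
    proof (rule bar.geo_X_eq_Q[OF that])
      fix m :: nat assume "m > 0" "e = 2 ^ m"
      then have "even e" by simp
      then show False using kle w by auto
    qed (use kle w in auto)
  qed
  have PQb: "geo X u \<noteq> bar P * bar Q" if "odd u" for u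
  proof
    assume "geo X u = bar P * bar Q"
    then show False
    proof (rule bar.geo_X_eq_PQ[OF that])
      assume "bar P = M_2 \<and> bar Q = M_3 \<or> bar P = M_3 \<and> bar Q = M_2"
      then have "degree (bar P) = 3" using degree_M_2_3 by metis
      then show False using dP w by auto
    next
      fix v assume "v = 3 \<or> v = 5" "geo X v = bar P" "bar Q = geo (X ^ v) v"
      from bar.geo_X_PQ_exponents[OF this] show False using kle w by auto
    qed
  qed
  show False
  proof (cases "w = 3")
    case True
    have "X_side (bar P) (bar Q) \<subseteq> {(1, 0, 0), (3, 1, 0)}"
    proof (rule bar.X_side_subset)
      fix u assume "odd u" "geo X u = bar P"
      then show "(u, 1, 0) \<in> {(1, 0, 0), (3, 1, 0)}" using Pb(1)[of u] by simp
    qed (use Qb PQb in auto)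
    from solve_9[OF _ sX(2) sided_mono[OF sY this], of a \<alpha> c1 c d] sX' eqs ml kle ij
    show False by (simp add: True)
  next
    case False
    then have w5: "w = 5" using w by simp
    have "X_side (bar P) (bar Q) \<subseteq> {(1, 0, 0)}"
      by (rule bar.X_side_subset) (use Pb Qb PQb False in blast)+
    from solve_25[OF _ sX(2) sided_mono[OF sY this], of a \<alpha> c1 c d] sX' eqs ml kle
    show False by (simp add: w5)
  qed
qed

text \<open>On the \<open>Y\<close> side \<open>Q\<close> does not occur: it would require
  \<open>l = 1\<close> together with \<open>w = 3\<close>, hence the index 7, whose geometric sum is
  reducible.\<close>

lemma no_solution_power_family:
  assumes m: "m > 0" and w: "w = 3 \<or> w = 5" and Pw: "geo X w = P" and Qu: "geo X (2 ^ m * w + 1) = Q"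
    and kle: "k = 1" "l = 2 ^ m - 1" "e = 2 ^ m"
    and sX: "sided (X_side P Q) a \<alpha> c1 d1" "d1 > 0" and sY: "sided (X_side (bar P) (bar Q)) b \<beta> c2 d2"
    and eqs: "c = c1 + c2 + e * d" "d = d1 + d2"
    and ml: "mersenne_like c" "mersenne_like d"
  shows False
proof -
  interpret bar: odd_prime_pair "bar P" "bar Q" j i l k e by (rule odd_prime_pair_bar)
  have dP: "degree P = w - 1" using degree_geo[of X w] Pw by simp
  have dQ: "degree Q = 2 ^ m * w" using degree_geo[of X "2 ^ m * w + 1"] Qu by simp
  have odd_w: "odd w" using w by auto
  have even_e: "even e" using kle m by simp
  have not7: "\<not> (w = 3 \<and> m = 1)" using not_prime_geo_X_7 Qu prime_Q by auto
  have PQ: "geo X u \<noteq> P * Q" if "odd u" for u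
  proof
    assume "geo X u = P * Q"
    then show False
    proof (rule geo_X_eq_PQ[OF that])
      assume "P = M_2 \<and> Q = M_3 \<or> P = M_3 \<and> Q = M_2"
      then have "degree P = 3" using degree_M_2_3 by auto
      then show False using dP w by auto
    next
      fix v assume v: "v = 3 \<or> v = 5" "geo X v = P" "Q = geo (X ^ v) v"
      show False using geo_X_PQ_exponents[OF v] kle v by auto
    qed
  qed
  have "X_side P Q \<subseteq> {(1, 0, 0), (w, 1, 0), (2 ^ m * w + 1, 0, 1)}"
    by (rule X_side_subset) (use dP dQ w PQ in auto)
  note sX' = sided_mono[OF sX(1) this]
  have Pb: "u = 3" "w = 3" if "odd u" "geo X u = bar P" for u
    using geo_X_P_bar[OF odd_w Pw that] by auto
  have Qb: "geo X u \<noteq> bar Q" if "odd u" for u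
  proof
    assume "geo X u = bar Q"
    then show False
    proof (rule bar.geo_X_eq_Q[OF that])
      assume "e = 0"
      then show False using kle by simp
    next
      fix n v :: nat assume h: "v = 3 \<or> v = 5" "geo X v = bar P" "l = 1"
      have "w = 3" using Pb[of v] h by auto
      moreover have "(2::nat) ^ m = 2 ^ 1" using h(3) kle by simp
      then have "m = 1" using power_inject_exp[of "2::nat" m 1] by simp
      ultimately show False using not7 by blast
    qed
  qed
  have PQb: "geo X u \<noteq> bar P * bar Q" if "odd u" for u
  proof
    assume "geo X u = bar P * bar Q"
    then show False
    proof (rule bar.geo_X_eq_PQ[OF that])
      assume "bar P = M_2 \<and> bar Q = M_3 \<or> bar P = M_3 \<and> bar Q = M_2"
      then have "degree (bar P) = 3" using degree_M_2_3 by metis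
      then show False using dP w by auto
    next
      fix v assume v: "v = 3 \<or> v = 5" "geo X v = bar P" "bar Q = geo (X ^ v) v"
      then have "e = v - 2" using bar.geo_X_PQ_exponents[OF v] by blast
      then show False using even_e v(1) by auto
    qed
  qed
  have "X_side (bar P) (bar Q) \<subseteq> {(1, 0, 0), (3, 1, 0)}"
  proof (rule bar.X_side_subset)
    fix u assume "odd u" "geo X u = bar P"
    then show "(u, 1, 0) \<in> {(1, 0, 0), (3, 1, 0)}" using Pb(1)[of u] by simp
  qed (use Qb PQb in auto)
  from solve_power_family[OF sX' sX(2) w m not7 sided_mono[OF sY this]] eqs ml kle
  show False by simp
qed

text \<open>The hypothesis \<open>d1 > 0\<close> supplies a sum in \<open>X\<close> that is
  divisible by \<open>Q\<close>. It costs no generality, since \<open>Q\<close> must come from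
  \<open>X\<close> or \<open>Y\<close> and \<open>bar\<close> exchanges them.\<close>

lemma solution_X_side:
  assumes sX: "sided (X_side P Q) a \<alpha> c1 d1" "d1 > 0" and sY: "sided (X_side (bar P) (bar Q)) b \<beta> c2 d2"
    and eqs: "a = \<beta> + i * c + k * d" "b = \<alpha> + j * c + l * d" "c = c1 + c2 + e * d" "d = d1 + d2"
    and ml: "mersenne_like c" "mersenne_like d"
  shows "listed (X ^ a * Y ^ b * P ^ c * Q ^ d)"
proof -
  obtain u x y where "(u, x, y) \<in> X_side P Q" "y > 0" using sided_pos[OF sX] by blast
  then have "odd u \<and> (geo X u = Q \<or> geo X u = P * Q)" by (cases rule: X_side_cases) auto
  then consider "odd u" "geo X u = Q" | "odd u" "geo X u = P * Q" by blast
  then show ?thesis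
  proof cases
    case 1
    from geo_X_eq_Q[OF 1] show ?thesis
    proof cases
      case h: 1
      show ?thesis
      proof (cases "u = 3")
        case True
        then have "degree Q = 2" using degree_geo[of X 3] 1 by simp
        then have "i = 1 \<and> j = 1" using degree_le degree_P pos by linarith
        then have "P = geo X 3" using P_eq geo_X_3_5[of 3] by simp
        then show ?thesis using 1 True P_neq_Q by simp
      next
        case False
        then have "geo X 5 = Q" using h 1 by simp
        then show ?thesis by (rule solution_Q_geo_5[OF _ sX sY eqs ml])
      qed
    next
      case h: (2 m w)
      have False using no_solution_power_family[OF h(1-3) _ h(5-7) sX sY eqs(3,4) ml] h(4) 1 by simp
      then show ?thesis ..
    qed
  next
    case 2
    from geo_X_eq_PQ[OF 2] show ?thesis
    proof cases
      case h: 1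
      show ?thesis by (rule solution_M_2_M_3[OF h(2) sX(1) sY eqs ml(1)])
    next
      case h: (2 w)
      have False using no_solution_self_reciprocal[OF h(1,2,4) sX sY eqs(2-4) ml] .
      then show ?thesis ..
    qed
  qed
qed

text \<open>\<open>e = 1\<close> is neither 0 nor a positive power of two, which excludes
  \<open>Q\<close>. For \<open>P * Q\<close> the degrees rule out \<open>M_2\<close> and
  \<open>M_3\<close>, and the exponents \<open>k\<close>, \<open>l\<close>, \<open>e\<close> rule
  out the self-reciprocal case.\<close>

lemma geo_X_neq_geo_P:
  assumes N: "N = 2 \<or> N = 4" and Q: "geo P (N + 1) = Q"
    and kle: "e = 1" "k = i * (N - 1)" "l = j * (N - 1)" and u: "odd u"
  shows "geo X u \<noteq> Q" "geo X u \<noteq> P * Q"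
proof -
  have dQ: "degree Q = N * degree P" using degree_geo[OF degree_P_pos, of "N + 1"] Q by simp
  show "geo X u \<noteq> Q"
  proof
    assume "geo X u = Q"
    then show False
    proof (rule geo_X_eq_Q[OF u])
      fix m :: nat assume "m > 0" "e = 2 ^ m"
      then have "even e" by simp
      then show False using kle by simp
    qed (use kle in auto)
  qed
  show "geo X u \<noteq> P * Q"
  proof
    assume "geo X u = P * Q"
    then show False
    proof (rule geo_X_eq_PQ[OF u])
      assume "P = M_2 \<and> Q = M_3 \<or> P = M_3 \<and> Q = M_2"
      then have "degree P = 3" "degree Q = 3" using degree_M_2_3 by auto
      then show False using dQ N by auto
    next
      fix v assume v: "v = 3 \<or> v = 5" "geo X v = P" "Q = geo (X ^ v) v"
      show False using geo_X_PQ_exponents[OF v] geo_X_P_exponents[OF v(1,2)] kle v(1) by auto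
    qed
  qed
qed

lemma X_side_geo_P:
  assumes N: "N = 2 \<or> N = 4" and Q: "geo P (N + 1) = Q"
    and kle: "e = 1" "k = i * (N - 1)" "l = j * (N - 1)"
    and sX: "sided (X_side P Q) a \<alpha> c1 d1"
  shows "d1 = 0" "c1 = 1 \<or> even c1" "c1 > 0 \<Longrightarrow> \<exists>u. odd u \<and> geo X u = P"
    "geo X 3 = P \<Longrightarrow> sided {(1, 0, 0), (3, 1, 0)} a \<alpha> c1 d1"
proof -
  note neq = geo_X_neq_geo_P[OF N Q kle]
  have sub: "X_side P Q \<subseteq> {(1, 0, 0), (u, 1, 0)}" if "odd u" "geo X u = P" for u
    by (rule X_side_subset) (use neq geo_X_index[OF that] in auto)
  show "geo X 3 = P \<Longrightarrow> sided {(1, 0, 0), (3, 1, 0)} a \<alpha> c1 d1"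
    by (rule sided_mono[OF sX sub]) auto
  have "d1 = 0 \<and> (c1 = 0 \<or> (\<exists>u. odd u \<and> geo X u = P) \<and> (c1 = 1 \<or> even c1))"
  proof (cases "\<exists>u. odd u \<and> geo X u = P")
    case False
    have "X_side P Q \<subseteq> {(1, 0, 0)}"
      by (rule X_side_subset) (use neq False in blast)+
    then show ?thesis using sided_1[OF sided_mono[OF sX]] by blast
  next
    case True
    then obtain u where u: "odd u" "geo X u = P" by blast
    note s = sided_mono[OF sX sub[OF u]]
    from geo_X_eq_P[OF u] show ?thesis
    proof
      assume "u = 3"
      then show ?thesis using sided_3[of a \<alpha> c1 d1] s True by auto
    next
      assume "u = 5"
      then show ?thesis using sided_5_P[of a \<alpha> c1 d1] s True by auto
    qed
  qed
  then show "d1 = 0" "c1 = 1 \<or> even c1" "c1 > 0 \<Longrightarrow> \<exists>u. odd u \<and> geo X u = P" by auto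
qed


text \<open>\<open>c1 + c2\<close> is odd and at least 3, while each of \<open>c1\<close>,
  \<open>c2\<close> is 1 or even. So both are positive, \<open>P\<close> is a geometric sum in both
  \<open>X\<close> and \<open>Y\<close>, and hence \<open>P = M_1\<close>.\<close>

lemma solution_geo_P:
  assumes N: "N = 2 \<or> N = 4" and Q: "geo P (N + 1) = Q"
    and kle: "e = 1" "k = i * (N - 1)" "l = j * (N - 1)"
    and sX: "sided (X_side P Q) a \<alpha> c1 d1" and sY: "sided (X_side (bar P) (bar Q)) b \<beta> c2 d2"
    and sP: "sided {(1, 0, 0), (N + 1, 1, 0)} c \<gamma> d3 0" "d3 > 0"
    and eqs: "a = \<beta> + i * \<gamma> + k * d" "b = \<alpha> + j * \<gamma> + l * d" "c = c1 + c2 + e * d" "d = d1 + d2 + d3"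
    and ml: "mersenne_like d"
  shows "listed (X ^ a * Y ^ b * P ^ c * Q ^ d)"
proof -
  interpret bar: odd_prime_pair "bar P" "bar Q" j i l k e by (rule odd_prime_pair_bar)
  have Qb: "geo (bar P) (N + 1) = bar Q" using Q bar_geo[of P "N + 1"] by simp
  note 1 = X_side_geo_P[OF N Q kle sX]
  note 2 = bar.X_side_geo_P[OF N Qb kle(1,3,2) sY]
  have d: "d = d3" "d1 = 0" "d2 = 0" using eqs(4) 1(1) 2(1) by simp_all
  have "c1 + c2 = 3 \<or> c1 + c2 = 5 \<or> c1 + c2 = 7"
    using N
  proof
    assume "N = 2"
    then have sP': "sided {(1, 0, 0), (3, 1, 0)} c \<gamma> d3 0" using sP(1) by simp
    have "d = 1 \<and> c = 4 \<or> d = 1 \<and> c = 6 \<or> d = 2 \<and> c = 5"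
      using sided_3[OF sP'] sP(2) d mersenne_likeD[OF ml] by auto
    then show ?thesis using eqs(3) kle(1) by (elim disjE conjE) simp_all
  next
    assume "N = 4"
    then have sP': "sided {(1, 0, 0), (5, 1, 0)} c \<gamma> d3 0" using sP(1) by simp
    have "d = 1 \<and> c = 8 \<or> d = 2 \<and> c = 9"
      using sided_5_P[OF sP'] sP(2) d mersenne_likeD[OF ml] by auto
    then show ?thesis using eqs(3) kle(1) by (elim disjE conjE) simp_all
  qed
  then have "c1 \<noteq> 0 \<and> c2 \<noteq> 0" using 1(2) 2(2) by (intro conjI notI) (elim disjE; simp)+
  then have pos': "c1 > 0" "c2 > 0" by auto
  obtain u where u: "odd u" "geo X u = P" using 1(3)[OF pos'(1)] by (elim exE conjE)
  obtain v where v: "odd v" "geo X v = bar P" using 2(3)[OF pos'(2)] by (elim exE conjE)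
  note uv = u v
  then have "u = 3" "v = 3" using geo_X_P_bar[OF uv] by simp_all
  then have P3: "geo X 3 = P" "geo X 3 = bar P" using uv by simp_all
  then have PM: "P = M_1" using M_eq_geo by simp
  have ij: "i = 1" "j = 1" using geo_X_P_exponents[OF _ P3(1)] by auto
  have sX': "sided {(1, 0, 0), (3, 1, 0)} a \<alpha> c1 0" using 1(4)[OF P3(1)] d by simp
  have sY': "sided {(1, 0, 0), (3, 1, 0)} b \<beta> c2 0" using 2(4)[OF P3(2)] d by simp
  from N show ?thesis
  proof
    assume N2: "N = 2"
    then have sP': "sided {(1, 0, 0), (3, 1, 0)} c \<gamma> d 0" using sP d by simp
    have abcd: "(a = 4 \<and> b = 5 \<or> a = 5 \<and> b = 4) \<and> (c = 4 \<and> d = 1 \<or> c = 5 \<and> d = 2)"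
      by (rule solve_geo_P_3[OF sX' sY' sP' _ _ _ ml pos']) (use eqs ij kle N2 in auto)
    have QM: "Q = S_1" using Q S_1_eq N2 PM by simp
    have "X ^ 4 * Y ^ 5 * P ^ 4 * Q ^ 1 = D_1" "X ^ 4 * Y ^ 5 * P ^ 5 * Q ^ 2 = D_2"
      "X ^ 5 * Y ^ 4 * P ^ 4 * Q ^ 1 = bar D_1" "X ^ 5 * Y ^ 4 * P ^ 5 * Q ^ 2 = bar D_2"
      unfolding PM QM D_1_def D_2_def X_plus_one bar_mult bar_power bar_M bar_X bar_Y
      by (simp_all only: power_one_right mult_ac)
    then show ?thesis using abcd by (elim disjE conjE) (simp_all add: listed_def)
  next
    assume N4: "N = 4"
    then have sP': "sided {(1, 0, 0), (5, 1, 0)} c \<gamma> d 0" using sP d by simp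
    have False
      by (rule solve_geo_P_5[OF sX' sY' sP' _ _ _ ml pos']) (use eqs ij kle N4 in auto)
    then show ?thesis ..
  qed
qed


section \<open>From divisor sums to exponent equations\<close>

lemma sigma_biunitary_X_sided:
  assumes "a > 0" and dvd: "sigma_biunitary (X ^ a) dvd X ^ a' * Y ^ b' * (P ^ c * Q ^ d)"
  obtains \<alpha> p q where "sided (X_side P Q) a \<alpha> p q" "sigma_biunitary (X ^ a) = Y ^ \<alpha> * P ^ p * Q ^ q"
proof -
  obtain K u v \<alpha> where s: "exponent_split a K u v \<alpha>"
    "sigma_biunitary (X ^ a) = (1 + X) ^ \<alpha> * geo X u ^ K * geo X v"
    by (rule sigma_biunitary_split[OF prime_X assms(1)])
  note o = exponent_split_odd[OF s(1)]
  have "geo X u dvd sigma_biunitary (X ^ a)"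
    unfolding s(2) using o by (intro dvd_mult2 dvd_mult dvd_power) simp
  then have "geo X u dvd X ^ a' * Y ^ b' * (P ^ c * Q ^ d)" using dvd by (rule dvd_trans)
  then obtain x y where xy: "x \<le> 1" "y \<le> 1" "geo X u = P ^ x * Q ^ y"
    using geo_X_dvd_cases o by blast
  have "geo X v dvd sigma_biunitary (X ^ a)" unfolding s(2) by simp
  then have "geo X v dvd X ^ a' * Y ^ b' * (P ^ c * Q ^ d)" using dvd by (rule dvd_trans)
  then obtain z t where zt: "z \<le> 1" "t \<le> 1" "geo X v = P ^ z * Q ^ t"
    using geo_X_dvd_cases o by blast
  have "(u, x, y) \<in> X_side P Q" "(v, z, t) \<in> X_side P Q" using xy zt o by (simp_all add: X_side_def)
  then have "sided (X_side P Q) a \<alpha> (K * x + z) (K * y + t)" unfolding sided_def using s(1) by blast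
  moreover have "sigma_biunitary (X ^ a) = Y ^ \<alpha> * P ^ (K * x + z) * Q ^ (K * y + t)"
    unfolding s(2) xy(3) zt(3) one_plus_X
    by (simp only: power_mult_distrib power_add power_mult[symmetric] mult_ac)
  ultimately show ?thesis using that by blast
qed

text \<open>This is the dichotomy of the classification: if all sums in \<open>P\<close> are
  trivial, \<open>c\<close> is restricted like \<open>d\<close> and the \<open>C\<close> solutions
  result; otherwise \<open>Q\<close> is a sum in \<open>P\<close>, which leads to \<open>D_1\<close>
  and \<open>D_2\<close>.\<close>

lemma sigma_biunitary_P_sided:
  assumes "c > 0" and dvd: "sigma_biunitary (P ^ c) dvd X ^ a' * Y ^ b' * (P ^ c' * Q ^ d')"
  obtains \<gamma> where "sided {(1, 0, 0)} c \<gamma> 0 0" "sigma_biunitary (P ^ c) = X ^ (i * \<gamma>) * Y ^ (j * \<gamma>)"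
  | \<gamma> q N where "sided {(1, 0, 0), (N + 1, 1, 0)} c \<gamma> q 0" "q > 0"
      "sigma_biunitary (P ^ c) = X ^ (i * \<gamma>) * Y ^ (j * \<gamma>) * Q ^ q"
      "N = 2 \<or> N = 4" "geo P (N + 1) = Q" "e = 1" "k = i * (N - 1)" "l = j * (N - 1)"
proof -
  obtain K u v \<gamma> where s: "exponent_split c K u v \<gamma>"
    "sigma_biunitary (P ^ c) = (1 + P) ^ \<gamma> * geo P u ^ K * geo P v"
    by (rule sigma_biunitary_split[OF prime_P assms(1)])
  note o = exponent_split_odd[OF s(1)]
  have "geo P u dvd sigma_biunitary (P ^ c)"
    unfolding s(2) using o by (intro dvd_mult2 dvd_mult dvd_power) simp
  then have du: "geo P u dvd X ^ a' * Y ^ b' * (P ^ c' * Q ^ d')" using dvd by (rule dvd_trans)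
  have "geo P v dvd sigma_biunitary (P ^ c)" unfolding s(2) by simp
  then have dv: "geo P v dvd X ^ a' * Y ^ b' * (P ^ c' * Q ^ d')" using dvd by (rule dvd_trans)
  have "1 + P = X ^ i * Y ^ j" by (simp add: P_eq)
  then have s': "sigma_biunitary (P ^ c) = X ^ (i * \<gamma>) * Y ^ (j * \<gamma>) * geo P u ^ K * geo P v"
    unfolding s(2) by (simp only: power_mult_distrib power_mult)
  define good where "good N \<longleftrightarrow> (N = 2 \<or> N = 4) \<and> geo P (N + 1) = Q \<and> e = 1 \<and>
    k = i * (N - 1) \<and> l = j * (N - 1)" for N
  have g: "w = 1 \<or> (\<exists>N. w = N + 1 \<and> good N)"
    if "odd w" "geo P w dvd X ^ a' * Y ^ b' * (P ^ c' * Q ^ d')" for w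
    using that
  proof (rule geo_P_dvd_cases)
    fix N assume "N = 2 \<or> N = 4" "w = N + 1" "geo P w = Q" "e = 1" "k = i * (N - 1)" "l = j * (N - 1)"
    then have "w = N + 1 \<and> good N" unfolding good_def by blast
    then show ?thesis by blast
  qed simp
  have gu: "u = 1 \<or> (\<exists>N. u = N + 1 \<and> good N)" and gv: "v = 1 \<or> (\<exists>N. v = N + 1 \<and> good N)"
    using g[OF _ du] g[OF _ dv] o by simp_all
  show ?thesis
  proof (cases "u = 1 \<and> v = 1")
    case True
    then have "exponent_split c K 1 1 \<gamma>" using s(1) by simp
    then have "sided {(1, 0, 0)} c \<gamma> 0 0" unfolding sided_def by force
    moreover have "sigma_biunitary (P ^ c) = X ^ (i * \<gamma>) * Y ^ (j * \<gamma>)" using s' True by simp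
    ultimately show ?thesis by (rule that(1))
  next
    case False
    then obtain N where N: "good N" using gu gv by blast
    then have N': "N = 2 \<or> N = 4" "geo P (N + 1) = Q" "e = 1" "k = i * (N - 1)" "l = j * (N - 1)"
      by (simp_all add: good_def)
    \<comment> \<open>\<open>u\<close> and \<open>v\<close> may both be nontrivial, but then both
      sums equal \<open>Q\<close>, so their indices coincide and one \<open>N\<close> serves for
      both.\<close>
    have uniq: "w = N + 1" if "w = M + 1" "good M" for w M
    proof -
      have "geo P (M + 1) = geo P (N + 1)" using that(2) N by (simp add: good_def)
      then show ?thesis using geo_eq_geo_iff[OF degree_P_pos, of "M + 1" "N + 1"] that(1) by simp
    qed
    define f where "f w = (if w = 1 then 0 else 1 :: nat)" for w :: nat
    have N1: "N + 1 \<noteq> 1" using N'(1) by auto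
    have f: "(w, f w, 0) \<in> {(1, 0, 0), (N + 1, 1, 0)} \<and> geo P w = Q ^ f w"
      if "w = 1 \<or> (\<exists>M. w = M + 1 \<and> good M)" for w
    proof (cases "w = 1")
      case False
      then have "w = N + 1" using that uniq by blast
      then show ?thesis using N1 N'(2) by (simp add: f_def)
    qed (simp add: f_def)
    note u = f[OF gu, THEN conjunct1] f[OF gu, THEN conjunct2]
    note v = f[OF gv, THEN conjunct1] f[OF gv, THEN conjunct2]
    have "sided {(1, 0, 0), (N + 1, 1, 0)} c \<gamma> (K * f u + f v) 0"
      unfolding sided_def by (intro exI conjI, rule s(1), rule u(1), rule v(1)) simp_all
    moreover have "K * f u + f v > 0" using False o by (auto simp: f_def)
    moreover have "sigma_biunitary (P ^ c) = X ^ (i * \<gamma>) * Y ^ (j * \<gamma>) * Q ^ (K * f u + f v)"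
      unfolding s' u(2) v(2) by (simp only: power_add power_mult[symmetric] mult_ac)
    ultimately show ?thesis using N' by (rule that(2))
  qed
qed

lemma sigma_biunitary_Q:
  assumes "d > 0" and dvd: "sigma_biunitary (Q ^ d) dvd X ^ a' * Y ^ b' * (P ^ c' * Q ^ d')"
  shows "mersenne_like d" "sigma_biunitary (Q ^ d) = X ^ (k * d) * Y ^ (l * d) * P ^ (e * d)"
proof -
  obtain K u v \<delta> where s: "exponent_split d K u v \<delta>"
    "sigma_biunitary (Q ^ d) = (1 + Q) ^ \<delta> * geo Q u ^ K * geo Q v"
    by (rule sigma_biunitary_split[OF prime_Q assms(1)])
  note o = exponent_split_odd[OF s(1)]
  have "geo Q u dvd sigma_biunitary (Q ^ d)"
    unfolding s(2) using o by (intro dvd_mult2 dvd_mult dvd_power) simp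
  then have u: "u = 1" using dvd o by (meson dvd_trans geo_Q_dvd_cases)
  have "geo Q v dvd sigma_biunitary (Q ^ d)" unfolding s(2) by simp
  then have v: "v = 1" using dvd o by (meson dvd_trans geo_Q_dvd_cases)
  have "exponent_split d K 1 1 \<delta>" using s(1) u v by simp
  then have "sided {(1, 0, 0)} d \<delta> 0 0" unfolding sided_def by force
  then have d: "d = \<delta>" "mersenne_like d" using sided_1 by blast+
  show "mersenne_like d" by (rule d(2))
  have "1 + Q = X ^ k * Y ^ l * P ^ e" by (simp add: Q_eq)
  then show "sigma_biunitary (Q ^ d) = X ^ (k * d) * Y ^ (l * d) * P ^ (e * d)"
    using s(2) u v d(1) by (simp add: power_mult_distrib power_mult)
qed

lemma perfect_listed:
  assumes pos: "a > 0" "b > 0" "c > 0" "d > 0"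
    and eq: "sigma_biunitary (X ^ a) * sigma_biunitary (Y ^ b) * sigma_biunitary (P ^ c) *
      sigma_biunitary (Q ^ d) = X ^ a * Y ^ b * P ^ c * Q ^ d"
  shows "listed (X ^ a * Y ^ b * P ^ c * Q ^ d)"
proof -
  interpret bar: odd_prime_pair "bar P" "bar Q" j i l k e by (rule odd_prime_pair_bar)
  define A where "A = X ^ a * Y ^ b * (P ^ c * Q ^ d)"
  have A: "A = sigma_biunitary (X ^ a) * sigma_biunitary (Y ^ b) * sigma_biunitary (P ^ c) *
      sigma_biunitary (Q ^ d)"
    unfolding A_def eq by (simp only: mult.assoc)
  have dvd: "sigma_biunitary (X ^ a) dvd A" "sigma_biunitary (Y ^ b) dvd A"
    "sigma_biunitary (P ^ c) dvd A" "sigma_biunitary (Q ^ d) dvd A"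
    unfolding A by (rule dvd_mult2 dvd_triv_left dvd_triv_right)+
  have barA: "bar A = X ^ b * Y ^ a * (bar P ^ c * bar Q ^ d)"
    unfolding A_def by (simp only: bar_mult bar_power bar_X bar_Y mult_ac)
  obtain \<alpha> c1 d1 where sX: "sided (X_side P Q) a \<alpha> c1 d1" "sigma_biunitary (X ^ a) = Y ^ \<alpha> * P ^ c1 * Q ^ d1"
    by (rule sigma_biunitary_X_sided[OF pos(1) dvd(1)[unfolded A_def]])
  have bX: "bar (sigma_biunitary (Y ^ b)) = sigma_biunitary (X ^ b)"
    using bar_sigma_biunitary_prime_power[OF prime_Y pos(2)] by (simp only: bar_Y)
  have "sigma_biunitary (X ^ b) dvd bar A" unfolding bX[symmetric] bar_dvd_iff by (rule dvd(2))
  then have dvdb: "sigma_biunitary (X ^ b) dvd X ^ b * Y ^ a * (bar P ^ c * bar Q ^ d)" unfolding barA .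
  obtain \<beta> c2 d2 where sY: "sided (X_side (bar P) (bar Q)) b \<beta> c2 d2"
    and "sigma_biunitary (X ^ b) = Y ^ \<beta> * bar P ^ c2 * bar Q ^ d2"
    by (rule bar.sigma_biunitary_X_sided[OF pos(2) dvdb])
  then have "sigma_biunitary (Y ^ b) = bar (Y ^ \<beta> * bar P ^ c2 * bar Q ^ d2)" using bX by (metis bar_bar)
  then have sY2: "sigma_biunitary (Y ^ b) = X ^ \<beta> * P ^ c2 * Q ^ d2"
    by (simp only: bar_mult bar_power bar_bar bar_Y)
  note sQ = sigma_biunitary_Q[OF pos(4) dvd(4)[unfolded A_def]]
  from sigma_biunitary_P_sided[OF pos(3) dvd(3)[unfolded A_def]] show ?thesis
  proof cases
    case (1 \<gamma>)
    have \<gamma>: "\<gamma> = c" "mersenne_like c" using sided_1[OF 1(1)] by auto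
    have "X ^ a * Y ^ b * P ^ c * Q ^ d = X ^ (\<beta> + i * c + k * d) * Y ^ (\<alpha> + j * c + l * d) *
      P ^ (c1 + c2 + e * d) * Q ^ (d1 + d2)"
      unfolding eq[symmetric] sX(2) sY2 sQ(2) 1(2)[unfolded \<gamma>(1)] by (simp only: power_add mult_ac)
    from exponents_eq[OF this] have eqs: "a = \<beta> + i * c + k * d" "b = \<alpha> + j * c + l * d"
      "c = c1 + c2 + e * d" "d = d1 + d2"
      by blast+
    show ?thesis
    proof (cases "d1 = 0")
      case False
      then show ?thesis using solution_X_side[OF sX(1) _ sY eqs \<gamma>(2) sQ(1)] by simp
    next
      case True
      \<comment> \<open>\<open>Q\<close> now comes from the \<open>Y\<close> side, and the previous
        case applies to the pair \<open>bar P\<close>, \<open>bar Q\<close>.\<close>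
      then have d2: "d2 > 0" using eqs(4) pos(4) by simp
      have sX': "sided (X_side (bar (bar P)) (bar (bar Q))) a \<alpha> c1 d1" unfolding bar_bar by (rule sX(1))
      have eqs': "c = c2 + c1 + e * d" "d = d2 + d1" using eqs(3,4) by linarith+
      have "listed (X ^ b * Y ^ a * bar P ^ c * bar Q ^ d)"
        by (rule bar.solution_X_side[OF sY d2 sX' eqs(2,1) eqs' \<gamma>(2) sQ(1)])
      then have "listed (bar A)" unfolding barA by (simp only: mult.assoc)
      then show ?thesis unfolding listed_bar A_def by (simp only: mult.assoc)
    qed
  next
    case (2 \<gamma> d3 N)
    have "X ^ a * Y ^ b * P ^ c * Q ^ d = X ^ (\<beta> + i * \<gamma> + k * d) * Y ^ (\<alpha> + j * \<gamma> + l * d) *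
      P ^ (c1 + c2 + e * d) * Q ^ (d1 + d2 + d3)"
      unfolding eq[symmetric] sX(2) sY2 sQ(2) 2(3) by (simp only: power_add mult_ac)
    from exponents_eq[OF this] have eqs: "a = \<beta> + i * \<gamma> + k * d" "b = \<alpha> + j * \<gamma> + l * d"
      "c = c1 + c2 + e * d" "d = d1 + d2 + d3"
      by blast+
    show ?thesis by (rule solution_geo_P[OF 2(4-8) sX(1) sY 2(1,2) eqs sQ(1)])
  qed
qed

end

section \<open>The classification\<close>

lemma dvd_four_prime_powers:
  assumes "prime P" "prime Q" "D dvd X ^ a * Y ^ b * P ^ c * Q ^ d"
  obtains i j r s where "D = X ^ i * Y ^ j * P ^ r * Q ^ s"
proof -
  obtain D' D4 where 1: "D = D' * D4" "D' dvd X ^ a * Y ^ b * P ^ c" "D4 dvd Q ^ d"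
    using division_decomp[OF assms(3)] by blast
  obtain D'' D3 where 2: "D' = D'' * D3" "D'' dvd X ^ a * Y ^ b" "D3 dvd P ^ c"
    using division_decomp[OF 1(2)] by blast
  obtain D1 D2 where 3: "D'' = D1 * D2" "D1 dvd X ^ a" "D2 dvd Y ^ b"
    using division_decomp[OF 2(2)] by blast
  obtain i where "D1 = X ^ i" using dvd_prime_power_bit_poly[OF prime_X 3(2)] by blast
  moreover obtain j where "D2 = Y ^ j" using dvd_prime_power_bit_poly[OF prime_Y 3(3)] by blast
  moreover obtain r where "D3 = P ^ r" using dvd_prime_power_bit_poly[OF assms(1) 2(3)] by blast
  moreover obtain s where "D4 = Q ^ s" using dvd_prime_power_bit_poly[OF assms(2) 1(3)] by blast
  ultimately show ?thesis using that 1(1) 2(1) 3(1) by blast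
qed

lemma prime_not_dvd_one_plus: "prime p \<Longrightarrow> \<not> p dvd 1 + (p :: bit poly)"
  by (metis dvd_add_left_iff dvd_refl not_prime_unit)

lemma odd_prime_eval:
  assumes "prime p" "p \<noteq> X" "p \<noteq> Y"
  shows "poly p 0 = 1" "poly p 1 = 1"
  using assms primes_dvd_imp_eq[OF prime_X assms(1)] primes_dvd_imp_eq[OF prime_Y assms(1)]
    bit_poly_eval_cases[of p] X_dvd_iff[of p] Y_dvd_iff[of p] by metis+

text \<open>A prime never divides its successor, which removes \<open>P\<close> from
  \<open>1 + P\<close> and \<open>Q\<close> from \<open>1 + Q\<close>. Evaluation at 0 and 1 makes
  the exponents of \<open>X\<close> and \<open>Y\<close> positive, so a factor \<open>Q\<close> in
  \<open>1 + P\<close> would make its degree exceed \<open>degree P\<close>.\<close>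

lemma odd_prime_pairI:
  assumes P: "prime P" "P \<noteq> X" "P \<noteq> Y" and Q: "prime Q" "Q \<noteq> X" "Q \<noteq> Y"
    and "P \<noteq> Q" "degree P \<le> degree Q"
    and dvd: "1 + P dvd X ^ a * Y ^ b * P ^ c * Q ^ d" "1 + Q dvd X ^ a * Y ^ b * P ^ c * Q ^ d"
  shows "\<exists>i j k l e. odd_prime_pair P Q i j k l e"
proof -
  note evP = odd_prime_eval[OF P] and evQ = odd_prime_eval[OF Q]
  have nz: "P \<noteq> 0" "Q \<noteq> 0" using P Q by auto
  obtain i j r s where 1: "1 + P = X ^ i * Y ^ j * P ^ r * Q ^ s"
    using dvd_four_prime_powers[OF P(1) Q(1) dvd(1)] by blast
  obtain k l e t where 2: "1 + Q = X ^ k * Y ^ l * P ^ e * Q ^ t"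
    using dvd_four_prime_powers[OF P(1) Q(1) dvd(2)] by blast
  have "r = 0"
  proof (rule ccontr)
    assume "r \<noteq> 0"
    then have "P dvd 1 + P" unfolding 1 by (intro dvd_mult2 dvd_mult dvd_power) simp
    then show False using prime_not_dvd_one_plus[OF P(1)] by blast
  qed
  have "t = 0"
  proof (rule ccontr)
    assume "t \<noteq> 0"
    then have "Q dvd 1 + Q" unfolding 2 by (intro dvd_mult dvd_power) simp
    then show False using prime_not_dvd_one_plus[OF Q(1)] by blast
  qed
  have i: "i > 0"
  proof (rule ccontr)
    assume "\<not> i > 0"
    then show False using arg_cong[OF 1, of "\<lambda>p. poly p 0"] evP evQ by simp
  qed
  have j: "j > 0"
  proof (rule ccontr)
    assume "\<not> j > 0"
    then show False using arg_cong[OF 1, of "\<lambda>p. poly p 1"] evP evQ by simp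
  qed
  have k: "k > 0"
  proof (rule ccontr)
    assume "\<not> k > 0"
    then show False using arg_cong[OF 2, of "\<lambda>p. poly p 0"] evP evQ by simp
  qed
  have l: "l > 0"
  proof (rule ccontr)
    assume "\<not> l > 0"
    then show False using arg_cong[OF 2, of "\<lambda>p. poly p 1"] evP evQ by simp
  qed
  have "s = 0"
  proof (rule ccontr)
    assume "s \<noteq> 0"
    have "degree P > 0" using P(1) by (rule prime_degree_pos)
    then have "degree (1 + P) = degree P" by (simp add: degree_add_eq_right)
    moreover have "degree (X ^ i * Y ^ j * P ^ r * Q ^ s) = i + j + r * degree P + s * degree Q"
      using nz by (simp add: degree_mult_eq degree_power_eq)
    moreover have "degree Q \<le> s * degree Q" using \<open>s \<noteq> 0\<close> by simp
    ultimately show False using 1 i assms(8) by simp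
  qed
  have "P = 1 + X ^ i * Y ^ j"
    using 1 \<open>r = 0\<close> \<open>s = 0\<close> by (metis add.commute bit_poly_add_eq_iff mult.right_neutral power_0)
  moreover have "Q = 1 + X ^ k * Y ^ l * P ^ e"
    using 2 \<open>t = 0\<close> by (metis add.commute bit_poly_add_eq_iff mult.right_neutral power_0)
  ultimately have "odd_prime_pair P Q i j k l e"
    using assms i j k l by (intro odd_prime_pair.intro)
  then show ?thesis by blast
qed

theorem theorem1p2:
  fixes A :: "bit poly"
  assumes "biunitary_perfect A" and "omega A = 4"
  shows "A \<in> {C_8, C_9, C_10, C_11, C_12, C_13, D_1, D_2} \<or>
         bar A \<in> {C_8, C_9, C_10, C_11, C_12, C_13, D_1, D_2}"
proof -
  have A0: "A \<noteq> 0" and perf: "sigma_biunitary A = A" using assms(1) by (simp_all add: biunitary_perfect_def)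
  define F where "F = prime_factors A"
  define m where "m p = multiplicity p A" for p
  have F: "p \<in> F \<longleftrightarrow> prime p \<and> p dvd A" for p
    unfolding F_def using A0 by (simp add: prime_factors_dvd)
  have fin: "finite F" by (simp add: F_def)
  have "F = {P. irreducible P \<and> P dvd A}" using F prime_bit_poly_iff by auto
  then have card: "card F = 4" using assms(2) by (simp add: omega_def)
  have mpos: "m p > 0" if "p \<in> F" for p
    using that F A0 prime_elem_multiplicity_eq_zero_iff[of p A] by (auto simp: m_def)
  have AF: "A = (\<Prod>p\<in>F. p ^ m p)"
    using prod_prime_factors[OF A0] by (simp add: F_def m_def)
  have "sigma_biunitary (\<Prod>p\<in>F. p ^ m p) = (\<Prod>p\<in>F. sigma_biunitary (p ^ m p))"
    by (rule sigma_biunitary_prod_prime_powers[OF fin]) (use F in blast)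
  then have AS: "A = (\<Prod>p\<in>F. sigma_biunitary (p ^ m p))" unfolding AF[symmetric] perf .
  have succ: "1 + p dvd A" if "p \<in> F" for p
  proof -
    have "1 + p dvd sigma_biunitary (p ^ m p)"
      using that F mpos[OF that] by (simp add: sigma_biunitary_prime_power mult.assoc)
    also have "\<dots> dvd A" by (subst AS) (rule dvd_prodI[OF fin that])
    finally show ?thesis .
  qed
  \<comment> \<open>Some prime \<open>p\<close> of \<open>A\<close> differs from \<open>X\<close>
    and \<open>Y\<close>. Then \<open>1 + p\<close> vanishes at 0 and 1 and divides
    \<open>A\<close>, so both linear polynomials belong to \<open>F\<close>.\<close>
  have "card (F - {X, Y}) \<ge> 2"
    using diff_card_le_card_Diff[of "{X, Y}" F] card by simp
  then have "F - {X, Y} \<noteq> {}" by (metis card.empty not_numeral_le_zero)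
  then obtain p where p: "p \<in> F" "p \<noteq> X" "p \<noteq> Y" by blast
  note ev = odd_prime_eval[of p]
  have "X dvd 1 + p" "Y dvd 1 + p" using ev p F by (simp_all add: X_dvd_iff Y_dvd_iff)
  then have "X \<in> F" "Y \<in> F" using succ[OF p(1)] F by (auto intro: dvd_trans)
  then have "card (F - {X, Y}) = 2" using card fin by (simp add: card_Diff_subset)
  then obtain R S where RS: "F - {X, Y} = {R, S}" "R \<noteq> S" by (auto simp: card_2_iff)
  obtain P Q where PQ: "F - {X, Y} = {P, Q}" "P \<noteq> Q" "degree P \<le> degree Q"
  proof (cases "degree R \<le> degree S")
    case False
    then show ?thesis using that[of S R] RS by auto
  qed (use that RS in blast)
  have FXY: "F = {X, Y, P, Q}" using PQ(1) \<open>X \<in> F\<close> \<open>Y \<in> F\<close> by blast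
  have neq: "P \<noteq> X" "P \<noteq> Y" "Q \<noteq> X" "Q \<noteq> Y" using PQ(1) by blast+
  have pr: "prime P" "prime Q" using F FXY by blast+
  have prod: "(\<Prod>p\<in>F. f p) = f X * f Y * f P * f Q" for f :: "bit poly \<Rightarrow> bit poly"
    unfolding FXY using neq PQ(2) by (simp add: mult.assoc)
  have A: "A = X ^ m X * Y ^ m Y * P ^ m P * Q ^ m Q" using AF unfolding prod .
  have dvd: "1 + P dvd X ^ m X * Y ^ m Y * P ^ m P * Q ^ m Q" "1 + Q dvd X ^ m X * Y ^ m Y * P ^ m P * Q ^ m Q"
    unfolding A[symmetric] using succ[of P] succ[of Q] FXY by blast+
  obtain i j k l e where "odd_prime_pair P Q i j k l e"
    using odd_prime_pairI[OF pr(1) neq(1,2) pr(2) neq(3,4) PQ(2,3) dvd] by blast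
  then interpret odd_prime_pair P Q i j k l e .
  have "m X > 0" "m Y > 0" "m P > 0" "m Q > 0" using mpos FXY by blast+
  then have "listed (X ^ m X * Y ^ m Y * P ^ m P * Q ^ m Q)"
    by (rule perfect_listed) (rule trans[OF AS[unfolded prod, symmetric] A])
  then have "listed A" unfolding A[symmetric] .
  then show ?thesis by (simp only: listed_def)
qed

end
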